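(* The following evaluations hold: $$\begin{aligned} \frac{[\Gamma(\frac{1}{4})]^8}{32\sqrt{2}\pi^2}={}&\frac{1}{3}\int_0^1\frac{[\mathbf K(\sqrt{1-k^2})]^3}{\sqrt{k}(1-k^2)^{3/4}}\,dk=\int_0^1\frac{[\mathbf K(\sqrt{1-k^2})]^2\mathbf K(k)}{\sqrt{k}(1-k^2)^{3/4}}\,dk=\int_0^1\frac{\mathbf K(\sqrt{1-k^2})[\mathbf K(k)]^2}{\sqrt{k}(1-k^2)^{3/4}}\,dk\\ ={}&\int_0^1\frac{[\mathbf K(\sqrt{1-t})]^3 }{6t^{3/4}(1-t)^{3/4}}\,dt=\int_0^1\frac{[\mathbf K(\sqrt{1-t})]^2\mathbf K(\sqrt{t}) }{2t^{3/4}(1-t)^{3/4}}\,dt=\int_0^1\frac{\mathbf K(\sqrt{1-t})[\mathbf K(\sqrt{t})]^{2} }{2t^{3/4}(1-t)^{3/4}}\,dt\\ ={}&\frac{\sqrt2\pi^3}{48}\int_{-1}^1\frac{[P_{-1/2}(x)]^3}{(1-x^{2})^{3/4}}\,dx=\frac{\sqrt{2}\pi^{3}}{16}\int_{-1}^1\frac{[P_{-1/2}(x)]^2P_{-1/2}(-x)}{(1-x^{2})^{3/4}}\,dx=\frac{\sqrt{2}\pi^{3}}{16}\int_{-1}^1\frac{P_{-1/2}(x)[P_{-1/2}(-x)]^2}{(1-x^{2})^{3/4}}\,dx. \end{aligned}$$ This is a special case of the following identity, which holds for every complex $\nu$ with $\operatorname{Re}\nu>-1$: $$\int_{-1}^1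\frac{[P_{\nu}(x)]^3}{(1-x^{2})^{(1-\nu)/2}}\,dx=[3-2\cos(\nu\pi)]\int_{-1}^1\frac{[P_{\nu}(x)]^2P_{\nu}(-x)}{(1-x^{2})^{(1-\nu)/2}}\,dx.$$
   Context: For $\nu\in\mathbb C$, $P_\nu$ denotes the Legendre function of the first kind of degree $\nu$, defined on $(-1,1]$ by $P_{\nu}(1-2z)={}_2F_1(-\nu,\nu+1;1;z)$, where ${}_2F_1$ is the Gauss hypergeometric function. $\mathbf K(k)=\int_0^{\pi/2}(1-k^2\sin^2\theta)^{-1/2}\,d\theta$ is the complete elliptic integral of the first kind with modulus $k$; one has $P_{-1/2}(x)=\frac{2}{\pi}\mathbf K(\sqrt{(1-x)/2})$ for $-1<x\leq1$. $\Gamma$ is the Euler gamma function. *)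

theory Defs
  imports "HOL-Analysis.Analysis"
begin

(* The Gauss series 2F1(a, b; c; z), convergent for norm z < 1. The trailing 1 of fps_hypergeo
   is the scaling of the argument; the factor n! is already part of fps_hypergeo. *)
definition hypergeo_2F1 :: "complex \<Rightarrow> complex \<Rightarrow> complex \<Rightarrow> complex \<Rightarrow> complex" where
  "hypergeo_2F1 a b c z = eval_fps (fps_hypergeo [a, b] [c] 1) z"

(* Only meaningful for -1 < x \<le> 1, where the argument (1 - x) / 2 of the series lies in [0, 1). *)
definition legendre_P :: "complex \<Rightarrow> real \<Rightarrow> complex" where
  "legendre_P \<nu> x = hypergeo_2F1 (- \<nu>) (\<nu> + 1) 1 (complex_of_real ((1 - x) / 2))"

(* The argument is the modulus k, not the parameter k^2; only meaningful for \<bar>k\<bar> < 1. *)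
definition elliptic_K :: "real \<Rightarrow> real" where
  "elliptic_K k = (LBINT \<theta>:{0..pi/2}. (1 - k\<^sup>2 * (sin \<theta>)\<^sup>2) powr (- 1 / 2))"

end

theory Submission
  imports Defs "HOL-Complex_Analysis.Complex_Analysis"
begin

text \<open>
  Write \<open>s = \<nu> + 1\<close> with \<open>0 < s < 1\<close> and put \<open>F\<^sub>s(u) = \<integral>(u + cosh t)\<^sup>-\<^sup>s dt\<close> and
  \<open>R\<^sub>s(y) = \<integral>(sinh t - y)\<^sub>+\<^sup>-\<^sup>s dt\<close>, integrals over the real line. Euler's integral gives
  \<open>R\<^sub>s(y) = \<Gamma>(s) \<Gamma>(1 - s) (1 + y\<^sup>2)\<^sup>-\<^sup>s\<^sup>/\<^sup>2 P\<^sub>\<nu>(y / sqrt(1 + y\<^sup>2))\<close>, and shifting the contour by \<open>\<i> \<pi> / 2\<close>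
  turns \<open>F\<^sub>s(\<i> y)\<close> into a combination of \<open>R\<^sub>s(y)\<close> and \<open>R\<^sub>s(-y)\<close>. As \<open>F\<^sub>s\<^sup>2 F\<^sub>1\<^sub>-\<^sub>s\<close> is holomorphic on the
  right half-plane and decays faster than \<open>1 / \<bar>u\<bar>\<close>, its integral over the imaginary axis vanishes; expanding
  this in \<open>P\<^sub>\<nu>(\<plusminus>x)\<close> is the ratio identity for \<open>-1 < \<nu> < 0\<close>, and both sides are holomorphic in
  \<open>\<nu>\<close> for \<open>Re \<nu> > -1\<close>.

  For \<open>s = 1/2\<close> the integral of \<open>F(\<i> y)\<^sup>2 F(-\<i> y)\<close> is folded onto the cuts \<open>[cosh t, \<infinity>)\<close> of
  \<open>(cosh t - u)\<^sup>-\<^sup>1\<^sup>/\<^sup>2\<close>, which gives \<open>2 \<integral>\<integral> F(u)\<^sup>2 (u - cosh t)\<^sup>-\<^sup>1\<^sup>/\<^sup>2 du dt\<close> over \<open>u > cosh t\<close>. In the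
  horocyclic coordinates \<open>u = (x\<^sup>2 + y\<^sup>2 + 1) / (2 y)\<close>, \<open>y = exp t\<close> of the hyperbolic plane, \<open>F(u)\<close> is an
  average over boundary points \<open>b\<close> of square roots of the Poisson kernel, and the integral factors into beta integrals.
\<close>

section \<open>Change of variables, contour shifts and parametric integrals\<close>

text \<open>Why the factors F_s, F_s, F_(1-s): P_\<nu> is unchanged under \<nu> -> -\<nu> - 1, so
  F_s and F_(1-s) have boundary values in the same pair P_\<nu>(x), P_\<nu>(-x). Their powers of 1 +
  y^2 multiply to the exponent -(s + 1)/2, which x = y / sqrt(1 + y^2) turns into the weight of the
  theorem. Reflecting y leaves only two unknown integrals, hence one linear relation: a ratio, but
  no absolute value. Both s and 1 - s must lie in (0, 1) for the singularities to be integrable, so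
  the contour argument is confined to -1 < \<nu> < 0.

  The absolute value needs a second relation. Replacing one F(\<i> y) by F(-\<i> y) brings
  singularities into the right half-plane, and the integral becomes one over the jumps instead of 0.
  At s = 1/2 these jumps are positive up to a constant phase, so Tonelli's theorem reorders the
  hyperbolic integral freely, and every piece reduces to F(0), a beta integral equal to Gamma(1/4)^2
  / sqrt(2 pi).\<close>

lemma set_integrable_lebesgue_iff_lborel:
  fixes f :: "'a::euclidean_space \<Rightarrow> 'b::euclidean_space"
  assumes "set_borel_measurable borel S f"
  shows "set_integrable lebesgue S f \<longleftrightarrow> set_integrable lborel S f"
  using assms unfolding set_integrable_def set_borel_measurable_def
  by (intro integrable_completion) simp

text \<open>The substitution rule for absolutely integrable functions on Lebesgue sets carries over
  to \<open>lborel\<close> because the integrands are Borel measurable. The equivalence is part of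
  the conclusion since several uses must transfer integrability together with the value.\<close>

lemma set_integrable_change_of_variables:
  fixes f :: "real \<Rightarrow> 'a::euclidean_space" and g h :: "real \<Rightarrow> real"
  assumes S: "S \<in> sets borel" and gS: "g ` S \<in> sets borel"
    and der: "\<And>x. x \<in> S \<Longrightarrow> (g has_real_derivative h x) (at x)"
    and inj: "inj_on g S"
    and f [measurable]: "f \<in> borel_measurable borel"
    and g [measurable]: "g \<in> borel_measurable borel"
    and h [measurable]: "h \<in> borel_measurable borel"
  shows "set_integrable lborel (g ` S) f \<longleftrightarrow> set_integrable lborel S (\<lambda>x. \<bar>h x\<bar> *\<^sub>R f (g x))"
    and "(LINT y:g ` S|lborel. f y) = (LINT x:S|lborel. \<bar>h x\<bar> *\<^sub>R f (g x))"
proof -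
  note S [measurable] gS [measurable]
  have S': "S \<in> sets lebesgue" using S by simp
  have der': "(g has_real_derivative h x) (at x within S)" if "x \<in> S" for x
    using der[OF that] by (rule has_field_derivative_at_within)
  have m1: "set_borel_measurable borel (g ` S) f" "set_borel_measurable borel S (\<lambda>x. \<bar>h x\<bar> *\<^sub>R f (g x))"
    unfolding set_borel_measurable_def by measurable
  have iff: "f absolutely_integrable_on g ` S \<longleftrightarrow> (\<lambda>x. \<bar>h x\<bar> *\<^sub>R f (g x)) absolutely_integrable_on S"
    by (rule absolutely_integrable_change_of_variables_real[OF S' der' inj])
  show i2: "set_integrable lborel (g ` S) f \<longleftrightarrow> set_integrable lborel S (\<lambda>x. \<bar>h x\<bar> *\<^sub>R f (g x))"
    using iff m1 by (simp add: set_integrable_lebesgue_iff_lborel)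
  show "(LINT y:g ` S|lborel. f y) = (LINT x:S|lborel. \<bar>h x\<bar> *\<^sub>R f (g x))"
  proof (cases "set_integrable lborel (g ` S) f")
    case True
    then have a: "f absolutely_integrable_on g ` S"
      using m1 by (simp add: set_integrable_lebesgue_iff_lborel)
    have "integral S (\<lambda>x. \<bar>h x\<bar> *\<^sub>R f (g x)) = integral (g ` S) f"
      using has_absolute_integral_change_of_variables_real[OF S' der' inj, of f] a by blast
    then show ?thesis
      using set_borel_integral_eq_integral(2) True i2 by metis
  next
    \<comment> \<open>Without integrability both Bochner integrals are 0 by convention, so the
      equation holds here as well.\<close>
    case False
    then show ?thesis
      using i2 by (simp add: set_lebesgue_integral_def set_integrable_def not_integrable_integral_eq)
  qed
qed

text \<open>The case distinction makes one equation serve two purposes: reading integrability off a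
  finite value, and passing from a nonnegative integral to a Bochner integral.\<close>

lemma nn_integral_eq_set_integral:
  fixes f :: "real \<Rightarrow> real"
  assumes [measurable]: "S \<in> sets borel" "f \<in> borel_measurable borel"
    and nn: "\<And>x. x \<in> S \<Longrightarrow> 0 \<le> f x"
  shows "(\<integral>\<^sup>+x\<in>S. ennreal (f x) \<partial>lborel) =
    (if set_integrable lborel S f then ennreal (LINT x:S|lborel. f x) else \<infinity>)"
proof -
  have eq: "(\<integral>\<^sup>+x\<in>S. ennreal (f x) \<partial>lborel) = (\<integral>\<^sup>+x. ennreal (indicator S x *\<^sub>R f x) \<partial>lborel)"
    by (intro nn_integral_cong) (auto simp: indicator_def)
  have nn': "0 \<le> indicator S x *\<^sub>R f x" for x
    using nn by (auto simp: indicator_def)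
  show ?thesis
  proof (cases "set_integrable lborel S f")
    case True
    then show ?thesis
      unfolding eq set_integrable_def set_lebesgue_integral_def
      by (subst nn_integral_eq_integral) (use nn' in auto)
  next
    case False
    have "\<not> (\<integral>\<^sup>+x. ennreal (norm (indicator S x *\<^sub>R f x)) \<partial>lborel) < \<infinity>"
      using False unfolding set_integrable_def integrable_iff_bounded by simp
    then have "(\<integral>\<^sup>+x. ennreal (indicator S x *\<^sub>R f x) \<partial>lborel) = \<infinity>"
      using nn' less_top by (auto simp: abs_of_nonneg)
    then show ?thesis using False by (simp add: eq)
  qed
qed

lemma nn_integral_change_of_variables:
  fixes f g h :: "real \<Rightarrow> real"
  assumes S: "S \<in> sets borel" and gS: "g ` S \<in> sets borel"
    and der: "\<And>x. x \<in> S \<Longrightarrow> (g has_real_derivative h x) (at x)"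
    and inj: "inj_on g S"
    and f [measurable]: "f \<in> borel_measurable borel" and nn: "\<And>y. y \<in> g ` S \<Longrightarrow> 0 \<le> f y"
    and g [measurable]: "g \<in> borel_measurable borel"
    and h [measurable]: "h \<in> borel_measurable borel"
  shows "(\<integral>\<^sup>+y\<in>g ` S. ennreal (f y) \<partial>lborel) = (\<integral>\<^sup>+x\<in>S. ennreal (\<bar>h x\<bar> * f (g x)) \<partial>lborel)"
proof -
  note S [measurable] gS [measurable]
  show ?thesis
    using set_integrable_change_of_variables[OF S gS der inj f g h] nn
    by (subst (1 2) nn_integral_eq_set_integral) auto
qed

text \<open>An integrable function need not tend to 0 at infinity, but it cannot stay above
  \<open>e\<close> almost everywhere on a half-line of infinite measure. Truncation points of
  contours are found this way; \<open>P\<close> keeps them off a null set.\<close>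

lemma exists_small_value:
  fixes g :: "real \<Rightarrow> real"
  assumes g: "integrable lborel g" and e: "0 < e" and P: "AE t in lborel. P t"
  shows "\<exists>T\<ge>N. P T \<and> g T < e"
proof (rule ccontr)
  assume "\<not> ?thesis"
  then have *: "e \<le> g T" if "T \<ge> N" "P T" for T using that by force
  have "integrable lborel (\<lambda>x. indicator {N..} x * e)"
  proof (rule Bochner_Integration.integrable_bound[OF g])
    show "AE x in lborel. norm (indicator {N..} x * e) \<le> norm (g x)"
      using P by eventually_elim (use * e in \<open>force simp: indicator_def\<close>)
  qed measurable
  then have "integrable lborel (\<lambda>x. indicator {N..} x :: real)"
    using e by simp
  then have "emeasure lborel {N..} < \<infinity>"
    using integrable_indicator_iff[of lborel "{N..}"] by (simp add: less_top)
  then obtain c where c: "0 \<le> c" "emeasure lborel {N..} = ennreal c"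
    by (cases "emeasure lborel {N..}") auto
  have "emeasure lborel {N..N + (c + 1)} \<le> emeasure lborel {N..}"
    by (intro emeasure_mono) auto
  then show False using c by simp
qed

lemma AE_lborel_uminus:
  fixes P :: "real \<Rightarrow> bool"
  assumes "AE t in lborel. P t"
  shows "AE t in lborel. P (- t)"
proof -
  obtain N where N: "{t. \<not> P t} \<subseteq> N" "N \<in> null_sets lborel"
    using assms unfolding eventually_ae_filter by auto
  have [measurable]: "N \<in> sets borel" using N(2) by auto
  have "AE t in lborel. t \<notin> N" using N(2) by (rule AE_not_in)
  then have "AE t in lborel. 0 + (-1) * t \<notin> N"
    by (intro AE_borel_affine[where P = "\<lambda>t. t \<notin> N"]) measurable
  then show ?thesis
    by eventually_elim (use N(1) in auto)
qed

text \<open>The majorant \<open>M\<close> does not depend on the height and is used twice: it makes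
  the vertical sides of truncating rectangles negligible, and it dominates the passage to the two
  edges. Edge values are taken almost everywhere because the applications have a singular point on
  an edge.\<close>

lemma strip_shift:
  fixes k :: "complex \<Rightarrow> complex" and M :: "real \<Rightarrow> real" and k0 k1 :: "real \<Rightarrow> complex"
  assumes b: "0 < b"
    and hol: "k holomorphic_on {z. 0 < Im z \<and> Im z < b}"
    and M: "integrable lborel M"
    and bound: "AE t in lborel. \<forall>a. 0 < a \<longrightarrow> a < b \<longrightarrow> norm (k (Complex t a)) \<le> M t"
    and lim0: "AE t in lborel. ((\<lambda>a. k (Complex t a)) \<longlongrightarrow> k0 t) (at_right 0)"
    and lim1: "AE t in lborel. ((\<lambda>a. k (Complex t a)) \<longlongrightarrow> k1 t) (at_left b)"
    and [measurable]: "k0 \<in> borel_measurable borel" "k1 \<in> borel_measurable borel"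
  shows "integrable lborel k0" "integrable lborel k1"
    "(\<integral>t. k0 t \<partial>lborel) = (\<integral>t. k1 t \<partial>lborel)"
proof -
  let ?S = "{z. 0 < Im z \<and> Im z < b}"
  have conv: "convex ?S"
    using convex_Int[OF convex_halfspace_Im_gt[of 0] convex_halfspace_Im_lt[of b]]
    by (simp add: Int_def)
  have opn: "open ?S"
    using open_Int[OF open_halfspace_Im_gt[of 0] open_halfspace_Im_lt[of b]]
    by (simp add: Int_def)
  have [measurable]: "M \<in> borel_measurable borel" using M by simp
  \<comment> \<open>The strip is convex, so \<open>k\<close> has a primitive there; integrals over
    segments become differences of \<open>K\<close>, and path independence is automatic.\<close>
  obtain K where K: "\<And>z. z \<in> ?S \<Longrightarrow> (K has_field_derivative k z) (at z)"
  proof -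
    obtain K where "\<And>z. z \<in> ?S \<Longrightarrow> (K has_field_derivative k z) (at z within ?S)"
      using holomorphic_convex_primitive'[OF conv opn hol] by blast
    then show ?thesis using that[of K] at_within_open[OF _ opn] by simp
  qed
  have cont: "continuous_on UNIV (\<lambda>t. k (Complex t a))" if "0 < a" "a < b" for a
    by (rule continuous_on_compose2[OF holomorphic_on_imp_continuous_on[OF hol]])
       (use that in \<open>auto intro!: continuous_intros simp: Complex_eq\<close>)
  have meas [measurable]: "(\<lambda>t. k (Complex t a)) \<in> borel_measurable borel" if "0 < a" "a < b" for a
    using borel_measurable_continuous_onI[OF cont[OF that]] .
  have int: "integrable lborel (\<lambda>t. k (Complex t a))" if a: "0 < a" "a < b" for a
  proof (rule Bochner_Integration.integrable_bound[OF M])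
    show "AE t in lborel. norm (k (Complex t a)) \<le> norm (M t)"
      using bound
    proof eventually_elim
      case (elim t)
      have "norm (k (Complex t a)) \<le> M t" using elim a by blast
      then show ?case by simp
    qed
  qed (use meas[OF a] in simp)
  define J where "J a = (\<integral>t. k (Complex t a) \<partial>lborel)" for a
  have "AE t in lborel. \<forall>a. 0 < a \<longrightarrow> a < b \<longrightarrow> norm (k (Complex (-t) a)) \<le> M (-t)"
    using bound by (rule AE_lborel_uminus)
  with bound have bound2: "AE t in lborel. (\<forall>a. 0 < a \<longrightarrow> a < b \<longrightarrow> norm (k (Complex t a)) \<le> M t)
      \<and> (\<forall>a. 0 < a \<longrightarrow> a < b \<longrightarrow> norm (k (Complex (-t) a)) \<le> M (-t))"
    by (rule AE_conjI)
  have M2: "integrable lborel (\<lambda>t. M t + M (- t))"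
    using M lborel_integrable_real_affine[OF M, of "-1" 0] by simp
  \<comment> \<open>The vertical sides of the rectangle are negligible along heights at which the majorant is small.\<close>
  have "\<exists>T\<ge>real n. ((\<forall>a. 0 < a \<longrightarrow> a < b \<longrightarrow> norm (k (Complex T a)) \<le> M T)
      \<and> (\<forall>a. 0 < a \<longrightarrow> a < b \<longrightarrow> norm (k (Complex (-T) a)) \<le> M (-T))) \<and> M T + M (-T) < 1 / Suc n" for n
    by (rule exists_small_value[OF M2 _ bound2]) simp
  then obtain T where T: "\<And>n. T n \<ge> real n"
    "\<And>n a. 0 < a \<Longrightarrow> a < b \<Longrightarrow> norm (k (Complex (T n) a)) \<le> M (T n)"
    "\<And>n a. 0 < a \<Longrightarrow> a < b \<Longrightarrow> norm (k (Complex (- T n) a)) \<le> M (- T n)"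
    "\<And>n. M (T n) + M (- T n) < 1 / Suc n"
    by metis
  have Tlim: "filterlim T at_top sequentially"
    by (rule filterlim_at_top_mono[OF filterlim_real_sequentially]) (use T in auto)
  have ftc: "(LINT t:{-T n..T n}|lborel. k (Complex t a)) = K (Complex (T n) a) - K (Complex (- T n) a)"
    if a: "0 < a" "a < b" for a n
  proof -
    have Tn: "- T n \<le> T n" using T(1)[of n] by (simp add: order.trans[OF _ T(1)[of n]])
    have "(LBINT t. indicator {-T n..T n} t *\<^sub>R k (Complex t a)) = K (Complex (T n) a) - K (Complex (- T n) a)"
    proof (rule integral_FTC_atLeastAtMost[OF Tn])
      fix t
      have "((\<lambda>t. Complex t a) has_vector_derivative 1) (at t within {-T n..T n})"
        unfolding Complex_eq by (auto intro!: derivative_eq_intros)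
      then show "((\<lambda>t. K (Complex t a)) has_vector_derivative k (Complex t a)) (at t within {-T n..T n})"
        using field_vector_diff_chain_within[of "\<lambda>t. Complex t a" 1 t "{-T n..T n}" K "k (Complex t a)"]
          has_field_derivative_at_within[OF K[of "Complex t a"]] a
        by (simp add: o_def)
    next
      show "continuous_on {- T n..T n} (\<lambda>t. k (Complex t a))"
        using cont[OF a] continuous_on_subset by blast
    qed
    then show ?thesis by (simp add: set_lebesgue_integral_def)
  qed
  have trunc: "(\<lambda>n. K (Complex (T n) a) - K (Complex (- T n) a)) \<longlonglongrightarrow> J a"
    if a: "0 < a" "a < b" for a
  proof -
    have "(\<lambda>n. \<integral>t. indicator {-T n..T n} t *\<^sub>R k (Complex t a) \<partial>lborel) \<longlonglongrightarrow> J a"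
      unfolding J_def
    proof (rule integral_dominated_convergence[where w = "\<lambda>t. norm (k (Complex t a))"])
      show "AE t in lborel. (\<lambda>n. indicator {-T n..T n} t *\<^sub>R k (Complex t a)) \<longlonglongrightarrow> k (Complex t a)"
      proof (rule AE_I2, rule tendsto_eventually)
        fix t
        have "\<forall>\<^sub>F n in sequentially. \<bar>t\<bar> \<le> T n"
          using Tlim by (simp add: filterlim_at_top)
        then show "\<forall>\<^sub>F n in sequentially. indicator {-T n..T n} t *\<^sub>R k (Complex t a) = k (Complex t a)"
          by eventually_elim (auto simp: indicator_def)
      qed
    qed (use int[OF a] meas[OF a] in \<open>auto simp: indicator_def\<close>)
    then show ?thesis
      using ftc[OF a] by (simp add: set_lebesgue_integral_def)
  qed
  \<comment> \<open>Along a vertical segment the primitive changes by at most the derivative bound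
    times the length, and the length is below \<open>b\<close>.\<close>
  have side: "norm (K (Complex x a) - K (Complex x a')) \<le> C * b"
    if C: "\<And>a. 0 < a \<Longrightarrow> a < b \<Longrightarrow> norm (k (Complex x a)) \<le> C" and a: "0 < a" "a < b" "0 < a'" "a' < b" for x a a' C
  proof -
    let ?L = "{z. 0 < Im z \<and> Im z < b \<and> Re z = x}"
    have "?L = ?S \<inter> {z. inner 1 z = x}" by (auto simp: inner_complex_def)
    then have "convex ?L"
      using convex_Int[OF conv convex_hyperplane[of "1::complex" x]] by (simp only:)
    then have "norm (K (Complex x a) - K (Complex x a')) \<le> C * norm (Complex x a - Complex x a')"
    proof (rule field_differentiable_bound)
      fix z assume "z \<in> ?L"
      then show "(K has_field_derivative k z) (at z within ?L)"
        by (auto intro!: has_field_derivative_at_within[OF K])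
    next
      fix z assume z: "z \<in> ?L"
      then show "norm (k z) \<le> C" using C[of "Im z"] by auto
    qed (use a in auto)
    also have "norm (Complex x a - Complex x a') = \<bar>a - a'\<bar>"
      by (simp add: cmod_def)
    also have "C * \<bar>a - a'\<bar> \<le> C * b"
      using a order.trans[OF norm_ge_zero C[OF a(1,2)]] by (intro mult_left_mono) auto
    finally show ?thesis .
  qed
  have const: "J a = J a'" if a: "0 < a" "a < b" "0 < a'" "a' < b" for a a'
  proof -
    let ?D = "\<lambda>n a. K (Complex (T n) a) - K (Complex (- T n) a)"
    have le: "norm (?D n a - ?D n a') \<le> 1 / Suc n * b" for n
    proof -
      have "norm (?D n a - ?D n a') \<le> norm (K (Complex (T n) a) - K (Complex (T n) a'))
            + norm (K (Complex (-T n) a) - K (Complex (-T n) a'))"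
        using norm_triangle_ineq4[of "K (Complex (T n) a) - K (Complex (T n) a')" "K (Complex (-T n) a) - K (Complex (-T n) a')"]
        by (simp add: algebra_simps)
      also have "\<dots> \<le> M (T n) * b + M (- T n) * b"
        by (intro add_mono side T a)
      also have "\<dots> \<le> 1 / Suc n * b"
        unfolding distrib_right[symmetric] using T(4)[of n] b by (intro mult_right_mono) auto
      finally show ?thesis .
    qed
    have "(\<lambda>n. ?D n a - ?D n a') \<longlonglongrightarrow> J a - J a'"
      by (intro tendsto_diff trunc a)
    moreover have "(\<lambda>n. ?D n a - ?D n a') \<longlonglongrightarrow> 0"
    proof (rule Lim_null_comparison[OF always_eventually])
      show "\<forall>n. norm (?D n a - ?D n a') \<le> 1 / Suc n * b" using le by blast
      show "(\<lambda>n. 1 / Suc n * b) \<longlonglongrightarrow> 0"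
        using tendsto_mult_left_zero[OF LIMSEQ_inverse_real_of_nat, of b] by (simp add: inverse_eq_divide)
    qed
    ultimately have "J a - J a' = 0" by (rule LIMSEQ_unique)
    then show ?thesis by simp
  qed
  have bdry: "integrable lborel kk \<and> J (b / 2) = (\<integral>t. kk t \<partial>lborel)"
    if x: "\<And>n. 0 < x n \<and> x n < b" and lim: "AE t in lborel. (\<lambda>n::nat. k (Complex t (x n))) \<longlonglongrightarrow> kk t"
      and [measurable]: "kk \<in> borel_measurable borel" for x kk
  proof
    have bd: "AE t in lborel. norm (k (Complex t (x n))) \<le> M t" for n
      using bound by eventually_elim (use x[of n] in auto)
    have [measurable]: "(\<lambda>t. k (Complex t (x n))) \<in> borel_measurable borel" for n
      using x[of n] by (intro meas) auto
    show "integrable lborel kk"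
      by (rule integrable_dominated_convergence[OF _ _ M lim bd]) auto
    have "(\<lambda>n. J (x n)) \<longlonglongrightarrow> (\<integral>t. kk t \<partial>lborel)"
      unfolding J_def by (rule integral_dominated_convergence[OF _ _ M lim bd]) auto
    moreover have "J (x n) = J (b / 2)" for n
      using x[of n] b by (intro const) auto
    ultimately have "(\<lambda>n. J (b / 2)) \<longlonglongrightarrow> (\<integral>t. kk t \<partial>lborel)" by simp
    then show "J (b / 2) = (\<integral>t. kk t \<partial>lborel)"
      by (simp add: LIMSEQ_const_iff)
  qed
  \<comment> \<open>The offset 2 keeps the height strictly below \<open>b\<close> already for
    \<open>n = 0\<close>.\<close>
  have "(\<lambda>n. b / real (n + 2)) \<longlonglongrightarrow> 0"
    by (rule LIMSEQ_ignore_initial_segment[OF lim_const_over_n])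
  then have n0: "(\<lambda>n. b / (real n + 2)) \<longlonglongrightarrow> 0" by (simp add: add.commute)
  have x0: "0 < b / (real n + 2) \<and> b / (real n + 2) < b" for n
    using b mult_strict_left_mono[of 1 "real n + 2" b] by (simp add: divide_less_eq)
  have f0: "filterlim (\<lambda>n. b / (real n + 2)) (at_right 0) sequentially"
    by (rule tendsto_imp_filterlim_at_right[OF n0]) (use x0 in auto)
  have f1: "filterlim (\<lambda>n. b - b / (real n + 2)) (at_left b) sequentially"
    by (rule tendsto_imp_filterlim_at_left) (use tendsto_diff[OF tendsto_const n0, of b] x0 in auto)
  have l0: "AE t in lborel. (\<lambda>n. k (Complex t (b / (real n + 2)))) \<longlonglongrightarrow> k0 t"
    using lim0 by eventually_elim (rule filterlim_compose[OF _ f0])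
  have l1: "AE t in lborel. (\<lambda>n. k (Complex t (b - b / (real n + 2)))) \<longlonglongrightarrow> k1 t"
    using lim1 by eventually_elim (rule filterlim_compose[OF _ f1])
  have x1: "0 < b - b / (real n + 2) \<and> b - b / (real n + 2) < b" for n
    using x0[of n] by simp
  have r0: "integrable lborel k0 \<and> J (b / 2) = (\<integral>t. k0 t \<partial>lborel)"
    by (rule bdry[OF x0 l0]) measurable
  have r1: "integrable lborel k1 \<and> J (b / 2) = (\<integral>t. k1 t \<partial>lborel)"
    by (rule bdry[OF x1 l1]) measurable
  show "integrable lborel k0" "integrable lborel k1"
    "(\<integral>t. k0 t \<partial>lborel) = (\<integral>t. k1 t \<partial>lborel)"
    using r0 r1 by auto
qed

text \<open>Cauchy's inequality on discs of half the radius converts the local majorant of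
  \<open>f\<close> into one for its derivative, hence for all difference quotients. Dominated
  convergence along sequences then differentiates under the integral.\<close>

lemma holomorphic_integral:
  fixes f :: "complex \<Rightarrow> 'a \<Rightarrow> complex"
  assumes U: "open U"
    and meas: "\<And>z. z \<in> U \<Longrightarrow> f z \<in> borel_measurable M"
    and hol: "\<And>x. x \<in> space M \<Longrightarrow> (\<lambda>z. f z x) holomorphic_on U"
    and dom: "\<And>z0. z0 \<in> U \<Longrightarrow> \<exists>r>0. \<exists>g. integrable M g \<and> (\<forall>z\<in>U. dist z z0 \<le> r \<longrightarrow> (\<forall>x\<in>space M. norm (f z x) \<le> g x))"
  shows "(\<lambda>z. \<integral>x. f z x \<partial>M) holomorphic_on U"
  unfolding holomorphic_on_def
proof
  fix z0 assume z0: "z0 \<in> U"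
  obtain r0 g where r0: "0 < r0" and g: "integrable M g"
    and le0: "\<And>z x. z \<in> U \<Longrightarrow> dist z z0 \<le> r0 \<Longrightarrow> x \<in> space M \<Longrightarrow> norm (f z x) \<le> g x"
    using dom[OF z0] by blast
  obtain r1 where r1: "0 < r1" "cball z0 r1 \<subseteq> U" using U z0 open_contains_cball by blast
  define r where "r = min r0 r1"
  have r: "0 < r" "cball z0 r \<subseteq> U" using r0 r1 by (auto simp: r_def)
  have le: "norm (f z x) \<le> g x" if "z \<in> cball z0 r" "x \<in> space M" for z x
    using le0[of z x] that r(2) by (auto simp: r_def dist_commute)
  have int: "integrable M (f z)" if "z \<in> cball z0 r" for z
    by (rule Bochner_Integration.integrable_bound[OF g meas])
       (use that r(2) le in \<open>force intro!: AE_I2\<close>)+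
  have deriv_le: "norm (deriv (\<lambda>z. f z x) w) \<le> g x / (r / 2)" if w: "w \<in> cball z0 (r/2)" and x: "x \<in> space M" for w x
  proof -
    have sub: "cball w (r/2) \<subseteq> cball z0 r"
    proof
      fix y assume "y \<in> cball w (r/2)"
      then show "y \<in> cball z0 r" using w dist_triangle[of z0 y w] by auto
    qed
    have h: "(\<lambda>z. f z x) holomorphic_on cball w (r/2)"
      using hol[OF x] sub r(2) holomorphic_on_subset by blast
    have "norm ((deriv ^^ 1) (\<lambda>z. f z x) w) \<le> fact 1 * g x / (r/2) ^ 1"
    proof (rule Cauchy_inequality)
      show "(\<lambda>z. f z x) holomorphic_on ball w (r/2)"
        using h by (rule holomorphic_on_subset) auto
      show "continuous_on (cball w (r/2)) (\<lambda>z. f z x)"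
        using h by (rule holomorphic_on_imp_continuous_on)
      fix y assume "norm (w - y) = r/2"
      then have "y \<in> cball w (r/2)" by (simp add: dist_norm)
      then show "norm (f y x) \<le> g x" using sub le[OF _ x] by blast
    qed (use r in auto)
    then show ?thesis by simp
  qed
  have lip: "norm (f z x - f z0 x) \<le> g x / (r / 2) * norm (z - z0)" if z: "z \<in> cball z0 (r/2)" and x: "x \<in> space M" for z x
  proof (rule field_differentiable_bound[of "cball z0 (r/2)"])
    fix y assume y: "y \<in> cball z0 (r/2)"
    then have "y \<in> U" using r by auto
    then show "((\<lambda>z. f z x) has_field_derivative deriv (\<lambda>z. f z x) y) (at y within cball z0 (r/2))"
      using holomorphic_derivI[OF hol[OF x] U] by blast
    show "norm (deriv (\<lambda>z. f z x) y) \<le> g x / (r / 2)" using deriv_le y x by blast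
  qed (use r z in auto)
  define I where "I z = (\<integral>x. f z x \<partial>M)" for z
  define d where "d x = deriv (\<lambda>z. f z x) z0" for x
  have dlim: "((\<lambda>z. (f z x - f z0 x) / (z - z0)) \<longlongrightarrow> d x) (at z0)" if "x \<in> space M" for x
    using holomorphic_derivI[OF hol[OF that] U z0, of UNIV]
    unfolding d_def has_field_derivative_iff by simp
  have "((\<lambda>z. (I z - I z0) / (z - z0)) \<longlongrightarrow> (\<integral>x. d x \<partial>M)) (at z0)"
    unfolding tendsto_at_iff_sequentially
  proof (intro allI impI)
    fix X :: "nat \<Rightarrow> complex"
    assume X: "\<forall>n. X n \<in> UNIV - {z0}" and Xl: "X \<longlonglongrightarrow> z0"
    have ev: "\<forall>\<^sub>F n in sequentially. X n \<in> cball z0 (r/2)"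
      using tendstoD[OF Xl, of "r/2"] r by (auto elim!: eventually_mono simp: dist_commute)
    then obtain N where N: "\<And>n. n \<ge> N \<Longrightarrow> X n \<in> cball z0 (r/2)"
      by (auto simp: eventually_sequentially)
    \<comment> \<open>Dropping the first \<open>N\<close> terms puts the whole sequence into the
      disc where the Lipschitz bound \<open>lip\<close> holds.\<close>
    define Y where "Y n = X (n + N)" for n
    have Y: "Y n \<in> cball z0 (r/2)" "Y n \<noteq> z0" "Y n \<in> cball z0 r" "Y n \<in> U" for n
      using N[of "n + N"] X r by (auto simp: Y_def)
    have Yl: "Y \<longlonglongrightarrow> z0" unfolding Y_def using Xl by (rule LIMSEQ_ignore_initial_segment)
    have pw: "(\<lambda>n. (f (Y n) x - f z0 x) / (Y n - z0)) \<longlonglongrightarrow> d x" if "x \<in> space M" for x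
      using dlim[OF that] Yl Y unfolding tendsto_at_iff_sequentially by (auto simp: o_def)
    have [measurable]: "f (Y n) \<in> borel_measurable M" "f z0 \<in> borel_measurable M" for n
      using meas Y z0 by auto
    have [measurable]: "d \<in> borel_measurable M"
      by (rule borel_measurable_LIMSEQ_metric[OF _ pw]) measurable
    have lim: "(\<lambda>n. \<integral>x. (f (Y n) x - f z0 x) / (Y n - z0) \<partial>M) \<longlonglongrightarrow> (\<integral>x. d x \<partial>M)"
    proof (rule integral_dominated_convergence[where w = "\<lambda>x. g x / (r/2)"])
      show "AE x in M. norm ((f (Y n) x - f z0 x) / (Y n - z0)) \<le> g x / (r / 2)" for n
        using lip[OF Y(1)[of n]] Y(2)[of n] by (auto intro!: AE_I2 simp: norm_divide pos_divide_le_eq)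
    qed (use g pw in auto)
    have eq: "(\<integral>x. (f (Y n) x - f z0 x) / (Y n - z0) \<partial>M) = (I (Y n) - I z0) / (Y n - z0)" for n
    proof -
      have "(\<integral>x. f (Y n) x - f z0 x \<partial>M) = I (Y n) - I z0"
        unfolding I_def using int[OF Y(3)[of n]] int[of z0] r by (intro Bochner_Integration.integral_diff) auto
      moreover have "(\<integral>x. (f (Y n) x - f z0 x) / (Y n - z0) \<partial>M) = (\<integral>x. f (Y n) x - f z0 x \<partial>M) / (Y n - z0)"
        by (rule integral_divide_zero)
      ultimately show ?thesis by (simp only:)
    qed
    have "(\<lambda>n. (I (Y n) - I z0) / (Y n - z0)) \<longlonglongrightarrow> (\<integral>x. d x \<partial>M)"
      using lim unfolding eq .
    then show "((\<lambda>z. (I z - I z0) / (z - z0)) \<circ> X) \<longlonglongrightarrow> (\<integral>x. d x \<partial>M)"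
      unfolding o_def Y_def by (rule LIMSEQ_offset)
  qed
  then have "(I has_field_derivative (\<integral>x. d x \<partial>M)) (at z0)"
    by (simp add: has_field_derivative_iff)
  then have "(I has_field_derivative (\<integral>x. d x \<partial>M)) (at z0 within U)"
    by (rule has_field_derivative_at_within)
  then show "(\<lambda>z. \<integral>x. f z x \<partial>M) field_differentiable at z0 within U"
    unfolding field_differentiable_def I_def by blast
qed

section \<open>Legendre functions and the Euler integral\<close>

definition legendre_coeff :: "complex \<Rightarrow> nat \<Rightarrow> complex" where
  "legendre_coeff \<nu> n = pochhammer (- \<nu>) n * pochhammer (\<nu> + 1) n / (fact n)\<^sup>2"

lemma legendre_P_altdef:
  "legendre_P \<nu> x = (\<Sum>n. legendre_coeff \<nu> n * complex_of_real ((1 - x) / 2) ^ n)"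
  unfolding legendre_P_def hypergeo_2F1_def eval_fps_def legendre_coeff_def
  by (simp add: power2_eq_square flip: pochhammer_fact)

lemma borel_measurable_legendre_P [measurable]: "legendre_P \<nu> \<in> borel_measurable borel"
  unfolding legendre_P_altdef[abs_def] by measurable

lemma legendre_coeff_0 [simp]: "legendre_coeff \<nu> 0 = 1"
  by (simp add: legendre_coeff_def)

text \<open>In this form the recurrence sees \<nu> only through \<open>\<nu> * (\<nu> + 1)\<close>,
  which is why the growth bounds are uniform over bounded values of that product.\<close>

lemma legendre_coeff_Suc:
  "legendre_coeff \<nu> (Suc n) =
    legendre_coeff \<nu> n * ((of_nat n * of_nat (Suc n) - \<nu> * (\<nu> + 1)) / (of_nat (Suc n))\<^sup>2)"
proof -
  have "(- \<nu> + of_nat n) * (\<nu> + 1 + of_nat n) = of_nat n * of_nat (Suc n) - \<nu> * (\<nu> + 1)"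
    by (simp add: algebra_simps)
  moreover have "legendre_coeff \<nu> (Suc n) = legendre_coeff \<nu> n * (((- \<nu> + of_nat n) * (\<nu> + 1 + of_nat n)) / (of_nat (Suc n))\<^sup>2)"
    unfolding legendre_coeff_def pochhammer_Suc fact_Suc power_mult_distrib of_nat_mult
    by (simp add: algebra_simps del: of_nat_Suc)
  ultimately show ?thesis by simp
qed

lemma legendre_coeff_reflect: "legendre_coeff (- \<nu> - 1) n = legendre_coeff \<nu> n"
  by (simp add: legendre_coeff_def mult.commute add.commute)

text \<open>The degrees \<open>s - 1\<close> and \<open>- s\<close> give the same function, so the
  boundary values belonging to \<open>s\<close> and to \<open>1 - s\<close> can be written in the
  same Legendre functions.\<close>

lemma legendre_P_reflect: "legendre_P (- \<nu> - 1) x = legendre_P \<nu> x"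
  by (simp add: legendre_P_altdef legendre_coeff_reflect)

lemma binomial_pochhammer_sums:
  fixes a z :: real
  assumes "\<bar>z\<bar> < 1"
  shows "(\<lambda>n. pochhammer a n / fact n * z ^ n) sums (1 - z) powr (- a)"
proof -
  have "(\<lambda>n. ((-a) gchoose n) * (- z) ^ n) sums (1 + (- z)) powr (- a)"
    by (rule gen_binomial_real) (use assms in auto)
  moreover have "((-a) gchoose n) * (- z) ^ n = pochhammer a n / fact n * z ^ n" for n
    by (simp add: gbinomial_pochhammer power_mult_distrib[of "-1" z n, simplified] mult_ac
        flip: power_add mult_2)
  ultimately show ?thesis by simp
qed

text \<open>The coefficients behave like a multiple of \<open>1 / n\<close>, which allows a
  logarithmic singularity at \<open>x = -1\<close>. Comparison with the coefficients of
  \<open>(1 - z) powr (- \<delta>)\<close>, of order \<open>n powr (\<delta> - 1)\<close>, gives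
  away an arbitrarily small power and in return has a constant that is uniform over bounded
  \<open>\<nu> * (\<nu> + 1)\<close>.\<close>

lemma legendre_coeff_bound:
  fixes M \<delta> :: real
  assumes M: "0 \<le> M" and d: "0 < \<delta>" "\<delta> \<le> 1"
  shows "\<exists>C>0. \<forall>\<nu> n. norm (\<nu> * (\<nu> + 1)) \<le> M \<longrightarrow> norm (legendre_coeff \<nu> n) \<le> C * (pochhammer \<delta> n / fact n)"
proof -
  define d where "d n = pochhammer \<delta> n / fact n" for n
  have d0: "0 < d n" for n using d by (simp add: d_def pochhammer_pos)
  have dSuc: "d (Suc n) = d n * ((\<delta> + n) / Suc n)" for n
    by (simp add: d_def pochhammer_Suc del: of_nat_Suc)
  have ddec: "d (Suc n) \<le> d n" for n
    unfolding dSuc using d d0[of n] by (intro mult_left_le) auto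
  have dle: "d n \<le> d m" if "m \<le> n" for m n
    using lift_Suc_antimono_le[of d, OF ddec that] .
  \<comment> \<open>From this index on, the ratio of consecutive coefficients is dominated by that of the series of \<open>(1 - z) powr - \<delta>\<close>.\<close>
  obtain N :: nat where N: "M / \<delta> \<le> real N" using real_arch_simple by blast
  \<comment> \<open>Up to \<open>N\<close> the crude bound \<open>(1 + M) ^ n\<close> is enough
    because \<open>d\<close> is decreasing; \<open>C\<close> is chosen so that the two regimes meet
    at \<open>N\<close>.\<close>
  define C where "C = (1 + M) ^ N / d N"
  have C0: "0 < C" using M d0 by (simp add: C_def)
  have "norm (legendre_coeff \<nu> n) \<le> C * d n" if nu: "norm (\<nu> * (\<nu> + 1)) \<le> M" for \<nu> n
  proof -
    have ratio: "norm (legendre_coeff \<nu> (Suc n)) \<le> norm (legendre_coeff \<nu> n) * ((real n * Suc n + M) / (real (Suc n))\<^sup>2)" for n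
    proof -
      have "norm (of_nat n * of_nat (Suc n) - \<nu> * (\<nu> + 1)) \<le> norm (of_nat n * of_nat (Suc n) :: complex) + norm (\<nu> * (\<nu> + 1))"
        by (rule norm_triangle_ineq4)
      also have "\<dots> \<le> real n * Suc n + M" using nu by (simp add: norm_mult del: of_nat_Suc)
      finally show ?thesis
        unfolding legendre_coeff_Suc norm_mult norm_divide norm_power norm_of_nat of_nat_power
        by (intro mult_left_mono divide_right_mono zero_le_power2 norm_ge_zero)
    qed
    have small: "norm (legendre_coeff \<nu> n) \<le> (1 + M) ^ n" for n
    proof (induction n)
      case (Suc n)
      have "real n * Suc n + M \<le> (1 + M) * (real (Suc n))\<^sup>2"
      proof -
        have "real n * Suc n \<le> (real (Suc n))\<^sup>2" "1 \<le> (real (Suc n))\<^sup>2"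
          by (auto simp: power2_eq_square algebra_simps)
        then show ?thesis using M mult_left_mono[of 1 "(real (Suc n))\<^sup>2" M] by (simp add: algebra_simps del: of_nat_Suc)
      qed
      then have "(real n * Suc n + M) / (real (Suc n))\<^sup>2 \<le> 1 + M"
        by (simp add: divide_le_eq del: of_nat_Suc)
      then have "norm (legendre_coeff \<nu> n) * ((real n * Suc n + M) / (real (Suc n))\<^sup>2) \<le> (1 + M) ^ n * (1 + M)"
        using Suc M by (intro mult_mono) auto
      then show ?case using ratio[of n] by (simp add: mult.commute)
    qed simp
    show ?thesis
    proof (cases "n \<le> N")
      case True
      have "norm (legendre_coeff \<nu> n) \<le> (1 + M) ^ N"
        using small[of n] power_increasing[OF True, of "1 + M"] M by simp
      also have "\<dots> = C * d N" using d0[of N] by (simp add: C_def)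
      also have "\<dots> \<le> C * d n" using C0 dle[OF True] by simp
      finally show ?thesis .
    next
      case False
      then have "N \<le> n" by simp
      then show ?thesis
      proof (induction n rule: dec_induct)
        case base
        then show ?case using small[of N] d0[of N] by (simp add: C_def)
      next
        case (step m)
        have "M \<le> \<delta> * (m + 1)"
          using N d step(1) by (simp add: field_simps) (smt (verit) mult_left_mono of_nat_mono)
        then have "real m * Suc m + M \<le> (\<delta> + m) * Suc m"
          by (simp add: algebra_simps)
        then have *: "(real m * Suc m + M) / (real (Suc m))\<^sup>2 \<le> (\<delta> + m) / Suc m"
          by (simp add: power2_eq_square divide_simps del: of_nat_Suc)
        have "norm (legendre_coeff \<nu> (Suc m)) \<le> C * d m * ((\<delta> + m) / Suc m)"
          using ratio[of m] by (rule order.trans)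
            (intro mult_mono step(3) *, use C0 d0[of m] M in auto)
        then show ?case by (simp add: dSuc mult.assoc)
      qed
    qed
  qed
  then show ?thesis using C0 unfolding d_def by blast
qed

lemma legendre_P_bound:
  fixes M \<delta> :: real
  assumes M: "0 \<le> M" and d: "0 < \<delta>" "\<delta> \<le> 1"
  shows "\<exists>C>0. \<forall>\<nu> x. norm (\<nu> * (\<nu> + 1)) \<le> M \<longrightarrow> -1 < x \<longrightarrow> x \<le> 1 \<longrightarrow>
    norm (legendre_P \<nu> x) \<le> C * ((1 + x) / 2) powr (- \<delta>)"
proof -
  obtain C where C: "C > 0" "\<And>\<nu> n. norm (\<nu> * (\<nu> + 1)) \<le> M \<Longrightarrow> norm (legendre_coeff \<nu> n) \<le> C * (pochhammer \<delta> n / fact n)"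
    using legendre_coeff_bound[OF assms] by blast
  have "norm (legendre_P \<nu> x) \<le> C * ((1 + x) / 2) powr (- \<delta>)"
    if nu: "norm (\<nu> * (\<nu> + 1)) \<le> M" and x: "-1 < x" "x \<le> 1" for \<nu> x
  proof -
    have z: "\<bar>(1 - x) / 2\<bar> < 1" using x by auto
    have s: "(\<lambda>n. C * (pochhammer \<delta> n / fact n * ((1 - x) / 2) ^ n)) sums (C * (1 - (1 - x) / 2) powr (- \<delta>))"
      by (intro sums_mult binomial_pochhammer_sums z)
    have le: "norm (legendre_coeff \<nu> n * complex_of_real ((1 - x) / 2) ^ n) \<le> C * (pochhammer \<delta> n / fact n * ((1 - x) / 2) ^ n)" for n
    proof -
      have "norm (legendre_coeff \<nu> n * complex_of_real ((1 - x) / 2) ^ n) = norm (legendre_coeff \<nu> n) * ((1 - x) / 2) ^ n"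
        unfolding norm_mult norm_power norm_of_real using x by simp
      also have "\<dots> \<le> C * (pochhammer \<delta> n / fact n) * ((1 - x) / 2) ^ n"
        using x by (intro mult_right_mono C nu) auto
      finally show ?thesis by (simp add: mult.assoc)
    qed
    have "norm (legendre_P \<nu> x) \<le> (\<Sum>n. C * (pochhammer \<delta> n / fact n * ((1 - x) / 2) ^ n))"
      unfolding legendre_P_altdef
      by (rule norm_suminf_le[OF le sums_summable[OF s]])
    also have "\<dots> = C * ((1 + x) / 2) powr (- \<delta>)"
      using sums_unique[OF s] by (simp add: field_simps)
    finally show ?thesis .
  qed
  then show ?thesis using C(1) by blast
qed

lemma legendre_coeff_summable:
  assumes x: "-1 < x" "x \<le> (1::real)"
  shows "summable (\<lambda>n. norm (legendre_coeff \<nu> n * complex_of_real ((1 - x) / 2) ^ n))"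
proof -
  obtain C where C: "C > 0" "\<And>\<nu>' n. norm (\<nu>' * (\<nu>' + 1)) \<le> norm (\<nu> * (\<nu> + 1)) \<Longrightarrow> norm (legendre_coeff \<nu>' n) \<le> C * (pochhammer 1 n / fact n)"
    using legendre_coeff_bound[of "norm (\<nu> * (\<nu> + 1))" 1] by auto
  have "norm (norm (legendre_coeff \<nu> n * complex_of_real ((1 - x) / 2) ^ n)) \<le> C * ((1 - x) / 2) ^ n" for n
  proof -
    have "norm (legendre_coeff \<nu> n) * ((1 - x) / 2) ^ n \<le> C * ((1 - x) / 2) ^ n"
      using C(2)[of \<nu> n] x by (intro mult_right_mono) (auto simp: pochhammer_fact[symmetric])
    then show ?thesis unfolding norm_mult norm_power norm_of_real using x by simp
  qed
  moreover have "summable (\<lambda>n. C * ((1 - x) / 2) ^ n)"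
    using x by (intro summable_mult summable_geometric) auto
  ultimately show ?thesis by (rule summable_comparison_test'[where N = 0, rotated])
qed

text \<open>For \<delta> = 1 the comparison coefficients are all 1, so on a disc of degrees the
  coefficients are bounded by one constant and a geometric series dominates. The partial sums,
  polynomials in \<nu>, therefore converge uniformly there.\<close>

lemma holomorphic_legendre_P:
  assumes x: "-1 < x" "x \<le> (1::real)"
  shows "(\<lambda>\<nu>. legendre_P \<nu> x) holomorphic_on UNIV"
proof -
  have z: "\<bar>(1 - x) / 2\<bar> < 1" using x by auto
  have "(\<lambda>\<nu>. legendre_P \<nu> x) holomorphic_on ball 0 R" for R
  proof (cases "R > 0")
    case True
    define M where "M = R * (R + 1)"
    have M: "0 \<le> M" using True by (simp add: M_def)
    obtain C where C: "C > 0" "\<And>\<nu> n. norm (\<nu> * (\<nu> + 1)) \<le> M \<Longrightarrow> norm (legendre_coeff \<nu> n) \<le> C * (pochhammer 1 n / fact n)"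
      using legendre_coeff_bound[OF M, of 1] by auto
    define f where "f n \<nu> = legendre_coeff \<nu> n * complex_of_real ((1 - x) / 2) ^ n" for n \<nu>
    have le: "norm (f n \<nu>) \<le> C * ((1 - x) / 2) ^ n" if "\<nu> \<in> ball 0 R" for n \<nu>
    proof -
      have "norm (\<nu> * (\<nu> + 1)) \<le> R * (R + 1)"
        unfolding norm_mult using that norm_triangle_ineq[of \<nu> 1] True by (intro mult_mono) auto
      then have "norm (legendre_coeff \<nu> n) * ((1 - x) / 2) ^ n \<le> C * ((1 - x) / 2) ^ n"
        using C(2)[of \<nu> n] x by (intro mult_right_mono) (auto simp: pochhammer_fact[symmetric] M_def)
      then show ?thesis unfolding f_def norm_mult norm_power norm_of_real using x by simp
    qed
    have sm: "summable (\<lambda>n. C * ((1 - x) / 2) ^ n)"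
      using x by (intro summable_mult summable_geometric) auto
    have ul: "uniform_limit (ball 0 R) (\<lambda>n \<nu>. \<Sum>i<n. f i \<nu>) (\<lambda>\<nu>. \<Sum>i. f i \<nu>) sequentially"
      by (rule Weierstrass_m_test[OF le sm])
    have holf: "f n holomorphic_on S" for n S
    proof -
      have "(\<lambda>\<nu>. legendre_coeff \<nu> n) holomorphic_on S"
        by (induction n) (auto simp: legendre_coeff_Suc intro!: holomorphic_intros)
      then show ?thesis unfolding f_def by (intro holomorphic_intros)
    qed
    have "(\<lambda>\<nu>. \<Sum>i. f i \<nu>) holomorphic_on ball 0 R"
    proof (rule holomorphic_uniform_sequence)
      show "(\<lambda>\<nu>. \<Sum>i<n. f i \<nu>) holomorphic_on ball 0 R" for n
        by (intro holomorphic_intros holf)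
      fix y :: complex assume "y \<in> ball 0 R"
      then obtain d where "d > 0" "cball y d \<subseteq> ball 0 R"
        using open_contains_cball[of "ball 0 R :: complex set"] open_ball by blast
      then show "\<exists>d>0. cball y d \<subseteq> ball 0 R \<and> uniform_limit (cball y d) (\<lambda>n \<nu>. \<Sum>i<n. f i \<nu>) (\<lambda>\<nu>. \<Sum>i. f i \<nu>) sequentially"
        using uniform_limit_on_subset[OF ul] by blast
    qed auto
    then show ?thesis by (simp add: legendre_P_altdef f_def)
  next
    case False
    then have "ball (0::complex) R = {}" by simp
    then show ?thesis by (simp only: holomorphic_on_empty)
  qed
  then have "(\<lambda>\<nu>. legendre_P \<nu> x) field_differentiable at w" for w
    using holomorphic_on_imp_differentiable_at[of _ "ball 0 (norm w + 1)" w] by auto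
  then show ?thesis
    by (simp add: holomorphic_on_def)
qed

text \<open>Indexed by the kernel exponent \<open>s\<close> instead of the degree
  \<open>s - 1\<close>; the reflection of the degree becomes \<open>s\<close> ->
  \<open>1 - s\<close>.\<close>

definition legendre_real :: "real \<Rightarrow> real \<Rightarrow> real" where
  "legendre_real s x = Re (legendre_P (of_real (s - 1)) x)"

lemma borel_measurable_legendre_real [measurable]: "legendre_real s \<in> borel_measurable borel"
  unfolding legendre_real_def[abs_def] by measurable

lemma legendre_real_sums:
  assumes x: "-1 < x" "x \<le> 1"
  shows "(\<lambda>n. pochhammer s n * pochhammer (1 - s) n / (fact n)\<^sup>2 * ((1 - x) / 2) ^ n) sums legendre_real s x"
    and "legendre_P (of_real (s - 1)) x = of_real (legendre_real s x)"
proof -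
  let ?c = "\<lambda>n. pochhammer s n * pochhammer (1 - s) n / (fact n)\<^sup>2 * ((1 - x) / 2) ^ n"
  have c: "legendre_coeff (of_real (s - 1)) n * complex_of_real ((1 - x) / 2) ^ n = of_real (?c n)" for n
    using pochhammer_of_real[of s n, where 'a = complex] pochhammer_of_real[of "1 - s" n, where 'a = complex]
    by (simp add: legendre_coeff_def mult.commute)
  have "(\<lambda>n. complex_of_real (?c n)) sums legendre_P (of_real (s - 1)) x"
    unfolding legendre_P_altdef c[symmetric]
    using summable_norm_cancel[OF legendre_coeff_summable[OF x]] by (rule summable_sums)
  then have r: "?c sums Re (legendre_P (of_real (s - 1)) x)" and "(\<lambda>n. 0) sums Im (legendre_P (of_real (s - 1)) x)"
    unfolding sums_complex_iff Re_complex_of_real Im_complex_of_real by blast+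
  then have "Im (legendre_P (of_real (s - 1)) x) = 0"
    using sums_unique2 sums_zero by blast
  then show "legendre_P (of_real (s - 1)) x = of_real (legendre_real s x)"
    by (simp add: complex_eq_iff legendre_real_def)
  show "?c sums legendre_real s x" using r by (simp add: legendre_real_def)
qed

lemma legendre_real_reflect: "legendre_real (1 - s) x = legendre_real s x"
  using legendre_P_reflect[of "of_real (s - 1)" x] by (simp add: legendre_real_def algebra_simps)

lemma legendre_real_ge_1:
  assumes s: "0 < s" "s < 1" and x: "-1 < x" "x \<le> 1"
  shows "1 \<le> legendre_real s x"
proof -
  let ?c = "\<lambda>n. pochhammer s n * pochhammer (1 - s) n / (fact n)\<^sup>2 * ((1 - x) / 2) ^ n"
  have "sum ?c {0} \<le> suminf ?c"
    using legendre_real_sums(1)[OF x, of s] s x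
    by (intro sum_le_suminf) (auto simp: sums_iff intro!: mult_nonneg_nonneg divide_nonneg_pos less_imp_le[OF pochhammer_pos])
  then show ?thesis using legendre_real_sums(1)[OF x, of s] by (simp add: sums_iff)
qed

section \<open>Beta integrals and Euler's integral\<close>

lemma nn_integral_Beta:
  fixes a b :: real
  assumes "0 < a" "0 < b"
  shows "(\<integral>\<^sup>+t\<in>{0<..<1}. ennreal (t powr (a - 1) * (1 - t) powr (b - 1)) \<partial>lborel) = ennreal (Beta a b)"
proof (rule nn_integral_has_integral_lebesgue')
  show "((\<lambda>t. t powr (a - 1) * (1 - t) powr (b - 1)) has_integral Beta a b) {0<..<1}"
    using has_integral_Beta_real[OF assms] by (simp add: has_integral_Icc_iff_Ioo)
qed auto

text \<open>For \<open>0 < s < 1\<close> all terms of the binomial expansion of the last factor are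
  nonnegative, so sum and integral may be exchanged at once, and each term is the beta integral
  \<open>Beta (n + 1 - s) s\<close>. This is Euler's integral for the parameters \<open>s\<close>,
  \<open>1 - s\<close>, 1.\<close>

lemma legendre_real_Euler:
  assumes s: "0 < s" "s < 1" and x: "-1 < x" "x \<le> 1"
  shows "(\<integral>\<^sup>+t\<in>{0<..<1}. ennreal (t powr (- s) * (1 - t) powr (s - 1) * (1 - (1 - x) / 2 * t) powr (- s)) \<partial>lborel)
    = ennreal (Gamma s * Gamma (1 - s) * legendre_real s x)"
proof -
  define z where "z = (1 - x) / 2"
  have z: "0 \<le> z" "z < 1" using x by (auto simp: z_def)
  define p where "p n = pochhammer s n / fact n * z ^ n" for n
  have p0: "0 \<le> p n" for n using s z by (auto simp: p_def intro!: mult_nonneg_nonneg divide_nonneg_pos pochhammer_nonneg)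
  have coef: "(\<integral>\<^sup>+t\<in>{0<..<1}. ennreal (p n * (t powr (n - s) * (1 - t) powr (s - 1))) \<partial>lborel)
     = ennreal (Gamma s * Gamma (1 - s) * (pochhammer s n * pochhammer (1 - s) n / (fact n)\<^sup>2 * z ^ n))" for n
  proof -
    have ns: "1 - s \<notin> \<int>\<^sub>\<le>\<^sub>0" using s by (auto elim!: nonpos_Ints_cases)
    have "(\<integral>\<^sup>+t\<in>{0<..<1}. ennreal (p n * (t powr (n - s) * (1 - t) powr (s - 1))) \<partial>lborel)
      = (\<integral>\<^sup>+t. ennreal (p n) * (ennreal (t powr ((n + 1 - s) - 1) * (1 - t) powr (s - 1)) * indicator {0<..<1} t) \<partial>lborel)"
      using p0 by (intro nn_integral_cong) (auto simp: ennreal_mult' indicator_def)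
    also have "\<dots> = ennreal (p n) * ennreal (Beta (n + 1 - s) s)"
      using s by (subst nn_integral_cmult, simp, subst nn_integral_Beta) auto
    also have "\<dots> = ennreal (p n * Beta (n + 1 - s) s)"
      using p0 by (simp add: ennreal_mult')
    also have "Beta (n + 1 - s) s = Gamma s * Gamma (1 - s) * pochhammer (1 - s) n / fact n"
    proof -
      have g: "Gamma (1 - s + real n) = pochhammer (1 - s) n * Gamma (1 - s)"
        using pochhammer_Gamma[OF ns, of n] ns by (simp add: Gamma_eq_zero_iff)
      have "Beta (n + 1 - s) s = Gamma (1 - s + real n) * Gamma s / Gamma (1 + real n)"
        by (simp add: Beta_def algebra_simps)
      then show ?thesis unfolding g Gamma_fact by simp
    qed
    also have "p n * \<dots> = Gamma s * Gamma (1 - s) * (pochhammer s n * pochhammer (1 - s) n / (fact n)\<^sup>2 * z ^ n)"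
      by (simp add: p_def power2_eq_square)
    finally show ?thesis .
  qed
  have "(\<integral>\<^sup>+t\<in>{0<..<1}. ennreal (t powr (- s) * (1 - t) powr (s - 1) * (1 - z * t) powr (- s)) \<partial>lborel)
     = (\<integral>\<^sup>+t. (\<Sum>n. ennreal (p n * (t powr (n - s) * (1 - t) powr (s - 1))) * indicator {0<..<1} t) \<partial>lborel)"
  proof (rule nn_integral_cong)
    fix t :: real
    show "ennreal (t powr (- s) * (1 - t) powr (s - 1) * (1 - z * t) powr (- s)) * indicator {0<..<1} t
      = (\<Sum>n. ennreal (p n * (t powr (n - s) * (1 - t) powr (s - 1))) * indicator {0<..<1} t)"
    proof (cases "t \<in> {0<..<1}")
      case True
      then have t: "0 < t" "t < 1" by auto
      have zt: "\<bar>z * t\<bar> < 1" using z t mult_strict_mono[of z 1 t 1] by (simp add: abs_mult)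
      have "(\<lambda>n. t powr (- s) * (1 - t) powr (s - 1) * (pochhammer s n / fact n * (z * t) ^ n)) sums
          (t powr (- s) * (1 - t) powr (s - 1) * (1 - z * t) powr (- s))"
        by (intro sums_mult binomial_pochhammer_sums zt)
      moreover have "t powr (- s) * (1 - t) powr (s - 1) * (pochhammer s n / fact n * (z * t) ^ n)
          = p n * (t powr (n - s) * (1 - t) powr (s - 1))" for n
        using t by (simp add: p_def power_mult_distrib powr_diff powr_minus powr_realpow field_simps)
      ultimately have "(\<lambda>n. p n * (t powr (n - s) * (1 - t) powr (s - 1))) sums
          (t powr (- s) * (1 - t) powr (s - 1) * (1 - z * t) powr (- s))" by simp
      then show ?thesis
        using True p0 by (simp add: sums_iff suminf_ennreal2)
    qed simp
  qed
  also have "\<dots> = (\<Sum>n. ennreal (Gamma s * Gamma (1 - s) * (pochhammer s n * pochhammer (1 - s) n / (fact n)\<^sup>2 * z ^ n)))"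
    by (subst nn_integral_suminf, measurable, simp only: coef)
  also have "\<dots> = ennreal (Gamma s * Gamma (1 - s) * legendre_real s x)"
  proof -
    have "(\<lambda>n. Gamma s * Gamma (1 - s) * (pochhammer s n * pochhammer (1 - s) n / (fact n)\<^sup>2 * z ^ n)) sums
        (Gamma s * Gamma (1 - s) * legendre_real s x)"
      unfolding z_def by (intro sums_mult legendre_real_sums x)
    moreover have "0 \<le> Gamma s * Gamma (1 - s) * (pochhammer s n * pochhammer (1 - s) n / (fact n)\<^sup>2 * z ^ n)" for n
      using s z Gamma_real_pos[of s] Gamma_real_pos[of "1 - s"]
      by (intro mult_nonneg_nonneg divide_nonneg_pos pochhammer_nonneg) auto
    ultimately show ?thesis
      by (simp add: sums_iff suminf_ennreal2)
  qed
  finally show ?thesis by (simp add: z_def)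
qed

section \<open>The Legendre function as a boundary value\<close>

text \<open>Since \<open>0 powr a = 0\<close>, the integrand vanishes wherever \<open>sinh t \<le> y\<close>.\<close>
definition legR :: "real \<Rightarrow> real \<Rightarrow> real" where
  "legR s y = (\<integral>t. max 0 (sinh t - y) powr (- s) \<partial>lborel)"

lemma borel_measurable_sinh [measurable]: "(sinh :: real \<Rightarrow> real) \<in> borel_measurable borel"
  and borel_measurable_cosh [measurable]: "(cosh :: real \<Rightarrow> real) \<in> borel_measurable borel"
  by (auto intro!: borel_measurable_continuous_onI continuous_intros)

text \<open>The integrand lives on \<open>t > arsinh y\<close>. With
  \<open>w = sqrt (1 + y\<^sup>2)\<close> one has \<open>exp (arsinh y) = w + y\<close>, and
  \<open>t = arsinh y - ln (1 - \<tau>)\<close> makes \<open>sinh t - y\<close> the product in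
  \<open>shg\<close>; its power times the Jacobian \<open>1 / (1 - \<tau>)\<close> is
  \<open>w powr (- s)\<close> times the Euler integrand.\<close>

lemma nn_integral_legR:
  assumes s: "0 < s" "s < 1"
  shows "(\<integral>\<^sup>+t. ennreal (max 0 (sinh t - y) powr (- s)) \<partial>lborel)
    = ennreal (Gamma s * Gamma (1 - s) * ((1 + y\<^sup>2) powr (- s / 2) * legendre_real s (y / sqrt (1 + y\<^sup>2))))"
proof -
  define w where "w = sqrt (1 + y\<^sup>2)"
  have w0: "0 < w" by (simp add: w_def add_pos_nonneg)
  have w2: "w\<^sup>2 = 1 + y\<^sup>2" by (simp add: w_def)
  have wy: "\<bar>y\<bar> < w" unfolding w_def by (rule real_less_rsqrt) simp
  have inv: "(w - y) * (w + y) = 1" using w2 by (simp add: algebra_simps power2_eq_square)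
  define x where "x = y / w"
  have x: "-1 < x" "x \<le> 1" using wy w0 by (auto simp: x_def field_simps)
  define g where "g \<tau> = arsinh y - ln (1 - \<tau>)" for \<tau> :: real
  define h where "h \<tau> = 1 / (1 - \<tau>)" for \<tau> :: real
  have ea: "exp (arsinh y) = w + y"
    using arsinh_real_aux[of y] by (simp add: arsinh_real_def w_def add.commute)
  have ema: "exp (- arsinh y) = w - y"
    using inv wy unfolding exp_minus ea by (simp add: field_simps inverse_eq_divide)
  have shg: "sinh (g \<tau>) - y = w * (\<tau> * (1 - (1 - x) / 2 * \<tau>) / (1 - \<tau>))" if "\<tau> < 1" for \<tau>
  proof -
    have e1: "exp (g \<tau>) = (w + y) / (1 - \<tau>)"
      using that by (simp add: g_def exp_diff ea)
    have e2: "exp (- g \<tau>) = (w - y) * (1 - \<tau>)"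
      using that unfolding g_def minus_diff_eq by (simp add: exp_diff ema[symmetric] exp_minus field_simps)
    have "sinh (g \<tau>) = ((w + y) / (1 - \<tau>) - (w - y) * (1 - \<tau>)) / 2"
      by (simp add: sinh_field_def e1 e2)
    also have "\<dots> - y = w * (\<tau> * (1 - (1 - x) / 2 * \<tau>) / (1 - \<tau>))"
      using that w0 by (simp add: x_def divide_simps) (simp add: algebra_simps)
    finally show ?thesis .
  qed
  have img: "g ` {0<..<1} = {arsinh y<..}"
  proof (intro set_eqI iffI)
    fix t assume "t \<in> {arsinh y<..}"
    then have "g (1 - exp (arsinh y - t)) = t" "1 - exp (arsinh y - t) \<in> {0<..<1}"
      by (auto simp: g_def)
    then show "t \<in> g ` {0<..<1}" by (metis imageI)
  qed (auto simp: g_def)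
  have "(\<integral>\<^sup>+t. ennreal (max 0 (sinh t - y) powr (- s)) \<partial>lborel)
      = (\<integral>\<^sup>+t\<in>{arsinh y<..}. ennreal (max 0 (sinh t - y) powr (- s)) \<partial>lborel)"
  proof (rule nn_integral_cong)
    fix t
    have "max 0 (sinh t - y) = 0" if "\<not> arsinh y < t"
      using that sinh_arsinh_real[of y] sinh_real_le_iff[of t "arsinh y"] by simp
    then show "ennreal (max 0 (sinh t - y) powr (- s))
        = ennreal (max 0 (sinh t - y) powr (- s)) * indicator {arsinh y<..} t"
      by (auto simp: indicator_def)
  qed
  also have "\<dots> = (\<integral>\<^sup>+\<tau>\<in>{0<..<1}. ennreal (\<bar>h \<tau>\<bar> * max 0 (sinh (g \<tau>) - y) powr (- s)) \<partial>lborel)"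
    unfolding img[symmetric]
  proof (rule nn_integral_change_of_variables)
    show "inj_on g {0<..<1}" by (auto simp: g_def inj_on_def)
    show "(g has_real_derivative h \<tau>) (at \<tau>)" if "\<tau> \<in> {0<..<1}" for \<tau>
      using that unfolding g_def h_def by (auto intro!: derivative_eq_intros)
  qed (auto simp: img, unfold g_def h_def, measurable)
  also have "\<dots> = (\<integral>\<^sup>+\<tau>. ennreal (w powr (- s)) * (ennreal (\<tau> powr (- s) * (1 - \<tau>) powr (s - 1) * (1 - (1 - x) / 2 * \<tau>) powr (- s)) * indicator {0<..<1} \<tau>) \<partial>lborel)"
  proof (rule nn_integral_cong)
    fix \<tau> :: real
    show "ennreal (\<bar>h \<tau>\<bar> * max 0 (sinh (g \<tau>) - y) powr (- s)) * indicator {0<..<1} \<tau>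
       = ennreal (w powr (- s)) * (ennreal (\<tau> powr (- s) * (1 - \<tau>) powr (s - 1) * (1 - (1 - x) / 2 * \<tau>) powr (- s)) * indicator {0<..<1} \<tau>)"
    proof (cases "\<tau> \<in> {0<..<1}")
      case True
      have z: "0 < 1 - (1 - x) / 2 * \<tau>"
        using True x mult_strict_mono'[of "(1 - x) / 2" 1 \<tau> 1] by auto
      then have pos: "0 < w * (\<tau> * (1 - (1 - x) / 2 * \<tau>) / (1 - \<tau>))"
        using True w0 by auto
      have "\<bar>h \<tau>\<bar> * max 0 (sinh (g \<tau>) - y) powr (- s)
          = (1 / (1 - \<tau>)) * (w * (\<tau> * (1 - (1 - x) / 2 * \<tau>) / (1 - \<tau>))) powr (- s)"
        using True pos shg[of \<tau>] by (simp add: h_def)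
      also have "\<dots> = w powr (- s) * (\<tau> powr (- s) * (1 - \<tau>) powr (s - 1) * (1 - (1 - x) / 2 * \<tau>) powr (- s))"
      proof -
        define Z where "Z = 1 - (1 - x) / 2 * \<tau>"
        have "(w * (\<tau> * Z / (1 - \<tau>))) powr (- s) = w powr (- s) * (\<tau> powr (- s) * Z powr (- s) / (1 - \<tau>) powr (- s))"
          using True w0 z by (simp add: powr_mult powr_divide Z_def)
        moreover have "(1 - \<tau>) powr (s - 1) = 1 / (1 - \<tau>) / (1 - \<tau>) powr (- s)"
          using True by (simp add: powr_diff powr_minus field_simps)
        ultimately show ?thesis unfolding Z_def[symmetric] by (simp only:) (simp add: mult_ac)
      qed
      finally show ?thesis using True by (simp add: ennreal_mult')
    qed simp
  qed
  also have "\<dots> = ennreal (w powr (- s)) * ennreal (Gamma s * Gamma (1 - s) * legendre_real s x)"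
    by (subst nn_integral_cmult, measurable, subst legendre_real_Euler[OF s x]) simp
  also have "w powr (- s) = (1 + y\<^sup>2) powr (- s / 2)"
    unfolding w_def by (simp add: powr_half_sqrt[symmetric] powr_powr)
  finally show ?thesis
    using legendre_real_ge_1[OF s x] Gamma_real_pos[of s] Gamma_real_pos[of "1 - s"] s
    by (simp add: ennreal_mult'[symmetric] mult_ac x_def w_def del: Gamma_real_pos)
qed

lemma div_sqrt_one_plus_square_bounds: "-1 < y / sqrt (1 + y\<^sup>2)" "y / sqrt (1 + y\<^sup>2) < (1::real)"
proof -
  have "\<bar>y\<bar> < sqrt (1 + y\<^sup>2)" by (rule real_less_rsqrt) simp
  moreover have "0 < sqrt (1 + y\<^sup>2)" by (simp add: add_pos_nonneg)
  ultimately show "-1 < y / sqrt (1 + y\<^sup>2)" "y / sqrt (1 + y\<^sup>2) < 1" by (auto simp: field_simps)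
qed

lemma legR_eq:
  assumes s: "0 < s" "s < 1"
  shows "legR s y = Gamma s * Gamma (1 - s) * ((1 + y\<^sup>2) powr (- s / 2) * legendre_real s (y / sqrt (1 + y\<^sup>2)))"
    and integrable_legR: "integrable lborel (\<lambda>t. max 0 (sinh t - y) powr (- s))"
    and legR_nn: "(\<integral>\<^sup>+t. ennreal (max 0 (sinh t - y) powr (- s)) \<partial>lborel) = ennreal (legR s y)"
proof -
  let ?R = "Gamma s * Gamma (1 - s) * ((1 + y\<^sup>2) powr (- s / 2) * legendre_real s (y / sqrt (1 + y\<^sup>2)))"
  have pos: "0 \<le> ?R"
    using legendre_real_ge_1[OF s div_sqrt_one_plus_square_bounds(1) less_imp_le[OF div_sqrt_one_plus_square_bounds(2)], of y] s
    by (intro mult_nonneg_nonneg) (auto intro: less_imp_le Gamma_real_pos)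
  show i: "integrable lborel (\<lambda>t. max 0 (sinh t - y) powr (- s))"
    by (rule integrableI_nonneg) (auto simp: nn_integral_legR[OF s])
  show eq: "legR s y = ?R"
    unfolding legR_def by (subst integral_eq_nn_integral) (simp_all only: nn_integral_legR[OF s] enn2real_ennreal[OF pos], auto)
  show "(\<integral>\<^sup>+t. ennreal (max 0 (sinh t - y) powr (- s)) \<partial>lborel) = ennreal (legR s y)"
    unfolding eq by (rule nn_integral_legR[OF s])
qed

lemma legR_nonneg: "0 \<le> legR s y"
  unfolding legR_def by (rule integral_nonneg_AE) auto

lemma borel_measurable_legR [measurable]:
  assumes s: "0 < s" "s < 1"
  shows "legR s \<in> borel_measurable borel"
  unfolding legR_eq(1)[OF s, abs_def] by measurable

lemma max_diff_sinh:
  fixes y t :: real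
  shows "max 0 (sinh t - (- y)) = (if 0 \<le> y + sinh t then \<bar>y + sinh t\<bar> else 0)"
    and "max 0 (sinh (0 + (- 1) * t) - y) = (if 0 \<le> y + sinh t then 0 else \<bar>y + sinh t\<bar>)"
    and "max 0 (sinh (- t) - y) = (if 0 \<le> y + sinh t then 0 else \<bar>y + sinh t\<bar>)"
  by (auto simp: max_def abs_if)

text \<open>The integrand is that of \<open>legR s (- y)\<close> plus the reflection of that of
  \<open>legR s y\<close>, so integrability across the singularity comes from the Euler
  integral.\<close>

lemma integrable_abs_sinh_powr:
  fixes s y :: real
  assumes s: "0 < s" "s < 1"
  shows "integrable lborel (\<lambda>t. \<bar>y + sinh t\<bar> powr (- s))"
proof -
  have "integrable lborel (\<lambda>t. max 0 (sinh (0 + (-1) * t) - y) powr (- s))"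
    using integrable_legR[OF s, of y] by (rule lborel_integrable_real_affine) simp
  with integrable_legR[OF s, of "- y"]
  have "integrable lborel (\<lambda>t. max 0 (sinh t - (- y)) powr (- s) + max 0 (sinh (0 + (-1) * t) - y) powr (- s))"
    by (rule Bochner_Integration.integrable_add)
  moreover have "max 0 (sinh t - (- y)) powr (- s) + max 0 (sinh (0 + (-1) * t) - y) powr (- s) = \<bar>y + sinh t\<bar> powr (- s)" for t
    unfolding max_diff_sinh by simp
  ultimately show ?thesis by simp
qed

lemma integrable_cosh_powr:
  assumes s: "0 < s"
  shows "integrable lborel (\<lambda>t::real. cosh t powr (- s))"
proof -
  \<comment> \<open>The comparison with a power of \<open>sinh\<close> needs an exponent below 1;
    lowering \<open>s\<close> to \<open>r\<close> only enlarges the integrand because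
    \<open>cosh t \<ge> 1\<close>.\<close>
  define r where "r = min s (1/2)"
  have r: "0 < r" "r < 1" "r \<le> s" using s by (auto simp: r_def)
  show ?thesis
  proof (rule Bochner_Integration.integrable_bound[OF integrable_abs_sinh_powr[OF r(1,2), of 0]])
    have "AE t in lborel. t \<noteq> (0::real)"
      using AE_lborel_singleton by blast
    then show "AE t in lborel. norm (cosh t powr (- s)) \<le> norm (\<bar>0 + sinh t\<bar> powr (- r))"
    proof eventually_elim
      case (elim t)
      have "\<bar>sinh t\<bar> \<le> cosh t"
        using sinh_le_cosh_real[of t] sinh_le_cosh_real[of "- t"] by (simp add: abs_le_iff)
      have "cosh t powr (- s) \<le> cosh t powr (- r)"
        using cosh_real_ge_1[of t] r by (intro powr_mono) auto
      also have "\<dots> \<le> \<bar>sinh t\<bar> powr (- r)"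
        using \<open>\<bar>sinh t\<bar> \<le> cosh t\<close> elim r by (intro powr_mono2') auto
      finally show ?case by simp
    qed
  qed measurable
qed

section \<open>Values on the imaginary axis by a shift of contour\<close>

definition legF :: "real \<Rightarrow> complex \<Rightarrow> complex" where
  "legF s u = (\<integral>t. (u + of_real (cosh t)) powr (- of_real s) \<partial>lborel)"

lemma cosh_Complex: "cosh (Complex t a) = Complex (cosh t * cos a) (sinh t * sin a)"
proof -
  have "cosh (Complex t a) = cos (\<i> * Complex t a)" by (rule cosh_conv_cos)
  also have "\<i> * Complex t a = Complex (- a) t" by (simp add: complex_eq_iff)
  also have "cos (Complex (- a) t) = Complex (cosh t * cos a) (sinh t * sin a)"
    by (simp add: complex_eq_iff Re_cos Im_cos cosh_field_def sinh_field_def field_simps)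
  finally show ?thesis .
qed

lemma powr_imaginary:
  fixes x s :: real
  assumes "x \<noteq> 0"
  shows "(\<i> * of_real x) powr (- of_real s) = of_real (\<bar>x\<bar> powr (- s)) * cis (- sgn x * pi * s / 2)"
proof (cases "0 < x")
  case True
  have "(\<i> * of_real x) powr (- complex_of_real s) = (of_real x * \<i>) powr (- complex_of_real s)"
    by (metis mult.commute)
  also have "\<dots> = of_real (x powr (- s)) * \<i> powr (- complex_of_real s)"
    using True by (subst powr_times_real_left) (auto simp flip: powr_of_real)
  also have "\<i> powr (- complex_of_real s) = cis (- pi * s / 2)"
    by (simp add: powr_def cis_conv_exp mult_ac)
  finally show ?thesis using True by simp
next
  case False
  have "(\<i> * of_real x) powr (- complex_of_real s) = (of_real (- x) * (- \<i>)) powr (- complex_of_real s)"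
    by (simp add: mult.commute)
  also have "\<dots> = of_real ((- x) powr (- s)) * (- \<i>) powr (- complex_of_real s)"
    using False by (subst powr_times_real_left) (auto simp flip: powr_of_real)
  also have "(- \<i>) powr (- complex_of_real s) = cis (pi * s / 2)"
    by (simp add: powr_def cis_conv_exp mult_ac)
  finally show ?thesis using False assms by simp
qed

text \<open>Because \<open>cosh (t + \<i> * pi / 2) = \<i> * sinh t\<close>, the base on the shifted
  line is \<open>\<i> * (y + sinh t)\<close>. Its principal power has phase
  \<open>- pi * s / 2\<close> where \<open>y + sinh t\<close> is positive and
  \<open>pi * s / 2\<close> where it is negative; these two ranges of \<open>t\<close> produce the
  two terms.\<close>

lemma legF_imaginary:
  assumes s: "0 < s" "s < 1"
  shows "legF s (\<i> * of_real y) = cis (- pi * s / 2) * of_real (legR s (- y)) + cis (pi * s / 2) * of_real (legR s y)"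
proof -
  define k where "k z = (\<i> * of_real y + cosh z) powr (- of_real s)" for z
  define k1 where "k1 t = cis (- pi * s / 2) * of_real (max 0 (sinh t - (- y)) powr (- s))
     + cis (pi * s / 2) * of_real (max 0 (sinh (- t) - y) powr (- s))" for t
  define M where "M t = \<bar>y + sinh t\<bar> powr (- s) + cosh t powr (- s)" for t
  let ?b = "pi / 2"
  have k: "k (Complex t a) = Complex (cosh t * cos a) (y + sinh t * sin a) powr (- of_real s)" for t a
  proof -
    have "\<i> * of_real y + cosh (Complex t a) = Complex (cosh t * cos a) (y + sinh t * sin a)"
      unfolding cosh_Complex by (simp add: complex_eq_iff)
    then show ?thesis by (simp add: k_def)
  qed
  have hol: "k holomorphic_on {z. 0 < Im z \<and> Im z < ?b}"
  proof -
    have "\<i> * of_real y + cosh z \<notin> \<real>\<^sub>\<le>\<^sub>0" if "0 < Im z" "Im z < ?b" for z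
    proof -
      have "Re (\<i> * of_real y + cosh z) = cosh (Re z) * cos (Im z)"
        using cosh_Complex[of "Re z" "Im z"] by simp
      also have "\<dots> > 0" using that by (intro mult_pos_pos cos_gt_zero_pi) auto
      finally show ?thesis using complex_nonpos_Reals_iff by fastforce
    qed
    moreover have "cosh holomorphic_on S" for S :: "complex set"
      unfolding cosh_field_def[abs_def] by (intro holomorphic_intros) auto
    ultimately show ?thesis unfolding k_def by (intro holomorphic_intros) auto
  qed
  have M: "integrable lborel M"
    unfolding M_def by (intro Bochner_Integration.integrable_add integrable_abs_sinh_powr integrable_cosh_powr s)
  have ne: "AE t in lborel. y + sinh t \<noteq> 0"
  proof -
    have "AE t in lborel. t \<noteq> arsinh (- y)"
      using AE_lborel_singleton by blast
    then show ?thesis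
    proof eventually_elim
      case (elim t)
      show ?case
      proof
        assume "y + sinh t = 0"
        then have "sinh t = - y" by simp
        then have "t = arsinh (- y)" by (metis arsinh_sinh_real)
        with elim show False by simp
      qed
    qed
  qed
  have bound: "AE t in lborel. \<forall>a. 0 < a \<longrightarrow> a < ?b \<longrightarrow> norm (k (Complex t a)) \<le> M t"
    using ne
  proof (eventually_elim, intro allI impI)
    fix t a assume t: "y + sinh t \<noteq> 0" and a: "0 < a" "a < ?b"
    define \<sigma> where "\<sigma> = sin a"
    have sg: "0 \<le> \<sigma>" "\<sigma> \<le> 1" using a by (auto simp: \<sigma>_def sin_ge_zero)
    \<comment> \<open>The squared modulus is concave in \<open>sin a\<close>, so it is at least its smaller end value.\<close>
    define E where "E = (cosh t * cos a)\<^sup>2 + (y + sinh t * sin a)\<^sup>2"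
    define A where "A = (cosh t)\<^sup>2"
    define B where "B = (y + sinh t)\<^sup>2"
    have c2: "(cos a)\<^sup>2 = 1 - \<sigma>\<^sup>2" by (simp add: \<sigma>_def cos_squared_eq)
    have "E = (1 - \<sigma>) * A + \<sigma> * B + (1 - \<sigma>) * (y\<^sup>2 + \<sigma>)"
      unfolding E_def A_def B_def power_mult_distrib c2 \<sigma>_def[symmetric]
      unfolding cosh_square_eq by (simp add: algebra_simps power2_eq_square)
    then have E: "(1 - \<sigma>) * A + \<sigma> * B \<le> E" using sg by simp
    have "(1 - \<sigma>) * min A B + \<sigma> * min A B \<le> (1 - \<sigma>) * A + \<sigma> * B"
      using sg by (intro add_mono mult_left_mono) auto
    with E have E2: "min A B \<le> E" by (simp add: algebra_simps)
    have nrm: "norm (Complex (cosh t * cos a) (y + sinh t * sin a)) = sqrt E"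
      by (simp add: cmod_def E_def)
    have A0: "0 < A" "sqrt A = cosh t" by (auto simp: A_def)
    have B0: "0 < B" "sqrt B = \<bar>y + sinh t\<bar>" using t by (auto simp: B_def)
    have "norm (k (Complex t a)) = sqrt E powr (- s)"
    proof -
      have "sqrt E > 0" using E2 A0 B0 by auto
      then have "Complex (cosh t * cos a) (y + sinh t * sin a) \<noteq> 0" using nrm by force
      then show ?thesis
        unfolding k nrm[symmetric] by (simp add: norm_powr_real_powr')
    qed
    also have "\<dots> \<le> sqrt (min A B) powr (- s)"
      using A0 B0 E2 s by (intro powr_mono2') auto
    also have "\<dots> \<le> M t"
      using A0 B0 by (auto simp: min_def M_def)
    finally show "norm (k (Complex t a)) \<le> M t" .
  qed
  have lim0: "((\<lambda>a. k (Complex t a)) \<longlongrightarrow> (\<i> * of_real y + of_real (cosh t)) powr (- of_real s)) (at_right 0)" for t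
  proof -
    have "((\<lambda>a. Complex (cosh t * cos a) (y + sinh t * sin a) powr (- complex_of_real s)) \<longlongrightarrow>
        Complex (cosh t * cos 0) (y + sinh t * sin 0) powr (- complex_of_real s)) (at_right 0)"
      by (intro tendsto_powr_complex tendsto_Complex tendsto_intros) (use cosh_real_pos[of t] in \<open>auto simp: complex_nonpos_Reals_iff simp del: cosh_real_pos\<close>)
    also have "Complex (cosh t * cos 0) (y + sinh t * sin 0) = \<i> * of_real y + of_real (cosh t)"
      by (simp add: complex_eq_iff)
    finally show ?thesis unfolding k .
  qed
  have lim1: "AE t in lborel. ((\<lambda>a. k (Complex t a)) \<longlongrightarrow> k1 t) (at_left ?b)"
    using ne
  proof eventually_elim
    case (elim t)
    have "((\<lambda>a. Complex (cosh t * cos a) (y + sinh t * sin a) powr (- complex_of_real s)) \<longlongrightarrow>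
        Complex (cosh t * cos ?b) (y + sinh t * sin ?b) powr (- complex_of_real s)) (at_left ?b)"
      by (intro tendsto_powr_complex tendsto_Complex tendsto_intros) (use elim in \<open>auto simp: complex_nonpos_Reals_iff\<close>)
    also have "Complex (cosh t * cos ?b) (y + sinh t * sin ?b) = \<i> * of_real (y + sinh t)"
      by (simp add: complex_eq_iff)
    also have "(\<i> * of_real (y + sinh t)) powr (- complex_of_real s) = k1 t"
      unfolding powr_imaginary[OF elim] k1_def max_diff_sinh
      using elim by (cases "0 < y + sinh t") (auto simp: mult.commute)
    finally show ?case unfolding k .
  qed
  have [measurable]: "k1 \<in> borel_measurable borel" unfolding k1_def by measurable
  have i2: "integrable lborel (\<lambda>t. max 0 (sinh (- t) - y) powr (- s))"
    using lborel_integrable_real_affine[OF integrable_legR[OF s, of y], of "-1" 0] by simp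
  have "legF s (\<i> * of_real y) = (\<integral>t. k1 t \<partial>lborel)"
    unfolding legF_def
    by (rule strip_shift(3)[of ?b k M, OF _ hol M bound _ lim1]) (use lim0 in \<open>auto\<close>)
  also have "\<dots> = cis (- pi * s / 2) * of_real (legR s (- y)) + cis (pi * s / 2) * of_real (\<integral>t. max 0 (sinh (- t) - y) powr (- s) \<partial>lborel)"
    unfolding k1_def legR_def
    using integrable_legR[OF s, of "- y"] i2
    by (subst Bochner_Integration.integral_add) (auto simp del: of_real_mult)
  also have "(\<integral>t. max 0 (sinh (- t) - y) powr (- s) \<partial>lborel) = legR s y"
    unfolding legR_def by (subst lborel_integral_real_affine[of "-1" _ 0]) auto
  finally show ?thesis .
qed

section \<open>Contour integrals in the right half-plane\<close>

lemma borel_measurable_cnj [measurable]: "cnj \<in> borel_measurable borel"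
  by (intro borel_measurable_continuous_onI continuous_intros)

text \<open>The radius \<open>c\<close> is exceptional: there the boundary values on the positive axis may be singular.\<close>
lemma half_plane_contour:
  fixes f :: "complex \<Rightarrow> complex" and fp fm g :: "real \<Rightarrow> complex" and M :: "real \<Rightarrow> real" and c :: real
  assumes hol: "f holomorphic_on {w. 0 < Re w \<and> Im w \<noteq> 0}"
    and M: "set_integrable lborel {0<..} M"
    and bound: "\<And>\<rho> a. 0 < \<rho> \<Longrightarrow> \<rho> \<noteq> c \<Longrightarrow> a \<noteq> 0 \<Longrightarrow> \<bar>a\<bar> < pi / 2 \<Longrightarrow> norm (f (of_real \<rho> * cis a)) \<le> M \<rho>"
    and fp: "\<And>\<rho>. 0 < \<rho> \<Longrightarrow> \<rho> \<noteq> c \<Longrightarrow> ((\<lambda>a. f (of_real \<rho> * cis a)) \<longlongrightarrow> fp \<rho>) (at_right 0)"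
    and fm: "\<And>\<rho>. 0 < \<rho> \<Longrightarrow> \<rho> \<noteq> c \<Longrightarrow> ((\<lambda>a. f (of_real \<rho> * cis (- a))) \<longlongrightarrow> fm \<rho>) (at_right 0)"
    and gp: "\<And>\<rho>. 0 < \<rho> \<Longrightarrow> \<rho> \<noteq> c \<Longrightarrow> ((\<lambda>a. f (of_real \<rho> * cis a)) \<longlongrightarrow> g \<rho>) (at_left (pi / 2))"
    and gm: "\<And>\<rho>. 0 < \<rho> \<Longrightarrow> \<rho> \<noteq> c \<Longrightarrow> ((\<lambda>a. f (of_real \<rho> * cis (- a))) \<longlongrightarrow> g (- \<rho>)) (at_left (pi / 2))"
    and [measurable]: "M \<in> borel_measurable borel" "fp \<in> borel_measurable borel"
      "fm \<in> borel_measurable borel" "g \<in> borel_measurable borel"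
  shows "integrable lborel g"
    and "\<i> * (\<integral>y. g y \<partial>lborel) = (LINT \<rho>:{0<..}|lborel. fp \<rho> - fm \<rho>)"
proof -
  have img: "exp ` UNIV = {0::real<..}" by (auto simp: image_iff) (metis exp_ln)
  have sub_int: "set_integrable lborel {0<..} F \<longleftrightarrow> integrable lborel (\<lambda>t. exp t *\<^sub>R F (exp t))"
    and sub_eq: "(LINT \<rho>:{0<..}|lborel. F \<rho>) = (\<integral>t. exp t *\<^sub>R F (exp t) \<partial>lborel)"
    if [measurable]: "F \<in> borel_measurable borel" for F :: "real \<Rightarrow> 'a::euclidean_space"
  proof -
    have "set_integrable lborel (exp ` UNIV) F \<longleftrightarrow> set_integrable lborel UNIV (\<lambda>t. \<bar>exp t\<bar> *\<^sub>R F (exp t))"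
      "(LINT \<rho>:exp ` UNIV|lborel. F \<rho>) = (LINT t:UNIV|lborel. \<bar>exp t\<bar> *\<^sub>R F (exp t))"
      by (rule set_integrable_change_of_variables; auto simp: img intro!: derivative_eq_intros inj_onI)+
    then show "set_integrable lborel {0<..} F \<longleftrightarrow> integrable lborel (\<lambda>t. exp t *\<^sub>R F (exp t))"
      "(LINT \<rho>:{0<..}|lborel. F \<rho>) = (\<integral>t. exp t *\<^sub>R F (exp t) \<partial>lborel)"
      unfolding img by (simp_all add: set_integrable_def set_lebesgue_integral_def)
  qed
  have quadrant: "set_integrable lborel {0<..} f0 \<and> set_integrable lborel {0<..} f1 \<and>
      (LINT \<rho>:{0<..}|lborel. f0 \<rho>) = \<i> * (LINT \<rho>:{0<..}|lborel. f1 \<rho>)"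
    if hol: "h holomorphic_on {w. 0 < Re w \<and> 0 < Im w}"
    and bound: "\<And>\<rho> a. 0 < \<rho> \<Longrightarrow> \<rho> \<noteq> c \<Longrightarrow> 0 < a \<Longrightarrow> a < pi / 2 \<Longrightarrow> norm (h (of_real \<rho> * cis a)) \<le> M \<rho>"
    and f0: "\<And>\<rho>. 0 < \<rho> \<Longrightarrow> \<rho> \<noteq> c \<Longrightarrow> ((\<lambda>a. h (of_real \<rho> * cis a)) \<longlongrightarrow> f0 \<rho>) (at_right 0)"
    and f1: "\<And>\<rho>. 0 < \<rho> \<Longrightarrow> \<rho> \<noteq> c \<Longrightarrow> ((\<lambda>a. h (of_real \<rho> * cis a)) \<longlongrightarrow> f1 \<rho>) (at_left (pi / 2))"
    and [measurable]: "f0 \<in> borel_measurable borel" "f1 \<in> borel_measurable borel"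
    for h f0 f1
  proof -
    \<comment> \<open>In the logarithmic coordinate \<open>w = exp z\<close> the quadrant is a strip
      of height \<open>pi / 2\<close>, and the factor \<open>exp z\<close> is
      \<open>dw / dz\<close>. On the upper edge it supplies the extra \<open>\<i>\<close>.\<close>
    define k where "k z = h (exp z) * exp z" for z
    have ex: "exp (Complex t a) = of_real (exp t) * cis a" for t a
      by (simp add: exp_eq_polar)
    have ne: "AE t in lborel. exp t \<noteq> c"
    proof -
      have "AE t in lborel. t \<noteq> ln c" using AE_lborel_singleton by blast
      then show ?thesis by eventually_elim auto
    qed
    have 1: "k holomorphic_on {z. 0 < Im z \<and> Im z < pi / 2}"
    proof -
      have "(h \<circ> exp) holomorphic_on {z. 0 < Im z \<and> Im z < pi / 2}"
      proof (rule holomorphic_on_compose_gen[OF _ hol])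
        show "exp ` {z. 0 < Im z \<and> Im z < pi / 2} \<subseteq> {w. 0 < Re w \<and> 0 < Im w}"
          by (auto simp: Re_exp Im_exp cos_gt_zero_pi sin_gt_zero)
      qed (intro holomorphic_intros)
      then show ?thesis unfolding k_def o_def by (intro holomorphic_intros)
    qed
    have 2: "integrable lborel (\<lambda>t. exp t *\<^sub>R M (exp t))"
      using M sub_int[of M] by simp
    have 3: "AE t in lborel. \<forall>a. 0 < a \<longrightarrow> a < pi / 2 \<longrightarrow> norm (k (Complex t a)) \<le> exp t *\<^sub>R M (exp t)"
      using ne by eventually_elim (auto simp: k_def ex norm_mult intro!: bound)
    have 4: "AE t in lborel. ((\<lambda>a. k (Complex t a)) \<longlongrightarrow> exp t *\<^sub>R f0 (exp t)) (at_right 0)"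
      using ne
    proof eventually_elim
      case (elim t)
      have "((\<lambda>a. h (of_real (exp t) * cis a) * (of_real (exp t) * cis a)) \<longlongrightarrow> f0 (exp t) * (of_real (exp t) * cis 0)) (at_right 0)"
        by (intro tendsto_mult f0 tendsto_const tendsto_cis[OF tendsto_ident_at]) (use elim in auto)
      then show ?case by (simp add: k_def ex scaleR_conv_of_real mult.commute)
    qed
    have 5: "AE t in lborel. ((\<lambda>a. k (Complex t a)) \<longlongrightarrow> exp t *\<^sub>R (\<i> * f1 (exp t))) (at_left (pi / 2))"
      using ne
    proof eventually_elim
      case (elim t)
      have "((\<lambda>a. h (of_real (exp t) * cis a) * (of_real (exp t) * cis a)) \<longlongrightarrow> f1 (exp t) * (of_real (exp t) * cis (pi / 2))) (at_left (pi / 2))"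
        by (intro tendsto_mult f1 tendsto_const tendsto_cis[OF tendsto_ident_at]) (use elim in auto)
      then show ?case by (simp add: k_def ex scaleR_conv_of_real mult_ac)
    qed
    have r: "integrable lborel (\<lambda>t. exp t *\<^sub>R f0 (exp t))" "integrable lborel (\<lambda>t. exp t *\<^sub>R (\<i> * f1 (exp t)))"
      "(\<integral>t. exp t *\<^sub>R f0 (exp t) \<partial>lborel) = (\<integral>t. exp t *\<^sub>R (\<i> * f1 (exp t)) \<partial>lborel)"
      by (rule strip_shift[OF _ 1 2 3 4 5]; simp)+
    have "set_integrable lborel {0<..} (\<lambda>\<rho>. \<i> * f1 \<rho>)"
      using r(2) sub_int[of "\<lambda>\<rho>. \<i> * f1 \<rho>"] by simp
    then have i1: "set_integrable lborel {0<..} f1" by simp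
    have "(LINT \<rho>:{0<..}|lborel. f0 \<rho>) = (LINT \<rho>:{0<..}|lborel. \<i> * f1 \<rho>)"
      using r(3) sub_eq[of "\<lambda>\<rho>. \<i> * f1 \<rho>"] sub_eq[of f0] by simp
    then show ?thesis using r(1) i1 sub_int[of f0] by simp
  qed
  have up: "set_integrable lborel {0<..} fp \<and> set_integrable lborel {0<..} g \<and>
      (LINT \<rho>:{0<..}|lborel. fp \<rho>) = \<i> * (LINT \<rho>:{0<..}|lborel. g \<rho>)"
    by (rule quadrant[of f]) (use fp gp bound in \<open>auto intro: holomorphic_on_subset[OF hol]\<close>)
  \<comment> \<open>Conjugation on both sides preserves holomorphy and carries the lower quadrant to
    the upper one, so \<open>quadrant\<close> can be applied a second time.\<close>
  define h where "h = cnj \<circ> f \<circ> cnj"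
  have hh: "h (of_real \<rho> * cis a) = cnj (f (of_real \<rho> * cis (- a)))" for \<rho> a
    by (simp add: h_def cis_cnj)
  have "cnj ` {w. 0 < Re w \<and> Im w \<noteq> 0} = {w. 0 < Re w \<and> Im w \<noteq> 0}"
    by (auto simp: image_iff intro!: exI[of _ "cnj _"])
  moreover have "open {w. 0 < Re w \<and> Im w \<noteq> 0}"
    by (intro open_Collect_conj open_Collect_less open_Collect_neq continuous_intros)
  ultimately have "h holomorphic_on {w. 0 < Re w \<and> Im w \<noteq> 0}"
    unfolding h_def using holomorphic_on_compose_cnj_cnj[of f "{w. 0 < Re w \<and> Im w \<noteq> 0}"] hol by simp
  then have holh: "h holomorphic_on {w. 0 < Re w \<and> 0 < Im w}"
    by (rule holomorphic_on_subset) auto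
  have lo: "set_integrable lborel {0<..} (\<lambda>\<rho>. cnj (fm \<rho>)) \<and> set_integrable lborel {0<..} (\<lambda>\<rho>. cnj (g (- \<rho>))) \<and>
      (LINT \<rho>:{0<..}|lborel. cnj (fm \<rho>)) = \<i> * (LINT \<rho>:{0<..}|lborel. cnj (g (- \<rho>)))"
  proof (rule quadrant[OF holh])
    show "norm (h (of_real \<rho> * cis a)) \<le> M \<rho>" if "0 < \<rho>" "\<rho> \<noteq> c" "0 < a" "a < pi / 2" for \<rho> a
      unfolding hh complex_mod_cnj using that by (intro bound) auto
    show "((\<lambda>a. h (of_real \<rho> * cis a)) \<longlongrightarrow> cnj (fm \<rho>)) (at_right 0)" if "0 < \<rho>" "\<rho> \<noteq> c" for \<rho>
      unfolding hh by (intro tendsto_cnj fm that)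
    show "((\<lambda>a. h (of_real \<rho> * cis a)) \<longlongrightarrow> cnj (g (- \<rho>))) (at_left (pi / 2))" if "0 < \<rho>" "\<rho> \<noteq> c" for \<rho>
      unfolding hh by (intro tendsto_cnj gm that)
  qed measurable
  have ifm: "set_integrable lborel {0<..} fm" and igm: "set_integrable lborel {0<..} (\<lambda>\<rho>. g (- \<rho>))"
    using integrable_cnj[OF lo[THEN conjunct1, unfolded set_integrable_def]]
      integrable_cnj[OF lo[THEN conjunct2, THEN conjunct1, unfolded set_integrable_def]]
    by (simp_all add: set_integrable_def complex_cnj_scaleR)
  have cnjint: "(LINT \<rho>:{0<..}|lborel. cnj (F \<rho>)) = cnj (LINT \<rho>:{0<..}|lborel. F \<rho>)" for F
    using Bochner_Integration.integral_cnj[of lborel "\<lambda>\<rho>. indicator {0<..} \<rho> *\<^sub>R F \<rho>"]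
    by (simp add: set_lebesgue_integral_def complex_cnj_scaleR)
  have lo_eq: "(LINT \<rho>:{0<..}|lborel. fm \<rho>) = - \<i> * (LINT \<rho>:{0<..}|lborel. g (- \<rho>))"
    using arg_cong[OF conjunct2[OF conjunct2[OF lo]], of cnj] unfolding cnjint by simp
  have igm': "set_integrable lborel {..<0} g"
    using lborel_integrable_real_affine[of "\<lambda>\<rho>. indicator {0<..} \<rho> *\<^sub>R g (- \<rho>)" "-1" 0] igm
    unfolding set_integrable_def by (simp add: indicator_def)
  have gm_eq: "(LINT \<rho>:{0<..}|lborel. g (- \<rho>)) = (LINT y:{..<0}|lborel. g y)"
    unfolding set_lebesgue_integral_def
    by (subst lborel_integral_real_affine[of "-1" _ 0]) (simp_all add: indicator_def)
  have AEeq: "AE y in lborel. indicator {..<0} y *\<^sub>R g y + indicator {0<..} y *\<^sub>R g y = g y"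
  proof -
    have "AE y in lborel. y \<noteq> (0::real)" using AE_lborel_singleton by blast
    then show ?thesis by eventually_elim (auto simp: indicator_def)
  qed
  have sum: "integrable lborel (\<lambda>y. indicator {..<0} y *\<^sub>R g y + indicator {0<..} y *\<^sub>R g y)"
    using igm' up unfolding set_integrable_def by (intro Bochner_Integration.integrable_add) auto
  show "integrable lborel g"
    using integrable_cong_AE[OF _ _ AEeq] sum by simp
  have "(\<integral>y. g y \<partial>lborel) = (LINT y:{..<0}|lborel. g y) + (LINT y:{0<..}|lborel. g y)"
    unfolding set_lebesgue_integral_def
    using igm' up integral_cong_AE[OF _ _ AEeq]
    by (simp add: set_integrable_def)
  then show "\<i> * (\<integral>y. g y \<partial>lborel) = (LINT \<rho>:{0<..}|lborel. fp \<rho> - fm \<rho>)"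
    using up ifm lo_eq gm_eq by (simp add: set_integral_diff algebra_simps)
qed

section \<open>Decay and holomorphy of \<open>legF\<close>\<close>

lemma norm_add_cosh:
  assumes "0 \<le> Re u"
  shows "norm u \<le> norm (u + of_real (cosh t))" "cosh t \<le> norm (u + of_real (cosh t))"
proof -
  have "(norm u)\<^sup>2 + (cosh t)\<^sup>2 \<le> (norm (u + of_real (cosh t)))\<^sup>2"
    unfolding cmod_power2 using assms by (simp add: power2_eq_square algebra_simps)
  then have "(norm u)\<^sup>2 \<le> (norm (u + of_real (cosh t)))\<^sup>2" "(cosh t)\<^sup>2 \<le> (norm (u + of_real (cosh t)))\<^sup>2"
    by (smt (verit) zero_le_power2)+
  then show "norm u \<le> norm (u + of_real (cosh t))" "cosh t \<le> norm (u + of_real (cosh t))"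
    by (auto intro: power2_le_imp_le)
qed

lemma legF_integrand:
  assumes u: "-1 < Re u"
  shows legF_measurable: "(\<lambda>t. (u + of_real (cosh t)) powr (- complex_of_real s)) \<in> borel_measurable borel"
    and add_cosh_nonpos: "u + of_real (cosh t) \<notin> \<real>\<^sub>\<le>\<^sub>0"
proof -
  have *: "u + of_real (cosh t) \<notin> \<real>\<^sub>\<le>\<^sub>0" for t
    using u cosh_real_ge_1[of t] by (auto simp: complex_nonpos_Reals_iff)
  then show "u + of_real (cosh t) \<notin> \<real>\<^sub>\<le>\<^sub>0" .
  have pos: "0 < Re u + cosh t" for t
    using u cosh_real_ge_1[of t] by linarith
  show "(\<lambda>t. (u + of_real (cosh t)) powr (- complex_of_real s)) \<in> borel_measurable borel"
    by (intro borel_measurable_continuous_onI continuous_on_powr_complex continuous_intros)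
       (auto simp: pos less_imp_le[OF pos] complex_eq_iff less_imp_neq[OF pos, symmetric])
qed

text \<open>Both \<open>norm u\<close> and \<open>cosh t\<close> are lower bounds for the modulus of
  the base, so the exponent \<open>s\<close> can be shared out: the part \<open>\<theta> * s\<close>
  keeps the integral over \<open>t\<close> convergent, and the rest becomes decay in
  \<open>u\<close>.\<close>

lemma legF_integrand_bound:
  assumes u: "0 \<le> Re u" and s: "0 < s" and th: "0 < \<theta>" "\<theta> < 1"
  shows "norm ((u + of_real (cosh t)) powr (- complex_of_real s)) \<le> max 1 (norm u) powr (- (1 - \<theta>) * s) * cosh t powr (- \<theta> * s)"
proof -
  define n where "n = norm (u + of_real (cosh t))"
  have n: "max 1 (norm u) \<le> n" "cosh t \<le> n"
    using norm_add_cosh[OF u, of t] cosh_real_ge_1[of t] by (auto simp: n_def)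
  have n0: "0 < n" using n(1) by linarith
  have "norm ((u + of_real (cosh t)) powr (- complex_of_real s)) = n powr (- s)"
    by (simp add: norm_powr_real_powr' n_def)
  also have "\<dots> = n powr (- (1 - \<theta>) * s) * n powr (- \<theta> * s)"
    by (simp add: powr_add[symmetric] algebra_simps)
  also have "\<dots> \<le> max 1 (norm u) powr (- (1 - \<theta>) * s) * cosh t powr (- \<theta> * s)"
  proof -
    have "- (1 - \<theta>) * s \<le> 0" "- \<theta> * s \<le> 0"
      using s th by (simp_all add: mult_le_0_iff)
    then show ?thesis using n by (intro mult_mono powr_mono2') auto
  qed
  finally show ?thesis .
qed

lemma legF_bound:
  assumes s: "0 < s" and th: "0 < \<theta>" "\<theta> < 1"
  shows "\<exists>K>0. \<forall>u. 0 \<le> Re u \<longrightarrow> norm (legF s u) \<le> K * max 1 (norm u) powr (- (1 - \<theta>) * s)"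
proof -
  define K where "K = (\<integral>t. cosh t powr (- \<theta> * s) \<partial>lborel) + 1"
  have i: "integrable lborel (\<lambda>t::real. cosh t powr (- \<theta> * s))"
    using integrable_cosh_powr[of "\<theta> * s"] s th by simp
  have K: "0 < K" unfolding K_def by (intro add_nonneg_pos integral_nonneg_AE) auto
  have "norm (legF s u) \<le> K * max 1 (norm u) powr (- (1 - \<theta>) * s)" if u: "0 \<le> Re u" for u
  proof -
    let ?m = "max 1 (norm u) powr (- (1 - \<theta>) * s)"
    have "norm (legF s u) \<le> (\<integral>t. ?m * cosh t powr (- \<theta> * s) \<partial>lborel)"
      unfolding legF_def
    proof (rule Bochner_Integration.integral_norm_bound_integral)
      show "integrable lborel (\<lambda>t. (u + of_real (cosh t)) powr (- complex_of_real s))"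
        by (rule Bochner_Integration.integrable_bound[OF integrable_mult_right[OF i, of ?m]])
           (use legF_integrand_bound[OF u s th] legF_measurable[of u s] u in auto)
    qed (use i legF_integrand_bound[OF u s th] in auto)
    also have "\<dots> = ?m * (\<integral>t. cosh t powr (- \<theta> * s) \<partial>lborel)"
      by simp
    also have "\<dots> \<le> K * ?m" by (simp add: K_def mult.commute distrib_left)
    finally show ?thesis .
  qed
  then show ?thesis using K by blast
qed

lemma legF_holomorphic:
  assumes s: "0 < s"
  shows "legF s holomorphic_on {u. -1 < Re u}"
  unfolding legF_def
proof (rule holomorphic_integral)
  show "open {u. -1 < Re u}" by (rule open_halfspace_Re_gt)
  show "(\<lambda>t. (z + of_real (cosh t)) powr (- complex_of_real s)) \<in> borel_measurable lborel"
    if "z \<in> {u. -1 < Re u}" for z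
    using legF_measurable[of z s] that by simp
  show "(\<lambda>z. (z + of_real (cosh t)) powr (- complex_of_real s)) holomorphic_on {u. -1 < Re u}" for t
    by (intro holomorphic_intros) (auto intro: add_cosh_nonpos[THEN notE])
  fix z0 :: complex assume z0: "z0 \<in> {u. -1 < Re u}"
  \<comment> \<open>With this radius \<open>Re z \<ge> -1 + r\<close> on the disc, and then
    \<open>Re z + cosh t \<ge> r * cosh t\<close> because \<open>cosh t \<ge> 1\<close> and
    \<open>r \<le> 1\<close>.\<close>
  define r where "r = min 1 ((1 + Re z0) / 2)"
  have r: "0 < r" "r \<le> 1" "r \<le> (1 + Re z0) / 2"
    using z0 unfolding r_def by (simp_all only: min.cobounded1 min.cobounded2) simp
  have le: "norm ((z + of_real (cosh t)) powr (- complex_of_real s)) \<le> r powr (- s) * cosh t powr (- s)"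
    if z: "dist z z0 \<le> r" for z t
  proof -
    have "Re z0 - Re z \<le> r"
      using z abs_Re_le_cmod[of "z - z0"] by (simp add: dist_norm)
    then have "-1 + r \<le> Re z" using r by (simp add: field_simps)
    moreover have "(1 - r) * 1 \<le> (1 - r) * cosh t"
      using r cosh_real_ge_1[of t] by (intro mult_left_mono) auto
    ultimately have "r * cosh t \<le> Re z + cosh t" by (simp add: algebra_simps)
    also have "\<dots> \<le> norm (z + of_real (cosh t))"
      using complex_Re_le_cmod[of "z + of_real (cosh t)"] by simp
    finally have *: "r * cosh t \<le> norm (z + of_real (cosh t))" .
    have "norm ((z + of_real (cosh t)) powr (- complex_of_real s)) = norm (z + of_real (cosh t)) powr (- s)"
      by (simp add: norm_powr_real_powr')
    also have "\<dots> \<le> (r * cosh t) powr (- s)"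
      using * r s by (intro powr_mono2') auto
    also have "\<dots> = r powr (- s) * cosh t powr (- s)" using r by (simp add: powr_mult)
    finally show ?thesis .
  qed
  show "\<exists>r>0. \<exists>g. integrable lborel g \<and> (\<forall>z\<in>{u. -1 < Re u}. dist z z0 \<le> r \<longrightarrow>
      (\<forall>t\<in>space lborel. norm ((z + of_real (cosh t)) powr (- complex_of_real s)) \<le> g t))"
    by (rule exI[of _ r], rule conjI[OF r(1)], rule exI[of _ "\<lambda>t. r powr (- s) * cosh t powr (- s)"])
       (use le integrable_cosh_powr[OF s] in auto)
qed

lemma set_integrable_max_powr:
  fixes p K :: real
  assumes p: "1 < p"
  shows "set_integrable lborel {0<..} (\<lambda>\<rho>. K * max 1 \<rho> powr (- p))"
proof -
  have "set_integrable lborel {0<..1} (\<lambda>\<rho>. K * max 1 \<rho> powr (- p))"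
  proof -
    have "set_integrable lborel {0<..1} (\<lambda>\<rho>::real. K)"
      by (simp add: set_integrable_def)
    then show ?thesis
      by (rule set_integrable_cong[THEN iffD1, rotated -1]) (auto simp: max_def)
  qed
  moreover have "set_integrable lborel {1<..} (\<lambda>\<rho>. K * max 1 \<rho> powr (- p))"
  proof -
    have "((\<lambda>\<rho>. \<rho> powr (- p)) has_integral - (1 powr (- p + 1)) / (- p + 1)) {1..}"
      by (rule has_integral_powr_to_inf) (use p in auto)
    then have "(\<lambda>\<rho>. \<rho> powr (- p)) absolutely_integrable_on {1..}"
      by (intro nonnegative_absolutely_integrable_1) (auto simp: integrable_on_def)
    then have "set_integrable lborel {1..} (\<lambda>\<rho>::real. \<rho> powr (- p))"
      by (subst (asm) set_integrable_lebesgue_iff_lborel) (auto simp: set_borel_measurable_def)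
    then have "set_integrable lborel {1<..} (\<lambda>\<rho>::real. \<rho> powr (- p))"
      by (rule set_integrable_subset) auto
    then have "set_integrable lborel {1<..} (\<lambda>\<rho>::real. K * \<rho> powr (- p))"
      by (rule set_integrable_mult_right)
    then show ?thesis
      by (rule set_integrable_cong[THEN iffD1, rotated -1]) (auto simp: max_def)
  qed
  ultimately have "set_integrable lborel ({0<..1} \<union> {1<..}) (\<lambda>\<rho>. K * max 1 \<rho> powr (- p))"
    by (rule set_integrable_Un) auto
  moreover have "{0<..1} \<union> {1<..} = {0::real<..}" by auto
  ultimately show ?thesis by simp
qed

lemma tendsto_cis_quarter:
  fixes h :: "complex \<Rightarrow> complex"
  assumes "h holomorphic_on {u. -1 < Re u}" and "0 < \<rho>"
  shows "((\<lambda>a. h (of_real \<rho> * cis a)) \<longlongrightarrow> h (of_real \<rho>)) (at_right 0)"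
    and "((\<lambda>a. h (of_real \<rho> * cis (- a))) \<longlongrightarrow> h (of_real \<rho>)) (at_right 0)"
    and "((\<lambda>a. h (of_real \<rho> * cis a)) \<longlongrightarrow> h (\<i> * of_real \<rho>)) (at_left (pi / 2))"
    and "((\<lambda>a. h (of_real \<rho> * cis (- a))) \<longlongrightarrow> h (\<i> * of_real (- \<rho>))) (at_left (pi / 2))"
proof -
  have lim: "((\<lambda>a. h (w a)) \<longlongrightarrow> h w0) F" if "(w \<longlongrightarrow> w0) F" "-1 < Re w0" for w w0 and F :: "real filter"
  proof -
    have "continuous_on {u. -1 < Re u} h" using assms(1) by (rule holomorphic_on_imp_continuous_on)
    then have "isCont h w0"
      using that(2) open_halfspace_Re_gt[of "-1"] by (auto simp: continuous_on_eq_continuous_at)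
    then show ?thesis using that(1) isCont_tendsto_compose by blast
  qed
  have "((\<lambda>a. h (of_real \<rho> * cis a)) \<longlongrightarrow> h (of_real \<rho> * cis 0)) (at_right 0)"
       "((\<lambda>a. h (of_real \<rho> * cis (- a))) \<longlongrightarrow> h (of_real \<rho> * cis (- 0))) (at_right 0)"
       "((\<lambda>a. h (of_real \<rho> * cis a)) \<longlongrightarrow> h (of_real \<rho> * cis (pi/2))) (at_left (pi / 2))"
       "((\<lambda>a. h (of_real \<rho> * cis (- a))) \<longlongrightarrow> h (of_real \<rho> * cis (- (pi/2)))) (at_left (pi / 2))"
    by (intro lim tendsto_intros tendsto_cis; use assms(2) in simp)+
  then show "((\<lambda>a. h (of_real \<rho> * cis a)) \<longlongrightarrow> h (of_real \<rho>)) (at_right 0)"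
    and "((\<lambda>a. h (of_real \<rho> * cis (- a))) \<longlongrightarrow> h (of_real \<rho>)) (at_right 0)"
    and "((\<lambda>a. h (of_real \<rho> * cis a)) \<longlongrightarrow> h (\<i> * of_real \<rho>)) (at_left (pi / 2))"
    and "((\<lambda>a. h (of_real \<rho> * cis (- a))) \<longlongrightarrow> h (\<i> * of_real (- \<rho>))) (at_left (pi / 2))"
    by (simp_all add: mult.commute cis_cnj[symmetric])
qed

lemma legF_triple_integral_eq_0:
  assumes s: "0 < s" "s < 1"
  shows "integrable lborel (\<lambda>y. legF s (\<i> * of_real y) ^ 2 * legF (1 - s) (\<i> * of_real y))"
    and "(\<integral>y. legF s (\<i> * of_real y) ^ 2 * legF (1 - s) (\<i> * of_real y) \<partial>lborel) = 0"
proof -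
  define h where "h u = legF s u ^ 2 * legF (1 - s) u" for u
  \<comment> \<open>The total decay is \<open>(1 - \<theta>) * (s + 1)\<close>, which exceeds 1
    exactly when \<open>\<theta> * (s + 1) < s\<close>; as \<open>s + 1 < 2\<close>, a quarter of
    \<open>s\<close> is small enough.\<close>
  define \<theta> where "\<theta> = s / 4"
  have th: "0 < \<theta>" "\<theta> < 1" using s by (auto simp: \<theta>_def)
  have s': "0 < 1 - s" using s by simp
  define p where "p = (1 - \<theta>) * (s + 1)"
  have "\<theta> * (s + 1) < s"
    using s by (simp add: \<theta>_def) 
  then have p: "1 < p" by (simp add: p_def algebra_simps)
  obtain K1 where K1: "K1 > 0" "\<And>u. 0 \<le> Re u \<Longrightarrow> norm (legF s u) \<le> K1 * max 1 (norm u) powr (- (1 - \<theta>) * s)"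
    using legF_bound[OF s(1) th] by blast
  obtain K2 where K2: "K2 > 0" "\<And>u. 0 \<le> Re u \<Longrightarrow> norm (legF (1 - s) u) \<le> K2 * max 1 (norm u) powr (- (1 - \<theta>) * (1 - s))"
    using legF_bound[OF s' th] by blast
  have holU: "h holomorphic_on {u. -1 < Re u}"
    unfolding h_def by (intro holomorphic_intros legF_holomorphic s s')
  have bd: "norm (h u) \<le> K1\<^sup>2 * K2 * max 1 (norm u) powr (- p)" if u: "0 \<le> Re u" for u
  proof -
    have "norm (h u) \<le> (K1 * max 1 (norm u) powr (- (1 - \<theta>) * s)) ^ 2 * (K2 * max 1 (norm u) powr (- (1 - \<theta>) * (1 - s)))"
      unfolding h_def norm_mult norm_power using K1(1) K2(1)
      by (intro mult_mono power_mono K1(2) K2(2) u) auto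
    also have "\<dots> = K1\<^sup>2 * K2 * (max 1 (norm u) powr (- (1 - \<theta>) * s) * max 1 (norm u) powr (- (1 - \<theta>) * s) * max 1 (norm u) powr (- (1 - \<theta>) * (1 - s)))"
      by (simp add: power2_eq_square)
    also have "max 1 (norm u) powr (- (1 - \<theta>) * s) * max 1 (norm u) powr (- (1 - \<theta>) * s) * max 1 (norm u) powr (- (1 - \<theta>) * (1 - s)) = max 1 (norm u) powr (- p)"
      unfolding powr_add[symmetric] by (simp add: p_def algebra_simps)
    finally show ?thesis .
  qed
  have cont: "continuous_on UNIV (\<lambda>y. h (w * of_real y))" if "w = \<i>" for w
    by (rule continuous_on_compose2[OF holomorphic_on_imp_continuous_on[OF holU]])
       (use that in \<open>auto intro!: continuous_intros\<close>)
  have mh: "(\<lambda>y. h (\<i> * of_real y)) \<in> borel_measurable borel"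
    by (rule borel_measurable_continuous_onI) (rule cont, simp)
  \<comment> \<open>\<open>h\<close> is holomorphic across the positive axis, so \<open>fp\<close>
    is the limit from both sides and the jump is zero.\<close>
  define fp where "fp \<rho> = indicator {0<..} \<rho> *\<^sub>R h (of_real \<rho>)" for \<rho> :: real
  have mM: "(\<lambda>\<rho>. K1\<^sup>2 * K2 * max 1 \<rho> powr - p) \<in> borel_measurable borel"
    by measurable
  have mf: "fp \<in> borel_measurable borel"
    unfolding fp_def
    by (rule borel_measurable_continuous_on_indicator)
       (auto intro!: continuous_on_compose2[OF holomorphic_on_imp_continuous_on[OF holU]] continuous_intros)
  have hol: "h holomorphic_on {w. 0 < Re w \<and> Im w \<noteq> 0}"
    by (rule holomorphic_on_subset[OF holU]) auto
  have bd': "norm (h (of_real \<rho> * cis a)) \<le> K1\<^sup>2 * K2 * max 1 \<rho> powr - p" if "0 < \<rho>" "\<bar>a\<bar> < pi / 2" for \<rho> a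
  proof -
    have "0 < cos a" using that by (intro cos_gt_zero_pi) linarith+
    then show ?thesis using bd[of "of_real \<rho> * cis a"] that by (simp add: norm_mult)
  qed
  have lim0: "((\<lambda>a. h (of_real \<rho> * cis a)) \<longlongrightarrow> fp \<rho>) (at_right 0)"
    and lim1: "((\<lambda>a. h (of_real \<rho> * cis (- a))) \<longlongrightarrow> fp \<rho>) (at_right 0)" if "0 < \<rho>" for \<rho>
    using tendsto_cis_quarter(1,2)[OF holU that] that by (simp_all add: fp_def)
  \<comment> \<open>Radius 0 is outside the range \<open>0 < \<rho>\<close>, so with this
    \<open>c\<close> no radius is exceptional.\<close>
  note * = half_plane_contour[where c = 0, OF hol set_integrable_max_powr[OF p] bd' lim0 lim1
     tendsto_cis_quarter(3)[OF holU] tendsto_cis_quarter(4)[OF holU]]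
  have "integrable lborel (\<lambda>y. h (\<i> * of_real y))"
    by (rule *(1)[OF _ _ _ _ _ _ mM mf mf mh])
  moreover have "\<i> * (\<integral>y. h (\<i> * of_real y) \<partial>lborel) = (LINT \<rho>:{0<..}|lborel. fp \<rho> - fp \<rho>)"
    by (rule *(2)[OF _ _ _ _ _ _ mM mf mf mh])
  ultimately show "integrable lborel (\<lambda>y. legF s (\<i> * of_real y) ^ 2 * legF (1 - s) (\<i> * of_real y))"
    and "(\<integral>y. legF s (\<i> * of_real y) ^ 2 * legF (1 - s) (\<i> * of_real y) \<partial>lborel) = 0"
    unfolding h_def by (auto simp: set_lebesgue_integral_def)
qed

section \<open>The ratio identity\<close>

lemma one_minus_square_pos:
  fixes x :: real
  assumes "x \<in> {-1<..<1}"
  shows "0 < 1 - x\<^sup>2"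
proof -
  have "\<bar>x\<bar> < 1" using assms by auto
  then show ?thesis by (simp add: abs_square_less_1)
qed

text \<open>With \<open>x = 2 * t - 1\<close> the base is \<open>t * (1 - t)\<close>, and the
  integrand becomes that of a beta integral.\<close>

lemma set_integrable_quarter_powr:
  fixes a :: real
  assumes a: "0 < a"
  shows "set_integrable lborel {-1<..<1} (\<lambda>x. ((1 - x\<^sup>2) / 4) powr (a - 1))"
proof -
  define g where "g t = 2 * t - 1" for t :: real
  have img: "g ` {0<..<1} = {-1<..<1}"
  proof (intro set_eqI iffI)
    fix x :: real assume "x \<in> {-1<..<1}"
    then have "g ((x + 1) / 2) = x" "(x + 1) / 2 \<in> {0<..<1}" by (auto simp: g_def field_simps)
    then show "x \<in> g ` {0<..<1}" by (metis imageI)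
  qed (auto simp: g_def)
  have "(\<integral>\<^sup>+t\<in>{0<..<1}. ennreal (t powr (a - 1) * (1 - t) powr (a - 1)) \<partial>lborel) < \<infinity>"
    using a by (simp add: nn_integral_Beta)
  then have "set_integrable lborel {0<..<1} (\<lambda>t. t powr (a - 1) * (1 - t) powr (a - 1))"
    by (subst (asm) nn_integral_eq_set_integral) (auto split: if_splits)
  then have "set_integrable lborel {0<..<1} (\<lambda>t. 2 * (t powr (a - 1) * (1 - t) powr (a - 1)))"
    by (rule set_integrable_mult_right)
  then have *: "set_integrable lborel {0<..<1} (\<lambda>t. \<bar>2\<bar> *\<^sub>R ((1 - (g t)\<^sup>2) / 4) powr (a - 1))"
  proof (rule set_integrable_cong[THEN iffD1, rotated -1])
    fix t :: real assume t: "t \<in> {0<..<1}"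
    have "(1 - (g t)\<^sup>2) / 4 = t * (1 - t)" by (simp add: g_def power2_eq_square field_simps)
    then show "2 * (t powr (a - 1) * (1 - t) powr (a - 1)) = \<bar>2\<bar> *\<^sub>R ((1 - (g t)\<^sup>2) / 4) powr (a - 1)"
      using t by (simp add: powr_mult)
  qed simp_all
  have "set_integrable lborel (g ` {0<..<1}) (\<lambda>x. ((1 - x\<^sup>2) / 4) powr (a - 1))"
    using * by (subst set_integrable_change_of_variables(1)[where h = "\<lambda>_. 2"])
      (auto simp: img inj_on_def, auto simp: g_def[abs_def] intro!: derivative_eq_intros)
  then show ?thesis unfolding img .
qed

abbreviation legendre_cubed :: "complex \<Rightarrow> real \<Rightarrow> complex" where
  "legendre_cubed \<nu> x \<equiv> legendre_P \<nu> x ^ 3 / complex_of_real (1 - x\<^sup>2) powr ((1 - \<nu>) / 2)"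

abbreviation legendre_mixed :: "complex \<Rightarrow> real \<Rightarrow> complex" where
  "legendre_mixed \<nu> x \<equiv> legendre_P \<nu> x ^ 2 * legendre_P \<nu> (- x) / complex_of_real (1 - x\<^sup>2) powr ((1 - \<nu>) / 2)"

lemma legendre_triple_dominated:
  assumes nu0: "-1 < Re \<nu>0"
  shows "\<exists>r>0. \<exists>g. set_integrable lborel {-1<..<1} g \<and> (\<forall>\<nu> x. dist \<nu> \<nu>0 \<le> r \<longrightarrow> x \<in> {-1<..<1} \<longrightarrow>
     norm (legendre_cubed \<nu> x) \<le> g x \<and>
     norm (legendre_mixed \<nu> x) \<le> g x)"
proof -
  \<comment> \<open>At most half the distance from \<open>Re \<nu>0\<close> to -1, so that
    \<open>Re \<nu> \<ge> \<eta> - 1\<close> throughout the disc of radius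
    \<open>\<eta>\<close>.\<close>
  define \<eta> where "\<eta> = min 1 ((1 + Re \<nu>0) / 2)"
  have "0 < \<eta>" "\<eta> \<le> 1" "\<eta> \<le> (1 + Re \<nu>0) / 2"
    using nu0 unfolding \<eta>_def by (simp_all only: min.cobounded1 min.cobounded2) simp
  note eta = this
  \<comment> \<open>Exponent budget at the endpoints: the weight contributes at worst the power
    \<open>\<eta> / 2 - 1\<close>, and three Legendre factors cost
    \<open>3 * \<delta> = \<eta> / 4\<close>; what remains, \<open>\<eta> / 4 - 1\<close>, is still
    above -1.\<close>
  define \<delta> where "\<delta> = \<eta> / 12"
  have d: "0 < \<delta>" "\<delta> \<le> 1" using eta by (auto simp: \<delta>_def)
  define M where "M = (norm \<nu>0 + \<eta>) * (norm \<nu>0 + \<eta> + 1)"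
  have M: "0 \<le> M" using eta by (simp add: M_def)
  obtain C where C: "C > 0" "\<And>\<nu> x. norm (\<nu> * (\<nu> + 1)) \<le> M \<Longrightarrow> -1 < x \<Longrightarrow> x \<le> 1 \<Longrightarrow>
      norm (legendre_P \<nu> x) \<le> C * ((1 + x) / 2) powr (- \<delta>)"
    using legendre_P_bound[OF M d] by blast
  define g where "g x = C ^ 3 * ((1 - x\<^sup>2) / 4) powr (\<eta> / 4 - 1)" for x :: real
  have "set_integrable lborel {-1<..<1} g"
    unfolding g_def using eta by (intro set_integrable_mult_right set_integrable_quarter_powr) auto
  moreover have "norm (legendre_cubed \<nu> x) \<le> g x \<and>
     norm (legendre_mixed \<nu> x) \<le> g x"
    if nu: "dist \<nu> \<nu>0 \<le> \<eta>" and x: "x \<in> {-1<..<1}" for \<nu> x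
  proof -
    have n1: "norm \<nu> \<le> norm \<nu>0 + \<eta>"
      using nu norm_triangle_ineq2[of \<nu> \<nu>0] by (simp add: dist_norm)
    have "norm (\<nu> + 1) \<le> norm \<nu>0 + \<eta> + 1"
      using n1 norm_triangle_ineq[of \<nu> 1] by simp
    then have nuM: "norm (\<nu> * (\<nu> + 1)) \<le> M"
      unfolding M_def norm_mult using n1 eta by (intro mult_mono) auto
    have "Re \<nu>0 - Re \<nu> \<le> \<eta>"
      using nu abs_Re_le_cmod[of "\<nu> - \<nu>0"] by (simp add: dist_norm)
    then have Re: "\<eta> - 1 \<le> Re \<nu>" using eta by (simp add: field_simps)
    \<comment> \<open>\<open>q\<close> is the product of \<open>(1 + x) / 2\<close> and
      \<open>(1 - x) / 2\<close>, both below 1, hence a lower bound for each. One power of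
      \<open>q\<close> thus controls the Legendre functions at \<open>x\<close> and at
      \<open>- x\<close>.\<close>
    define q where "q = (1 - x\<^sup>2) / 4"
    have x2: "x\<^sup>2 < 1" using one_minus_square_pos[OF x] by simp
    have q: "0 < q" using x2 by (simp add: q_def)
    have qle: "q \<le> (1 + x) / 2" "q \<le> (1 - x) / 2"
    proof -
      have e: "q = ((1 + x) / 2) * ((1 - x) / 2)" by (simp add: q_def power2_eq_square algebra_simps)
      show "q \<le> (1 + x) / 2" "q \<le> (1 - x) / 2"
        using x mult_left_le[of "(1 - x) / 2" "(1 + x) / 2"] mult_left_le_one_le[of "(1 - x) / 2" "(1 + x) / 2"]
        by (auto simp: e)
    qed
    have P1: "norm (legendre_P \<nu> x) \<le> C * q powr (- \<delta>)"
      using C(2)[OF nuM, of x] x C(1) qle(1) q d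
      by (auto elim!: order.trans intro!: mult_left_mono powr_mono2')
    have P2: "norm (legendre_P \<nu> (- x)) \<le> C * q powr (- \<delta>)"
      using C(2)[OF nuM, of "- x"] x C(1) qle(2) q d
      by (auto elim!: order.trans intro!: mult_left_mono powr_mono2')
    have w: "norm (1 / complex_of_real (1 - x\<^sup>2) powr ((1 - \<nu>) / 2)) \<le> q powr (\<eta> / 2 - 1)"
    proof -
      have "norm (1 / complex_of_real (1 - x\<^sup>2) powr ((1 - \<nu>) / 2)) = norm (complex_of_real (1 - x\<^sup>2) powr (- ((1 - \<nu>) / 2)))"
        unfolding powr_minus by (simp add: norm_inverse norm_divide inverse_eq_divide)
      also have "\<dots> = (1 - x\<^sup>2) powr ((Re \<nu> - 1) / 2)"
      proof -
        have "Re (- ((1 - \<nu>) / 2)) = (Re \<nu> - 1) / 2" by (simp add: field_simps)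
        then show ?thesis using x2 by (subst norm_powr_real_powr) (auto simp only: Re_complex_of_real Reals_of_real)
      qed
      also have "\<dots> \<le> (1 - x\<^sup>2) powr (\<eta> / 2 - 1)"
        using x2 Re by (intro powr_mono') (auto simp: field_simps)
      also have "\<dots> \<le> q powr (\<eta> / 2 - 1)"
        using q x2 eta by (intro powr_mono2') (auto simp: q_def)
      finally show ?thesis .
    qed
    have gx: "g x = (C * q powr (- \<delta>)) ^ 3 * q powr (\<eta> / 2 - 1)"
    proof -
      have "(q powr (- \<delta>)) ^ 3 = q powr (- \<delta> * 3)"
        using q by (simp add: powr_powr flip: powr_realpow[of "q powr (- \<delta>)" 3, simplified])
      then have "(q powr (- \<delta>)) ^ 3 * q powr (\<eta> / 2 - 1) = q powr (\<eta> / 4 - 1)"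
        by (simp add: powr_add[symmetric] \<delta>_def)
      then show ?thesis by (simp add: g_def q_def power_mult_distrib mult.assoc)
    qed
    have cq: "0 \<le> C * q powr (- \<delta>)" using C(1) by simp
    have "norm (legendre_P \<nu> x ^ 3 * (1 / complex_of_real (1 - x\<^sup>2) powr ((1 - \<nu>) / 2))) \<le> g x"
      unfolding norm_mult norm_power gx by (intro mult_mono power_mono P1 w) (use cq in auto)
    moreover have "norm (legendre_P \<nu> x ^ 2 * legendre_P \<nu> (- x) * (1 / complex_of_real (1 - x\<^sup>2) powr ((1 - \<nu>) / 2))) \<le> g x"
    proof -
      have "norm (legendre_P \<nu> x ^ 2 * legendre_P \<nu> (- x)) \<le> (C * q powr (- \<delta>)) ^ 2 * (C * q powr (- \<delta>))"
        unfolding norm_mult norm_power by (intro mult_mono power_mono P1 P2) (use cq in auto)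
      then have "norm (legendre_P \<nu> x ^ 2 * legendre_P \<nu> (- x)) \<le> (C * q powr (- \<delta>)) ^ 3"
        by (simp add: power2_eq_square power3_eq_cube)
      then show ?thesis
        unfolding norm_mult[of "_ * _"] gx by (intro mult_mono w) (use cq in auto)
    qed
    ultimately show ?thesis by simp
  qed
  ultimately show ?thesis using eta(1) by blast
qed

definition legI3 :: "complex \<Rightarrow> complex" where
  "legI3 \<nu> = (LBINT x:{-1<..<1}. legendre_cubed \<nu> x)"

definition legI21 :: "complex \<Rightarrow> complex" where
  "legI21 \<nu> = (LBINT x:{-1<..<1}. legendre_mixed \<nu> x)"

lemma legendre_weight_measurable:
  "set_borel_measurable borel {-1<..<1} (\<lambda>x. 1 / complex_of_real (1 - x\<^sup>2) powr a)"
  unfolding set_borel_measurable_def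
proof (rule borel_measurable_continuous_on_indicator)
  have pos: "complex_of_real (1 - x\<^sup>2) \<notin> \<real>\<^sub>\<le>\<^sub>0" if "x \<in> {-1<..<1}" for x :: real
    using one_minus_square_pos[OF that] unfolding complex_nonpos_Reals_iff by simp
  then have ne: "complex_of_real (1 - x\<^sup>2) powr a \<noteq> 0" if "x \<in> {-1<..<1}" for x :: real
    using that unfolding powr_eq_0_iff by (metis zero_complex.simps nonpos_Reals_zero_I)
  have "continuous_on {-1<..<1} (\<lambda>x. complex_of_real (1 - x\<^sup>2) powr a)"
  proof (rule continuous_on_compose2[where g = "\<lambda>z. z powr a" and t = "- \<real>\<^sub>\<le>\<^sub>0"])
    show "continuous_on (- \<real>\<^sub>\<le>\<^sub>0) (\<lambda>z. z powr a)"
      by (intro holomorphic_on_imp_continuous_on holomorphic_intros) auto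
    show "continuous_on {-1<..<1} (\<lambda>x. complex_of_real (1 - x\<^sup>2))"
      by (intro continuous_intros)
  qed (use pos in blast)
  then show "continuous_on {-1<..<1} (\<lambda>x. 1 / complex_of_real (1 - x\<^sup>2) powr a)"
    by (intro continuous_on_divide continuous_on_const ballI ne)
qed simp

lemma legendre_triple_measurable:
  "set_borel_measurable borel {-1<..<1} (\<lambda>x. legendre_P \<nu> x ^ 3 / complex_of_real (1 - x\<^sup>2) powr a)"
  "set_borel_measurable borel {-1<..<1} (\<lambda>x. legendre_P \<nu> x ^ 2 * legendre_P \<nu> (- x) / complex_of_real (1 - x\<^sup>2) powr a)"
proof -
  note [measurable] = legendre_weight_measurable[unfolded set_borel_measurable_def]
  have "(\<lambda>x. legendre_P \<nu> x ^ 3 * (indicator {-1<..<1} x *\<^sub>R (1 / complex_of_real (1 - x\<^sup>2) powr a))) \<in> borel_measurable borel"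
    "(\<lambda>x. legendre_P \<nu> x ^ 2 * legendre_P \<nu> (- x) * (indicator {-1<..<1} x *\<^sub>R (1 / complex_of_real (1 - x\<^sup>2) powr a))) \<in> borel_measurable borel"
    by measurable
  then show "set_borel_measurable borel {-1<..<1} (\<lambda>x. legendre_P \<nu> x ^ 3 / complex_of_real (1 - x\<^sup>2) powr a)"
    "set_borel_measurable borel {-1<..<1} (\<lambda>x. legendre_P \<nu> x ^ 2 * legendre_P \<nu> (- x) / complex_of_real (1 - x\<^sup>2) powr a)"
    unfolding set_borel_measurable_def by simp_all
qed

lemma legendre_triple_integrable:
  assumes nu: "-1 < Re \<nu>"
  shows "set_integrable lborel {-1<..<1} (\<lambda>x. legendre_cubed \<nu> x)"
    and "set_integrable lborel {-1<..<1} (\<lambda>x. legendre_mixed \<nu> x)"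
proof -
  obtain r g where r: "0 < r" and g: "set_integrable lborel {-1<..<1} g"
    and le: "\<And>\<nu>' x. dist \<nu>' \<nu> \<le> r \<Longrightarrow> x \<in> {-1<..<1} \<Longrightarrow>
     norm (legendre_cubed \<nu>' x) \<le> g x \<and>
     norm (legendre_mixed \<nu>' x) \<le> g x"
    using legendre_triple_dominated[OF nu] by blast
  have le': "norm (legendre_cubed \<nu> x) \<le> norm (g x)"
     "norm (legendre_mixed \<nu> x) \<le> norm (g x)"
    if "x \<in> {-1<..<1}" for x
    using le[of \<nu> x] that r by (auto intro: order.trans[OF _ abs_ge_self])
  show "set_integrable lborel {-1<..<1} (\<lambda>x. legendre_cubed \<nu> x)"
    by (rule set_integrable_bound[OF g])
       (use le' legendre_triple_measurable in \<open>auto simp: set_borel_measurable_def\<close>)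
  show "set_integrable lborel {-1<..<1} (\<lambda>x. legendre_mixed \<nu> x)"
    by (rule set_integrable_bound[OF g])
       (use le' legendre_triple_measurable in \<open>auto simp: set_borel_measurable_def\<close>)
qed

lemma legI_holomorphic:
  "legI3 holomorphic_on {\<nu>. -1 < Re \<nu>}" "legI21 holomorphic_on {\<nu>. -1 < Re \<nu>}"
proof -
  have hol: "(\<lambda>\<nu>. indicator {-1<..<1} x *\<^sub>R (q \<nu> / complex_of_real (1 - x\<^sup>2) powr ((1 - \<nu>) / 2))) holomorphic_on {\<nu>. -1 < Re \<nu>}"
    if "x \<in> {-1<..<1} \<Longrightarrow> q holomorphic_on UNIV" for x :: real and q
  proof (cases "x \<in> {-1<..<1}")
    case True
    then have "1 - x\<^sup>2 \<noteq> 0" by (auto simp: power2_eq_1_iff)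
    then have "complex_of_real (1 - x\<^sup>2) \<noteq> 0" by (simp only: of_real_eq_0_iff not_False_eq_True)
    then show ?thesis
      using True holomorphic_on_subset[OF that[OF True]] by (auto intro!: holomorphic_intros)
  qed simp
  have h3: "(\<lambda>\<nu>. indicator {-1<..<1} x *\<^sub>R (legendre_cubed \<nu> x)) holomorphic_on {\<nu>. -1 < Re \<nu>}" for x
    by (rule hol) (auto intro!: holomorphic_intros holomorphic_legendre_P)
  have h21: "(\<lambda>\<nu>. indicator {-1<..<1} x *\<^sub>R (legendre_mixed \<nu> x)) holomorphic_on {\<nu>. -1 < Re \<nu>}" for x
    by (rule hol) (auto intro!: holomorphic_intros holomorphic_legendre_P)
  have dom: "\<exists>r>0. \<exists>g. integrable lborel g \<and> (\<forall>\<nu>\<in>{\<nu>. -1 < Re \<nu>}. dist \<nu> \<nu>0 \<le> r \<longrightarrow> (\<forall>x\<in>space lborel.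
       norm (indicator {-1<..<1} x *\<^sub>R (legendre_cubed \<nu> x)) \<le> g x \<and>
       norm (indicator {-1<..<1} x *\<^sub>R (legendre_mixed \<nu> x)) \<le> g x))"
    if "\<nu>0 \<in> {\<nu>. -1 < Re \<nu>}" for \<nu>0
  proof -
    have "-1 < Re \<nu>0" using that by simp
    then obtain r g where r: "0 < r" and g: "set_integrable lborel {-1<..<1} g"
      and le: "\<forall>\<nu>' x. dist \<nu>' \<nu>0 \<le> r \<longrightarrow> x \<in> {-1<..<1} \<longrightarrow>
       norm (legendre_cubed \<nu>' x) \<le> g x \<and>
       norm (legendre_mixed \<nu>' x) \<le> g x"
      using legendre_triple_dominated[of \<nu>0] by blast
    show ?thesis
      by (rule exI[of _ r], rule conjI[OF r], rule exI[of _ "\<lambda>x. indicator {-1<..<1} x *\<^sub>R g x"])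
         (use le g in \<open>auto simp: set_integrable_def indicator_def\<close>)
  qed
  show "legI3 holomorphic_on {\<nu>. -1 < Re \<nu>}"
    unfolding legI3_def[abs_def] set_lebesgue_integral_def
  proof (rule holomorphic_integral[OF open_halfspace_Re_gt _ h3])
    show "(\<lambda>x. indicator {-1<..<1} x *\<^sub>R (legendre_cubed z x)) \<in> borel_measurable lborel" for z
      using legendre_triple_measurable(1)[of z "(1 - z) / 2"] by (simp add: set_borel_measurable_def)
  qed (use dom in meson)
  show "legI21 holomorphic_on {\<nu>. -1 < Re \<nu>}"
    unfolding legI21_def[abs_def] set_lebesgue_integral_def
  proof (rule holomorphic_integral[OF open_halfspace_Re_gt _ h21])
    show "(\<lambda>x. indicator {-1<..<1} x *\<^sub>R (legendre_mixed z x)) \<in> borel_measurable lborel" for z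
      using legendre_triple_measurable(2)[of z "(1 - z) / 2"] by (simp add: set_borel_measurable_def)
  qed (use dom in meson)
qed

text \<open>Links the argument of the Legendre functions to the ordinate on the imaginary axis: by
  \<open>legR_eq\<close> the boundary values at \<open>\<i> * y\<close> involve the Legendre
  function at \<open>y / sqrt (1 + y\<^sup>2)\<close>.\<close>

lemma unit_interval_substitution:
  fixes G :: "real \<Rightarrow> real"
  assumes [measurable]: "G \<in> borel_measurable borel"
  shows "set_integrable lborel {-1<..<1} G \<longleftrightarrow> integrable lborel (\<lambda>y. (1 + y\<^sup>2) powr (- 3 / 2) * G (y / sqrt (1 + y\<^sup>2)))"
    and "(LBINT x:{-1<..<1}. G x) = (LBINT y. (1 + y\<^sup>2) powr (- 3 / 2) * G (y / sqrt (1 + y\<^sup>2)))"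
proof -
  define g where "g y = y / sqrt (1 + y\<^sup>2)" for y :: real
  have img: "g ` UNIV = {-1<..<1}"
  proof (intro set_eqI iffI)
    fix x :: real assume x: "x \<in> {-1<..<1}"
    then have x2: "0 < 1 - x\<^sup>2" by (rule one_minus_square_pos)
    have "1 + (x / sqrt (1 - x\<^sup>2))\<^sup>2 = 1 / (1 - x\<^sup>2)"
      using x2 by (simp add: power_divide field_simps)
    then have "g (x / sqrt (1 - x\<^sup>2)) = x"
      using x2 by (simp add: g_def real_sqrt_divide)
    then show "x \<in> g ` UNIV" by (metis rangeI)
  qed (use div_sqrt_one_plus_square_bounds in \<open>auto simp: g_def\<close>)
  have pos: "0 < 1 + y\<^sup>2" for y :: real by (simp add: add_pos_nonneg)
  have der: "(g has_real_derivative (1 + y\<^sup>2) powr (- 3 / 2)) (at y)" for y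
  proof -
    define w where "w = sqrt (1 + y\<^sup>2)"
    have w: "0 < w" "w\<^sup>2 = 1 + y\<^sup>2" using pos[of y] by (auto simp: w_def)
    have "(g has_real_derivative (w - y * (y / w)) / (w * w)) (at y)"
      unfolding g_def using w pos[of y]
      by (auto intro!: derivative_eq_intros simp: w_def field_simps)
    also have "(w - y * (y / w)) / (w * w) = 1 / w ^ 3"
      using w by (simp add: field_simps power2_eq_square power3_eq_cube) 
    also have "\<dots> = (1 + y\<^sup>2) powr (- 3 / 2)"
    proof -
      have "w ^ 3 = w powr 3" using w by simp
      also have "\<dots> = (1 + y\<^sup>2) powr (3 / 2)"
        unfolding w_def using pos[of y] by (simp add: powr_half_sqrt[symmetric] powr_powr)
      finally show ?thesis by (simp add: powr_minus_divide)
    qed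
    finally show ?thesis .
  qed
  have inj: "inj g"
  proof (rule strict_mono_on_imp_inj_on[where A = UNIV, simplified])
    show "strict_mono g"
    proof (rule strict_monoI)
      have "0 < (1 + y\<^sup>2) powr (- 3 / 2)" for y :: real
        using pos[of y] by (simp only: powr_gt_zero)
      then show "g x < g y" if "x < y" for x y
        using der by (intro DERIV_pos_imp_increasing[OF that]) blast
    qed
  qed
  have [measurable]: "g \<in> borel_measurable borel" unfolding g_def by measurable
  have "set_integrable lborel (g ` UNIV) G \<longleftrightarrow> set_integrable lborel UNIV (\<lambda>y. \<bar>(1 + y\<^sup>2) powr (- 3 / 2)\<bar> *\<^sub>R G (g y))"
    "(LINT x:g ` UNIV|lborel. G x) = (LINT y:UNIV|lborel. \<bar>(1 + y\<^sup>2) powr (- 3 / 2)\<bar> *\<^sub>R G (g y))"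
    by (rule set_integrable_change_of_variables[OF _ _ der inj]; simp add: img)+
  then show "set_integrable lborel {-1<..<1} G \<longleftrightarrow> integrable lborel (\<lambda>y. (1 + y\<^sup>2) powr (- 3 / 2) * G (y / sqrt (1 + y\<^sup>2)))"
    "(LBINT x:{-1<..<1}. G x) = (LBINT y. (1 + y\<^sup>2) powr (- 3 / 2) * G (y / sqrt (1 + y\<^sup>2)))"
    unfolding img g_def by (simp_all add: set_integrable_def set_lebesgue_integral_def)
qed

lemma legendre_triple_real:
  assumes x: "x \<in> {-1<..<1}"
  shows "legendre_P (of_real (s - 1)) x ^ 3 / complex_of_real (1 - x\<^sup>2) powr ((1 - of_real (s - 1)) / 2)
      = of_real (legendre_real s x ^ 3 * (1 - x\<^sup>2) powr (s / 2 - 1))"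
    and "legendre_P (of_real (s - 1)) x ^ 2 * legendre_P (of_real (s - 1)) (- x) / complex_of_real (1 - x\<^sup>2) powr ((1 - of_real (s - 1)) / 2)
      = of_real (legendre_real s x ^ 2 * legendre_real s (- x) * (1 - x\<^sup>2) powr (s / 2 - 1))"
proof -
  have x2: "0 < 1 - x\<^sup>2" using one_minus_square_pos[OF x] by simp
  have "complex_of_real (1 - x\<^sup>2) powr ((1 - of_real (s - 1)) / 2) = complex_of_real (1 - x\<^sup>2) powr of_real (1 - s / 2)"
    by (simp add: field_simps)
  also have "\<dots> = of_real ((1 - x\<^sup>2) powr (1 - s / 2))"
    using x2 by (simp only: powr_of_real less_imp_le)
  also have "(1 - x\<^sup>2) powr (1 - s / 2) = 1 / (1 - x\<^sup>2) powr (s / 2 - 1)"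
    using powr_minus_divide[of "1 - x\<^sup>2" "s / 2 - 1"] by simp
  finally have w: "complex_of_real (1 - x\<^sup>2) powr ((1 - of_real (s - 1)) / 2) = of_real (1 / (1 - x\<^sup>2) powr (s / 2 - 1))" .
  have p: "legendre_P (of_real (s - 1)) x = of_real (legendre_real s x)"
    "legendre_P (of_real (s - 1)) (- x) = of_real (legendre_real s (- x))"
    by (rule legendre_real_sums(2); use x in simp)+
  show "legendre_P (of_real (s - 1)) x ^ 3 / complex_of_real (1 - x\<^sup>2) powr ((1 - of_real (s - 1)) / 2)
      = of_real (legendre_real s x ^ 3 * (1 - x\<^sup>2) powr (s / 2 - 1))"
    "legendre_P (of_real (s - 1)) x ^ 2 * legendre_P (of_real (s - 1)) (- x) / complex_of_real (1 - x\<^sup>2) powr ((1 - of_real (s - 1)) / 2)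
      = of_real (legendre_real s x ^ 2 * legendre_real s (- x) * (1 - x\<^sup>2) powr (s / 2 - 1))"
    unfolding w p by simp_all
qed

text \<open>The exponent \<open>s / 2 - 1\<close> is \<open>(\<nu> - 1) / 2\<close> for the degree
  \<nu> = s - 1.\<close>

definition legJ3 :: "real \<Rightarrow> real" where
  "legJ3 s = (LBINT x:{-1<..<1}. legendre_real s x ^ 3 * (1 - x\<^sup>2) powr (s / 2 - 1))"

definition legJ21 :: "real \<Rightarrow> real" where
  "legJ21 s = (LBINT x:{-1<..<1}. legendre_real s x ^ 2 * legendre_real s (- x) * (1 - x\<^sup>2) powr (s / 2 - 1))"

lemma set_integrable_of_real_iff:
  "set_integrable M A (\<lambda>x. complex_of_real (f x)) \<longleftrightarrow> set_integrable M A f"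
  unfolding set_integrable_def complex_of_real_integrable_eq[symmetric] by (simp add: scaleR_conv_of_real)

lemma set_integral_of_real:
  "(LINT x:A|M. complex_of_real (f x)) = of_real (LINT x:A|M. f x)"
  unfolding set_lebesgue_integral_def by (simp add: scaleR_conv_of_real flip: of_real_mult)

lemma legI_of_real:
  shows "legI3 (of_real (s - 1)) = of_real (legJ3 s)" "legI21 (of_real (s - 1)) = of_real (legJ21 s)"
  unfolding legI3_def legI21_def legJ3_def legJ21_def set_integral_of_real[symmetric]
  by (rule set_lebesgue_integral_cong; use legendre_triple_real in force)+

lemma legJ_integrable:
  assumes s: "0 < s"
  shows "set_integrable lborel {-1<..<1} (\<lambda>x. legendre_real s x ^ 3 * (1 - x\<^sup>2) powr (s / 2 - 1))"
    and "set_integrable lborel {-1<..<1} (\<lambda>x. legendre_real s x ^ 2 * legendre_real s (- x) * (1 - x\<^sup>2) powr (s / 2 - 1))"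
proof -
  have "-1 < Re (of_real (s - 1))" using s by simp
  note * = legendre_triple_integrable[OF this]
  show "set_integrable lborel {-1<..<1} (\<lambda>x. legendre_real s x ^ 3 * (1 - x\<^sup>2) powr (s / 2 - 1))"
    using *(1) unfolding set_integrable_of_real_iff[symmetric]
    by (rule set_integrable_cong[THEN iffD1, rotated -1]) (use legendre_triple_real in force)+
  show "set_integrable lborel {-1<..<1} (\<lambda>x. legendre_real s x ^ 2 * legendre_real s (- x) * (1 - x\<^sup>2) powr (s / 2 - 1))"
    using *(2) unfolding set_integrable_of_real_iff[symmetric]
    by (rule set_integrable_cong[THEN iffD1, rotated -1]) (use legendre_triple_real in force)+
qed

definition legA :: "real \<Rightarrow> real \<Rightarrow> real" where
  "legA s y = legendre_real s (y / sqrt (1 + y\<^sup>2))"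

lemma legR_legA:
  assumes "0 < s" "s < 1"
  shows "legR s y = Gamma s * Gamma (1 - s) * ((1 + y\<^sup>2) powr (- s / 2) * legA s y)"
  unfolding legA_def by (rule legR_eq[OF assms])

text \<open>The weight is even in \<open>y\<close>, so the reflection \<open>y\<close> ->
  \<open>- y\<close> pairs the two pure cubes and the two mixed products, and only two distinct
  integrals survive. Its exponent is the Jacobian's \<open>- 3 / 2\<close> plus the
  \<open>1 - s / 2\<close> left by the power of \<open>1 - x\<^sup>2\<close>.\<close>

lemma legJ_line_integral:
  fixes k30 k21 k12 k03 :: complex
  assumes s: "0 < s"
  shows "(\<integral>y. of_real ((1 + y\<^sup>2) powr (- (s + 1) / 2)) *
      (k30 * of_real (legA s y) ^ 3 + k21 * (of_real (legA s y) ^ 2 * of_real (legA s (- y)))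
       + k12 * (of_real (legA s (- y)) ^ 2 * of_real (legA s y)) + k03 * of_real (legA s (- y)) ^ 3) \<partial>lborel)
    = (k30 + k03) * of_real (legJ3 s) + (k21 + k12) * of_real (legJ21 s)"
proof -
  define V where "V y = (1 + y\<^sup>2) powr (- (s + 1) / 2)" for y :: real
  define a where "a = legA s"
  have V_minus: "V (- y) = V y" for y by (simp add: V_def)
  have pos: "0 < 1 + y\<^sup>2" for y :: real by (simp add: add_pos_nonneg)
  have V: "(1 + y\<^sup>2) powr (- 3 / 2) * (F * (1 - (y / sqrt (1 + y\<^sup>2))\<^sup>2) powr (s / 2 - 1)) = V y * F" for y F
  proof -
    have "1 - (y / sqrt (1 + y\<^sup>2))\<^sup>2 = 1 / (1 + y\<^sup>2)"
      using pos[of y] by (simp add: power_divide field_simps)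
    then have "(1 - (y / sqrt (1 + y\<^sup>2))\<^sup>2) powr (s / 2 - 1) = (1 + y\<^sup>2) powr (1 - s / 2)"
      using pos[of y] powr_minus_divide[of "1 + y\<^sup>2" "s / 2 - 1"] by (simp add: powr_divide)
    then have "(1 + y\<^sup>2) powr (- 3 / 2) * (1 - (y / sqrt (1 + y\<^sup>2))\<^sup>2) powr (s / 2 - 1) = V y"
    proof -
      have "- 3 / 2 + (1 - s / 2) = - (s + 1) / 2" by (simp add: field_simps)
      then show ?thesis
        using \<open>_ powr (s / 2 - 1) = _\<close> unfolding V_def by (simp only: powr_add[symmetric])
    qed
    then show ?thesis by (metis mult.commute mult.left_commute)
  qed
  have i30: "integrable lborel (\<lambda>y. V y * a y ^ 3)" and j30: "legJ3 s = (LBINT y. V y * a y ^ 3)"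
    using legJ_integrable(1)[OF s] unit_interval_substitution[of "\<lambda>x. legendre_real s x ^ 3 * (1 - x\<^sup>2) powr (s / 2 - 1)"]
    unfolding V legJ3_def legA_def[symmetric] a_def[symmetric] by simp_all
  have am: "legendre_real s (- (y / sqrt (1 + y\<^sup>2))) = a (- y)" for y by (simp add: a_def legA_def)
  have i21: "integrable lborel (\<lambda>y. V y * (a y ^ 2 * a (- y)))" and j21: "legJ21 s = (LBINT y. V y * (a y ^ 2 * a (- y)))"
    using legJ_integrable(2)[OF s] unit_interval_substitution[of "\<lambda>x. legendre_real s x ^ 2 * legendre_real s (- x) * (1 - x\<^sup>2) powr (s / 2 - 1)"]
    unfolding V legJ21_def am legA_def[symmetric] a_def[symmetric] by simp_all
  have i03: "integrable lborel (\<lambda>y. V y * a (- y) ^ 3)" and j03: "legJ3 s = (LBINT y. V y * a (- y) ^ 3)"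
    using lborel_integrable_real_affine[OF i30, of "-1" 0] lborel_integral_real_affine[of "-1" "\<lambda>y. V y * a y ^ 3" 0] j30
    by (simp_all add: V_minus)
  have i12: "integrable lborel (\<lambda>y. V y * (a (- y) ^ 2 * a y))" and j12: "legJ21 s = (LBINT y. V y * (a (- y) ^ 2 * a y))"
    using lborel_integrable_real_affine[OF i21, of "-1" 0] lborel_integral_real_affine[of "-1" "\<lambda>y. V y * (a y ^ 2 * a (- y))" 0] j21
    by (simp_all add: V_minus)
  have o: "integrable lborel (\<lambda>y. complex_of_real (f y))" if "integrable lborel f" for f :: "real \<Rightarrow> real"
    using that by (rule integrable_of_real)
  have comb: "(\<integral>y. k30 * f1 y + k21 * f2 y + k12 * f3 y + k03 * f4 y \<partial>lborel)
      = k30 * integral\<^sup>L lborel f1 + k21 * integral\<^sup>L lborel f2 + k12 * integral\<^sup>L lborel f3 + k03 * integral\<^sup>L lborel f4"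
    if "integrable lborel f1" "integrable lborel f2" "integrable lborel f3" "integrable lborel f4"
    for f1 f2 f3 f4 :: "real \<Rightarrow> complex"
    using that by simp
  have "(\<integral>y. k30 * of_real (V y * a y ^ 3) + k21 * of_real (V y * (a y ^ 2 * a (- y)))
     + k12 * of_real (V y * (a (- y) ^ 2 * a y)) + k03 * of_real (V y * a (- y) ^ 3) \<partial>lborel)
     = k30 * of_real (LBINT y. V y * a y ^ 3) + k21 * of_real (LBINT y. V y * (a y ^ 2 * a (- y)))
     + k12 * of_real (LBINT y. V y * (a (- y) ^ 2 * a y)) + k03 * of_real (LBINT y. V y * a (- y) ^ 3)"
    unfolding integral_complex_of_real[symmetric]
    by (rule comb[OF o[OF i30] o[OF i21] o[OF i12] o[OF i03]])
  also have "\<dots> = (k30 + k03) * of_real (legJ3 s) + (k21 + k12) * of_real (legJ21 s)"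
    unfolding j30[symmetric] j21[symmetric] j12[symmetric] j03[symmetric] by (simp add: algebra_simps)
  finally show ?thesis
    by (simp add: V_def a_def algebra_simps)
qed

text \<open>On the imaginary axis \<open>legF s\<close> and \<open>legF (1 - s)\<close> are linear
  in the same values \<open>legA s y\<close> and \<open>legA s (- y)\<close>, with phases
  \<open>c\<close> and \<open>c'\<close> and their conjugates. Expanding the vanishing cubic
  integral therefore gives one linear relation between \<open>legJ3 s\<close> and
  \<open>legJ21 s\<close>.\<close>

lemma legendre_identity_unit_interval:
  assumes s: "0 < s" "s < 1"
  shows "legJ3 s = (3 + 2 * cos (pi * s)) * legJ21 s"
proof -
  define B where "B = Gamma s * Gamma (1 - s)"
  have B: "0 < B" unfolding B_def using s by (intro mult_pos_pos Gamma_real_pos) auto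
  define \<sigma> where "\<sigma> = pi * s / 2"
  define c c' where "c = cis \<sigma>" and "c' = cis (pi * (1 - s) / 2)"
  have cc: "c * cnj c = 1" "c' * cnj c' = 1" by (simp_all add: c_def c'_def cis_cnj cis_mult)
  define k30 k21 k12 k03 where "k30 = c\<^sup>2 * c'" and "k21 = c\<^sup>2 * cnj c' + 2 * c'"
    and "k12 = (cnj c)\<^sup>2 * c' + 2 * cnj c'" and "k03 = (cnj c)\<^sup>2 * cnj c'"
  have expand: "legF s (\<i> * of_real y) ^ 2 * legF (1 - s) (\<i> * of_real y) = of_real (B ^ 3) *
      (of_real ((1 + y\<^sup>2) powr (- (s + 1) / 2)) *
      (k30 * of_real (legA s y) ^ 3 + k21 * (of_real (legA s y) ^ 2 * of_real (legA s (- y)))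
       + k12 * (of_real (legA s (- y)) ^ 2 * of_real (legA s y)) + k03 * of_real (legA s (- y)) ^ 3))" for y
  proof -
    define E where "E = (1 + y\<^sup>2) powr (- s / 2)"
    define E' where "E' = (1 + y\<^sup>2) powr (- (1 - s) / 2)"
    define V where "V = (1 + y\<^sup>2) powr (- (s + 1) / 2)"
    have E: "E\<^sup>2 * E' = V"
      by (simp add: E_def E'_def V_def power2_eq_square powr_add[symmetric] field_simps)
    have s': "0 < 1 - s" "1 - s < 1" using s by auto
    have R: "legR s y = B * (E * legA s y)" "legR s (- y) = B * (E * legA s (- y))"
      unfolding legR_legA[OF s] by (simp_all add: B_def E_def)
    have R': "legR (1 - s) y = B * (E' * legA s y)" "legR (1 - s) (- y) = B * (E' * legA s (- y))"
      unfolding legR_legA[OF s'] by (simp_all add: B_def E'_def legA_def legendre_real_reflect mult_ac)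
    have F: "legF s (\<i> * of_real y) = of_real (B * E) * (cnj c * of_real (legA s (- y)) + c * of_real (legA s y))"
      unfolding legF_imaginary[OF s] R by (simp add: c_def \<sigma>_def cis_cnj algebra_simps)
    have F': "legF (1 - s) (\<i> * of_real y) = of_real (B * E') * (cnj c' * of_real (legA s (- y)) + c' * of_real (legA s y))"
    proof -
      have "cis (- pi * (1 - s) / 2) = cnj c'" "cis (pi * (1 - s) / 2) = c'"
        by (simp_all add: c'_def cis_cnj)
      then show ?thesis unfolding legF_imaginary[OF s'] R' by (simp add: algebra_simps)
    qed
    have poly: "(cnj c * q + c * p)\<^sup>2 * (cnj c' * q + c' * p) = k30 * p ^ 3 + k21 * (p\<^sup>2 * q) + k12 * (q\<^sup>2 * p) + k03 * q ^ 3" for p q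
    proof -
      have "(cnj c * q + c * p)\<^sup>2 = c\<^sup>2 * p\<^sup>2 + 2 * (c * cnj c) * (p * q) + (cnj c)\<^sup>2 * q\<^sup>2"
        by (simp add: power2_eq_square algebra_simps)
      then have sq: "(cnj c * q + c * p)\<^sup>2 = c\<^sup>2 * p\<^sup>2 + 2 * (p * q) + (cnj c)\<^sup>2 * q\<^sup>2"
        unfolding cc by simp
      show ?thesis unfolding sq k30_def k21_def k12_def k03_def
        by (simp add: power2_eq_square power3_eq_cube algebra_simps)
    qed
    have "legF s (\<i> * of_real y) ^ 2 * legF (1 - s) (\<i> * of_real y)
        = of_real (B ^ 3 * (E\<^sup>2 * E')) * ((cnj c * of_real (legA s (- y)) + c * of_real (legA s y))\<^sup>2 * (cnj c' * of_real (legA s (- y)) + c' * of_real (legA s y)))"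
      unfolding F F' by (simp add: power2_eq_square power3_eq_cube mult_ac)
    also have "\<dots> = of_real (B ^ 3 * V) * (k30 * of_real (legA s y) ^ 3 + k21 * (of_real (legA s y) ^ 2 * of_real (legA s (- y)))
       + k12 * (of_real (legA s (- y)) ^ 2 * of_real (legA s y)) + k03 * of_real (legA s (- y)) ^ 3)"
      unfolding poly E ..
    finally show ?thesis by (simp add: V_def mult.assoc)
  qed
  have "0 = (\<integral>y. legF s (\<i> * of_real y) ^ 2 * legF (1 - s) (\<i> * of_real y) \<partial>lborel)"
    using legF_triple_integral_eq_0(2)[OF s] by simp
  also have "\<dots> = of_real (B ^ 3) * ((k30 + k03) * of_real (legJ3 s) + (k21 + k12) * of_real (legJ21 s))"
    unfolding expand integral_mult_right_zero legJ_line_integral[OF s(1)] ..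
  finally have "0 = (k30 + k03) * of_real (legJ3 s) + (k21 + k12) * of_real (legJ21 s)"
    by (metis B less_irrefl mult_eq_0_iff of_real_eq_0_iff zero_less_power)
  \<comment> \<open>The coefficients form conjugate pairs, \<open>k03 = cnj k30\<close> and
    \<open>k12 = cnj k21\<close>, so the real part contains the whole relation.\<close>
  then have "0 = Re ((k30 + k03) * of_real (legJ3 s) + (k21 + k12) * of_real (legJ21 s))"
    by simp
  also have "\<dots> = - 2 * sin \<sigma> * legJ3 s + 2 * (sin (3 * \<sigma>) + 2 * sin \<sigma>) * legJ21 s"
  proof -
    have c': "c' = cis (pi / 2 - \<sigma>)" by (simp add: c'_def \<sigma>_def field_simps)
    have c2: "c\<^sup>2 = cis (2 * \<sigma>)" by (simp add: c_def power2_eq_square cis_mult)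
    have cc2: "(cnj c)\<^sup>2 = cis (- (2 * \<sigma>))" by (simp add: c_def power2_eq_square cis_cnj cis_mult)
    have "Re (k30 + k03) = 2 * cos (pi / 2 + \<sigma>)"
      unfolding k30_def k03_def c' c2 cc2 cis_cnj cis_mult by (simp add: algebra_simps) (simp add: cos_diff cos_add sin_add sin_diff)
    moreover have "Re (k21 + k12) = 2 * cos (3 * \<sigma> - pi / 2) + 4 * cos (pi / 2 - \<sigma>)"
    proof -
      have "k21 + k12 = cis (3 * \<sigma> - pi / 2) + cis (- (3 * \<sigma> - pi / 2)) + 2 * (cis (pi / 2 - \<sigma>) + cis (- (pi / 2 - \<sigma>)))"
        unfolding k21_def k12_def c' c2 cc2 cis_cnj cis_mult by (simp add: algebra_simps)
      moreover have "Re (cis A + cis (- A) + 2 * (cis D + cis (- D))) = 2 * cos A + 4 * cos D" for A D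
        by simp
      ultimately show ?thesis by (simp only:)
    qed
    moreover have "Re ((k30 + k03) * of_real (legJ3 s) + (k21 + k12) * of_real (legJ21 s)) = Re (k30 + k03) * legJ3 s + Re (k21 + k12) * legJ21 s"
      by simp
    moreover have "cos (pi / 2 + \<sigma>) = - sin \<sigma>" "cos (3 * \<sigma> - pi / 2) = sin (3 * \<sigma>)" "cos (pi / 2 - \<sigma>) = sin \<sigma>"
      by (simp_all add: cos_add cos_diff)
    ultimately show ?thesis by (simp only:) (simp add: algebra_simps)
  qed
  \<comment> \<open>The triple angle is the source of the factor in the identity; with \<nu> = s -
    1, \<open>cos (pi * s)\<close> is \<open>- cos (\<nu> * pi)\<close>.\<close>
  also have "sin (3 * \<sigma>) + 2 * sin \<sigma> = sin \<sigma> * (3 + 2 * cos (pi * s))"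
  proof -
    have "sin (3 * \<sigma>) = sin (2 * \<sigma> + \<sigma>)" by simp
    also have "\<dots> = sin \<sigma> * (2 * (cos \<sigma>)\<^sup>2 + cos (2 * \<sigma>))"
      unfolding sin_add sin_double by (simp add: power2_eq_square algebra_simps)
    also have "2 * (cos \<sigma>)\<^sup>2 = 1 + cos (2 * \<sigma>)" by (simp add: cos_double_cos)
    finally show ?thesis by (simp add: \<sigma>_def algebra_simps)
  qed
  finally have "sin \<sigma> * legJ3 s = sin \<sigma> * ((3 + 2 * cos (pi * s)) * legJ21 s)"
    by auto
  moreover have "sin \<sigma> > 0" using s by (intro sin_gt_zero) (auto simp: \<sigma>_def)
  ultimately show ?thesis by simp
qed

lemma legendre_identity:
  assumes nu: "-1 < Re \<nu>"
  shows "legI3 \<nu> = (3 - 2 * cos (\<nu> * of_real pi)) * legI21 \<nu>"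
proof -
  define S where "S = {\<nu>::complex. -1 < Re \<nu>}"
  \<comment> \<open>A real segment is enough for the identity theorem: it accumulates at -1/2,
    inside the connected half-plane.\<close>
  define U where "U = complex_of_real ` {-1<..<0}"
  have "legI3 \<nu> - (3 - 2 * cos (\<nu> * of_real pi)) * legI21 \<nu> = 0"
  proof (rule analytic_continuation[where f = "\<lambda>\<nu>. legI3 \<nu> - (3 - 2 * cos (\<nu> * of_real pi)) * legI21 \<nu>" and S = S and U = U and \<xi> = "of_real (-1/2)"])
    show "(\<lambda>\<nu>. legI3 \<nu> - (3 - 2 * cos (\<nu> * of_real pi)) * legI21 \<nu>) holomorphic_on S"
      unfolding S_def by (intro holomorphic_intros legI_holomorphic)
    show "open S" unfolding S_def by (rule open_halfspace_Re_gt)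
    show "connected S" unfolding S_def by (intro convex_connected convex_halfspace_Re_gt)
    show "U \<subseteq> S" by (auto simp: U_def S_def)
    show "complex_of_real (-1/2) \<in> S" "\<nu> \<in> S" using nu by (auto simp: S_def)
    show "complex_of_real (-1/2) islimpt U"
    proof -
      have "(-1/2::real) islimpt {-1<..<0}" 
        by (rule interior_limit_point) (simp add: interior_open)
      then obtain X where X: "\<And>n. X n \<in> {-1<..<0} - {-1/2}" "X \<longlonglongrightarrow> (-1/2::real)"
        unfolding islimpt_sequential by blast
      show ?thesis
        unfolding islimpt_sequential
      proof (intro exI[of _ "\<lambda>n. complex_of_real (X n)"] conjI allI)
        show "complex_of_real (X n) \<in> U - {complex_of_real (-1/2)}" for n
          using X(1)[of n] unfolding U_def by (metis Diff_iff imageI of_real_eq_iff singletonD singletonI)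
        show "(\<lambda>n. complex_of_real (X n)) \<longlonglongrightarrow> complex_of_real (-1/2)"
          using X(2) by (rule tendsto_of_real)
      qed
    qed
    fix z assume "z \<in> U"
    then obtain t where t: "t \<in> {-1<..<0}" "z = of_real t" by (auto simp: U_def)
    define s where "s = t + 1"
    have s: "0 < s" "s < 1" "z = of_real (s - 1)" using t by (auto simp: s_def)
    have "cos (z * of_real pi) = of_real (cos ((s - 1) * pi))"
      unfolding s(3) by (simp only: of_real_mult[symmetric] cos_of_real)
    also have "cos ((s - 1) * pi) = - cos (pi * s)"
      by (simp add: algebra_simps cos_diff)
    finally have "3 - 2 * cos (z * of_real pi) = of_real (3 + 2 * cos (pi * s))" by simp
    then show "legI3 z - (3 - 2 * cos (z * of_real pi)) * legI21 z = 0"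
      using legendre_identity_unit_interval[OF s(1,2)] unfolding s(3) legI_of_real by simp
  qed
  then show ?thesis by simp
qed

section \<open>A triple integral on the hyperbolic plane\<close>

lemma nn_integral_const_interval:
  fixes a b c :: real
  assumes "a \<le> b" "0 \<le> c"
  shows "(\<integral>\<^sup>+x\<in>{a<..<b}. ennreal c \<partial>lborel) = ennreal (c * (b - a))"
  using assms by (simp add: nn_integral_cmult_indicator ennreal_mult')

lemma nn_integral_inverse_quadratic:
  fixes \<alpha> \<beta> \<gamma> :: real
  assumes \<alpha>: "0 < \<alpha>" and disc: "\<beta>\<^sup>2 < \<alpha> * \<gamma>"
  shows "(\<integral>\<^sup>+x. ennreal (1 / (\<alpha> * x\<^sup>2 - 2 * \<beta> * x + \<gamma>)) \<partial>lborel) = ennreal (pi / sqrt (\<alpha> * \<gamma> - \<beta>\<^sup>2))"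
proof -
  define \<delta> where "\<delta> = sqrt (\<alpha> * \<gamma> - \<beta>\<^sup>2)"
  have \<delta>: "0 < \<delta>" "\<delta>\<^sup>2 = \<alpha> * \<gamma> - \<beta>\<^sup>2" using disc by (auto simp: \<delta>_def)
  \<comment> \<open>After completing the square,
    \<open>\<alpha> * x - \<beta> = \<delta> * tan \<theta>\<close> makes integrand times Jacobian
    the constant \<open>1 / \<delta>\<close> on an interval of length \<open>pi\<close>.\<close>
  define g where "g \<theta> = (\<beta> + \<delta> * tan \<theta>) / \<alpha>" for \<theta>
  define h where "h \<theta> = \<delta> * inverse ((cos \<theta>)\<^sup>2) / \<alpha>" for \<theta>
  let ?S = "{-(pi/2)<..<pi/2}"
  have quad: "\<alpha> * x\<^sup>2 - 2 * \<beta> * x + \<gamma> = ((\<alpha> * x - \<beta>)\<^sup>2 + \<delta>\<^sup>2) / \<alpha>" for x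
    using \<alpha> unfolding \<delta>(2) by (simp add: field_simps power2_eq_square)
  have cospos: "0 < cos \<theta>" if "\<theta> \<in> ?S" for \<theta> using that by (auto intro!: cos_gt_zero_pi)
  have img: "g ` ?S = UNIV"
  proof (intro set_eqI iffI UNIV_I)
    fix x :: real
    have "g (arctan ((\<alpha> * x - \<beta>) / \<delta>)) = x" "arctan ((\<alpha> * x - \<beta>) / \<delta>) \<in> ?S"
      using \<alpha> \<delta>(1) arctan_bounded[of "(\<alpha> * x - \<beta>) / \<delta>"] by (auto simp: g_def tan_arctan)
    then show "x \<in> g ` ?S" by (metis imageI)
  qed
  have "(\<integral>\<^sup>+x. ennreal (1 / (\<alpha> * x\<^sup>2 - 2 * \<beta> * x + \<gamma>)) \<partial>lborel)
      = (\<integral>\<^sup>+x\<in>g ` ?S. ennreal (1 / (\<alpha> * x\<^sup>2 - 2 * \<beta> * x + \<gamma>)) \<partial>lborel)"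
    unfolding img by simp
  also have "\<dots> = (\<integral>\<^sup>+\<theta>\<in>?S. ennreal (\<bar>h \<theta>\<bar> * (1 / (\<alpha> * (g \<theta>)\<^sup>2 - 2 * \<beta> * g \<theta> + \<gamma>))) \<partial>lborel)"
  proof (rule nn_integral_change_of_variables)
    show "inj_on g ?S"
    proof (rule inj_onI)
      fix x y assume xy: "x \<in> ?S" "y \<in> ?S" "g x = g y"
      then have "tan x = tan y" using \<alpha> \<delta> by (simp add: g_def)
      then show "x = y" using xy by (metis arctan_tan greaterThanLessThan_iff)
    qed
    show "(g has_real_derivative h \<theta>) (at \<theta>)" if "\<theta> \<in> ?S" for \<theta>
      unfolding g_def h_def using cospos[OF that] \<alpha> by (auto intro!: derivative_eq_intros)
    show "0 \<le> 1 / (\<alpha> * y\<^sup>2 - 2 * \<beta> * y + \<gamma>)" for y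
      unfolding quad using \<alpha> by simp
    show "g \<in> borel_measurable borel" "h \<in> borel_measurable borel"
      unfolding g_def h_def tan_def by measurable
  qed (auto simp: img)
  also have "\<dots> = (\<integral>\<^sup>+\<theta>\<in>?S. ennreal (1 / \<delta>) \<partial>lborel)"
  proof (rule nn_integral_cong)
    fix \<theta>
    have "\<bar>h \<theta>\<bar> * (1 / (\<alpha> * (g \<theta>)\<^sup>2 - 2 * \<beta> * g \<theta> + \<gamma>)) = 1 / \<delta>" if "\<theta> \<in> ?S"
    proof -
      have c: "0 < cos \<theta>" by (rule cospos[OF that])
      have "\<alpha> * (g \<theta>)\<^sup>2 - 2 * \<beta> * g \<theta> + \<gamma> = ((\<delta> * tan \<theta>)\<^sup>2 + \<delta>\<^sup>2) / \<alpha>"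
        unfolding quad using \<alpha> by (simp add: g_def)
      also have "\<dots> = \<delta>\<^sup>2 * inverse ((cos \<theta>)\<^sup>2) / \<alpha>"
      proof -
        have "(\<delta> * tan \<theta>)\<^sup>2 + \<delta>\<^sup>2 = \<delta>\<^sup>2 * (1 + (tan \<theta>)\<^sup>2)"
          by (simp add: power_mult_distrib algebra_simps)
        also have "1 + (tan \<theta>)\<^sup>2 = inverse ((cos \<theta>)\<^sup>2)"
          using tan_sec[of \<theta>] c by (simp add: power_inverse)
        finally show ?thesis by simp
      qed
      finally show ?thesis using \<alpha> \<delta> c by (simp add: h_def field_simps power2_eq_square)
    qed
    then show "ennreal (\<bar>h \<theta>\<bar> * (1 / (\<alpha> * (g \<theta>)\<^sup>2 - 2 * \<beta> * g \<theta> + \<gamma>))) * indicator ?S \<theta> = ennreal (1 / \<delta>) * indicator ?S \<theta>"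
      by (cases "\<theta> \<in> ?S") auto
  qed
  also have "\<dots> = ennreal (pi / \<delta>)"
    using \<delta> by (subst nn_integral_const_interval) auto
  finally show ?thesis by (simp add: \<delta>_def)
qed

text \<open>Linearises products under a square root, so that Fubini leaves integrals of inverse quadratics.\<close>
lemma nn_integral_inverse_sqrt:
  fixes A B :: real
  assumes A: "0 < A" and B: "0 < B"
  shows "(\<integral>\<^sup>+s. ennreal (exp (s / 2) / (A + exp s * B)) \<partial>lborel) = ennreal (pi / sqrt (A * B))"
proof -
  \<comment> \<open>Chosen so that \<open>exp (g \<theta>) * B = A * (tan \<theta>)\<^sup>2\<close>;
    then integrand times Jacobian is the constant \<open>2 / sqrt (A * B)\<close> on an interval of
    length \<open>pi / 2\<close>.\<close>
  define g where "g \<theta> = ln (A / B) + 2 * ln (tan \<theta>)" for \<theta>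
  define h where "h \<theta> = 2 * inverse ((cos \<theta>)\<^sup>2) / tan \<theta>" for \<theta> :: real
  let ?S = "{0<..<pi/2}"
  have pos: "0 < cos \<theta>" "0 < sin \<theta>" "0 < tan \<theta>" if "\<theta> \<in> ?S" for \<theta>
    using that by (auto intro!: cos_gt_zero_pi sin_gt_zero tan_gt_zero)
  have img: "g ` ?S = UNIV"
  proof (intro set_eqI iffI UNIV_I)
    fix s :: real
    have "g (arctan (exp ((s - ln (A / B)) / 2))) = s" "arctan (exp ((s - ln (A / B)) / 2)) \<in> ?S"
      using arctan_bounded[of "exp ((s - ln (A / B)) / 2)"] by (auto simp: g_def tan_arctan diff_divide_distrib)
    then show "s \<in> g ` ?S" by (metis imageI)
  qed
  have "(\<integral>\<^sup>+s. ennreal (exp (s / 2) / (A + exp s * B)) \<partial>lborel) = (\<integral>\<^sup>+s\<in>g ` ?S. ennreal (exp (s / 2) / (A + exp s * B)) \<partial>lborel)"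
    unfolding img by simp
  also have "\<dots> = (\<integral>\<^sup>+\<theta>\<in>?S. ennreal (\<bar>h \<theta>\<bar> * (exp (g \<theta> / 2) / (A + exp (g \<theta>) * B))) \<partial>lborel)"
  proof (rule nn_integral_change_of_variables)
    show "inj_on g ?S"
    proof (rule inj_onI)
      fix x y assume xy: "x \<in> ?S" "y \<in> ?S" "g x = g y"
      then have "tan x = tan y" using pos by (simp add: g_def)
      then show "x = y" using xy arctan_tan[of x] arctan_tan[of y] pi_gt_zero
        by (metis (no_types) greaterThanLessThan_iff less_trans neg_less_0_iff_less half_gt_zero)
    qed
    show "(g has_real_derivative h \<theta>) (at \<theta>)" if "\<theta> \<in> ?S" for \<theta>
      unfolding g_def h_def using pos[OF that] by (auto intro!: derivative_eq_intros simp: field_simps)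
    show "g \<in> borel_measurable borel" "h \<in> borel_measurable borel"
      unfolding g_def h_def tan_def by measurable
  qed (use A B in \<open>auto simp: img\<close>)
  also have "\<dots> = (\<integral>\<^sup>+\<theta>\<in>?S. ennreal (2 / sqrt (A * B)) \<partial>lborel)"
  proof (rule nn_integral_cong)
    fix \<theta>
    have "\<bar>h \<theta>\<bar> * (exp (g \<theta> / 2) / (A + exp (g \<theta>) * B)) = 2 / sqrt (A * B)" if "\<theta> \<in> ?S"
    proof -
      note p = pos[OF that]
      have e2: "exp (g \<theta> / 2) = sqrt (A / B) * tan \<theta>"
      proof -
        have "g \<theta> / 2 = ln (sqrt (A / B)) + ln (tan \<theta>)"
          using A B by (simp add: g_def ln_sqrt)
        then have "exp (g \<theta> / 2) = exp (ln (sqrt (A / B)) + ln (tan \<theta>))" by (simp only:)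
        then show ?thesis using A B p by (simp add: exp_add)
      qed
      have "exp (g \<theta>) = exp (g \<theta> / 2) ^ 2" by (simp add: exp_double[symmetric])
      then have e1: "exp (g \<theta>) * B = A * (tan \<theta>)\<^sup>2"
        unfolding e2 using A B by (simp add: power_mult_distrib)
      have den: "A + exp (g \<theta>) * B = A * inverse ((cos \<theta>)\<^sup>2)"
      proof -
        have "A + A * (tan \<theta>)\<^sup>2 = A * (1 + (tan \<theta>)\<^sup>2)" by (simp add: algebra_simps)
        also have "1 + (tan \<theta>)\<^sup>2 = inverse ((cos \<theta>)\<^sup>2)"
          using tan_sec[of \<theta>] p by (simp add: power_inverse)
        finally show ?thesis unfolding e1 .
      qed
      have "\<bar>h \<theta>\<bar> = h \<theta>" using p by (simp add: h_def)
      then have "\<bar>h \<theta>\<bar> * (exp (g \<theta> / 2) / (A + exp (g \<theta>) * B)) = 2 * sqrt (A / B) / A"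
        unfolding den e2 h_def using p A by (simp add: field_simps)
      also have "\<dots> = 2 / sqrt (A * B)"
        using A B by (simp add: real_sqrt_divide real_sqrt_mult field_simps)
      finally show ?thesis .
    qed
    then show "ennreal (\<bar>h \<theta>\<bar> * (exp (g \<theta> / 2) / (A + exp (g \<theta>) * B))) * indicator ?S \<theta> = ennreal (2 / sqrt (A * B)) * indicator ?S \<theta>"
      by (cases "\<theta> \<in> ?S") auto
  qed
  also have "\<dots> = ennreal (pi / sqrt (A * B))"
    using A B by (subst nn_integral_const_interval) auto
  finally show ?thesis .
qed

text \<open>The values of \<open>legF (1/2)\<close> on the nonnegative axis, kept real so that they
  can enter nonnegative integrals.\<close>

definition legFr :: "real \<Rightarrow> real" where
  "legFr u = (\<integral>t. 1 / sqrt (u + cosh t) \<partial>lborel)"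

lemma powr_minus_half: "0 \<le> x \<Longrightarrow> x powr (- (1 / 2)) = 1 / sqrt x" for x :: real
  by (simp add: powr_minus powr_half_sqrt inverse_eq_divide)

lemma inverse_sqrt_cosh_integrable:
  assumes u: "0 \<le> u"
  shows "integrable lborel (\<lambda>t. 1 / sqrt (u + cosh t))"
proof (rule Bochner_Integration.integrable_bound)
  show "integrable lborel (\<lambda>t::real. cosh t powr (- (1 / 2)))" by (rule integrable_cosh_powr) simp
  show "AE t in lborel. norm (1 / sqrt (u + cosh t)) \<le> norm (cosh t powr (- (1 / 2)))"
    using u by (intro AE_I2) (auto simp: powr_minus_half intro!: divide_left_mono mult_pos_pos add_nonneg_pos)
qed measurable

lemma legFr_nn:
  assumes u: "0 \<le> u"
  shows "(\<integral>\<^sup>+t. ennreal (1 / sqrt (u + cosh t)) \<partial>lborel) = ennreal (legFr u)"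
    and legFr_nonneg: "0 \<le> legFr u"
proof -
  have nn: "0 \<le> 1 / sqrt (u + cosh t)" for t
    using u by simp
  show "(\<integral>\<^sup>+t. ennreal (1 / sqrt (u + cosh t)) \<partial>lborel) = ennreal (legFr u)"
    unfolding legFr_def by (rule nn_integral_eq_integral[OF inverse_sqrt_cosh_integrable[OF u]]) (use nn in auto)
  show "0 \<le> legFr u" unfolding legFr_def by (rule integral_nonneg_AE) (use nn in auto)
qed

text \<open>The substitution \<open>t = ln (v / (1 - v)) / 2\<close> gives
  \<open>cosh t = 1 / (2 * sqrt (v * (1 - v)))\<close>, and the integral becomes
  \<open>Beta (1/4) (1/4) / sqrt 2\<close>. This is where the Gamma value of the theorem comes
  from.\<close>

lemma legFr_0: "legFr 0 = Gamma (1 / 4) ^ 2 / sqrt (2 * pi)"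
proof -
  define g where "g v = (ln v - ln (1 - v)) / 2" for v :: real
  define h where "h v = 1 / (2 * (v * (1 - v)))" for v :: real
  have img: "g ` {0<..<1} = UNIV"
  proof (intro set_eqI iffI UNIV_I)
    fix t :: real
    define v where "v = exp (2 * t) / (1 + exp (2 * t))"
    have p: "0 < 1 + exp (2 * t)" by (simp add: add_pos_pos)
    have v: "v \<in> {0<..<1}" "1 - v = 1 / (1 + exp (2 * t))" using p by (auto simp: v_def field_simps)
    have "g v = t"
      unfolding g_def v(2) unfolding v_def using p by (simp add: ln_div)
    with v show "t \<in> g ` {0<..<1}" by blast
  qed
  have "ennreal (legFr 0) = (\<integral>\<^sup>+t\<in>g ` {0<..<1}. ennreal (1 / sqrt (cosh t)) \<partial>lborel)"
    unfolding img using legFr_nn(1)[of 0] by simp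
  also have "\<dots> = (\<integral>\<^sup>+v\<in>{0<..<1}. ennreal (\<bar>h v\<bar> * (1 / sqrt (cosh (g v)))) \<partial>lborel)"
  proof (rule nn_integral_change_of_variables)
    show "(g has_real_derivative h v) (at v)" if "v \<in> {0<..<1}" for v
      unfolding g_def h_def using that by (auto intro!: derivative_eq_intros simp: field_simps)
    show "inj_on g {0<..<1}"
    proof (rule inj_onI)
      fix x y :: real assume xy: "x \<in> {0<..<1}" "y \<in> {0<..<1}" "g x = g y"
      then have "ln (x / (1 - x)) = ln (y / (1 - y))" by (simp add: g_def ln_div)
      then have "x / (1 - x) = y / (1 - y)" using xy by (subst (asm) ln_inj_iff) auto
      then show "x = y" using xy by (simp add: field_simps)
    qed
    show "g \<in> borel_measurable borel" "h \<in> borel_measurable borel"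
      unfolding g_def h_def by measurable
  qed (auto simp: img)
  also have "\<dots> = (\<integral>\<^sup>+v. ennreal (1 / sqrt 2) * (ennreal (v powr (1/4 - 1) * (1 - v) powr (1/4 - 1)) * indicator {0<..<1} v) \<partial>lborel)"
  proof (rule nn_integral_cong)
    fix v :: real
    have "\<bar>h v\<bar> * (1 / sqrt (cosh (g v))) = 1 / sqrt 2 * (v powr (1/4 - 1) * (1 - v) powr (1/4 - 1))" if v: "0 < v" "v < 1"
    proof -
      have gv: "g v = ln (sqrt (v / (1 - v)))" using v by (simp add: g_def ln_sqrt ln_div)
      have "cosh (g v) = (sqrt (v / (1 - v)) + inverse (sqrt (v / (1 - v)))) / 2"
        unfolding gv using v by (intro cosh_ln_real) simp
      also have "\<dots> = 1 / (2 * sqrt (v * (1 - v)))"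
      proof -
        define p q where "p = sqrt v" and "q = sqrt (1 - v)"
        have pq: "0 < p" "0 < q" "p * p + q * q = 1" using v by (simp_all add: p_def q_def)
        have "(p / q + inverse (p / q)) / 2 = (p * p + q * q) / (2 * (p * q))"
          using pq(1,2) by (simp add: field_simps)
        then show ?thesis unfolding pq(3) by (simp add: p_def q_def real_sqrt_divide real_sqrt_mult)
      qed
      finally have "1 / sqrt (cosh (g v)) = sqrt 2 * sqrt (sqrt (v * (1 - v)))"
        using v by (simp add: real_sqrt_divide real_sqrt_mult)
      also have "sqrt (sqrt (v * (1 - v))) = (v * (1 - v)) powr (1/4)"
        using v by (simp add: powr_half_sqrt[symmetric] powr_powr)
      finally have "\<bar>h v\<bar> * (1 / sqrt (cosh (g v))) = sqrt 2 / 2 * ((v * (1 - v)) powr (1/4) / (v * (1 - v)))"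
        using v by (simp add: h_def)
      also have "(v * (1 - v)) powr (1/4) / (v * (1 - v)) = (v * (1 - v)) powr (1/4 - 1)"
        using v powr_diff[of "v * (1 - v)" "1/4" 1] by simp
      also have "\<dots> = v powr (1/4 - 1) * (1 - v) powr (1/4 - 1)"
        using v by (simp add: powr_mult)
      also have "sqrt 2 / 2 = 1 / sqrt 2" by (simp add: real_div_sqrt field_simps)
      finally show ?thesis .
    qed
    then show "ennreal (\<bar>h v\<bar> * (1 / sqrt (cosh (g v)))) * indicator {0<..<1} v
       = ennreal (1 / sqrt 2) * (ennreal (v powr (1/4 - 1) * (1 - v) powr (1/4 - 1)) * indicator {0<..<1} v)"
      by (cases "v \<in> {0<..<1}") (auto simp: ennreal_mult'[symmetric])
  qed
  also have "\<dots> = ennreal (1 / sqrt 2) * ennreal (Beta (1/4) (1/4))"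
    by (subst nn_integral_cmult, measurable, subst nn_integral_Beta) auto
  also have "\<dots> = ennreal (Gamma (1 / 4) ^ 2 / sqrt (2 * pi))"
  proof -
    have "Beta (1/4) (1/4 :: real) = Gamma (1/4) ^ 2 / sqrt pi"
      by (simp add: Beta_def Gamma_one_half_real power2_eq_square)
    then show ?thesis by (simp add: ennreal_mult'[symmetric] real_sqrt_mult)
  qed
  finally show ?thesis
    by (subst (asm) ennreal_inj) (auto intro: legFr_nonneg)
qed

section \<open>Integrals of square roots of Poisson kernels\<close>

lemma sqrt_exp: "sqrt (exp x) = exp (x / 2)" for x :: real
  by (rule real_sqrt_unique) (simp_all add: exp_double[symmetric])

text \<open>With \<open>y = exp t\<close>, the left side is \<open>y powr (- 1 / 2)\<close> times
  the integral over \<open>b\<close> of the square roots of the Poisson kernels of the points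
  \<open>x + \<i> * y\<close> and \<open>\<i>\<close>. That integral is invariant under isometries,
  so it depends only on the hyperbolic distance of the points, whose cosh is the argument of
  \<open>legFr\<close>. The computation writes the root as an integral over \<open>s\<close> and
  integrates an inverse quadratic in \<open>b\<close>.\<close>

lemma inverse_sqrt_convolution:
  fixes x t :: real
  shows "(\<integral>\<^sup>+b. ennreal (1 / sqrt (((x - b)\<^sup>2 + exp (2 * t)) * (1 + b\<^sup>2))) \<partial>lborel)
    = ennreal (exp (- t / 2) / sqrt 2 * legFr (cosh t + x\<^sup>2 * exp (- t) / 2))"
proof -
  define u where "u = cosh t + x\<^sup>2 * exp (- t) / 2"
  have u: "0 \<le> u" by (simp add: u_def)
  have y: "x\<^sup>2 + exp (2 * t) + 1 = 2 * u * exp t"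
    by (simp add: u_def cosh_field_def field_simps mult_exp_exp exp_minus)
  define Q where "Q b s = (1 + exp s) * b\<^sup>2 - 2 * x * b + (x\<^sup>2 + exp (2 * t) + exp s)" for b s
  have Q: "(x - b)\<^sup>2 + exp (2 * t) + exp s * (1 + b\<^sup>2) = Q b s" for b s
    by (simp add: Q_def power2_eq_square algebra_simps)
  have disc: "(1 + exp s) * (x\<^sup>2 + exp (2 * t) + exp s) - x\<^sup>2 = exp s * exp s + 2 * u * exp t * exp s + exp (2 * t)" for s
    unfolding y[symmetric] by (simp add: algebra_simps)
  have disc_pos: "0 < exp s * exp s + 2 * u * exp t * exp s + exp (2 * t)" for s
    using u by (intro add_pos_pos add_pos_nonneg) auto
  have "ennreal pi * (\<integral>\<^sup>+b. ennreal (1 / sqrt (((x - b)\<^sup>2 + exp (2 * t)) * (1 + b\<^sup>2))) \<partial>lborel)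
     = (\<integral>\<^sup>+b. (\<integral>\<^sup>+s. ennreal (exp (s / 2) / Q b s) \<partial>lborel) \<partial>lborel)"
  proof (subst nn_integral_cmult[symmetric], measurable, rule nn_integral_cong)
    fix b :: real
    have "0 < (x - b)\<^sup>2 + exp (2 * t)" "0 < 1 + b\<^sup>2"
      by (rule add_nonneg_pos add_pos_nonneg; simp)+
    from nn_integral_inverse_sqrt[OF this]
    show "ennreal pi * ennreal (1 / sqrt (((x - b)\<^sup>2 + exp (2 * t)) * (1 + b\<^sup>2))) = (\<integral>\<^sup>+s. ennreal (exp (s / 2) / Q b s) \<partial>lborel)"
      unfolding Q by (simp add: ennreal_mult'[symmetric])
  qed
  also have "\<dots> = (\<integral>\<^sup>+s. (\<integral>\<^sup>+b. ennreal (exp (s / 2) / Q b s) \<partial>lborel) \<partial>lborel)"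
    unfolding Q_def by (rule lborel_pair.Fubini') measurable
  also have "\<dots> = (\<integral>\<^sup>+s. ennreal (pi * (exp (s / 2) / sqrt (exp s * exp s + 2 * u * exp t * exp s + exp (2 * t)))) \<partial>lborel)"
  proof (rule nn_integral_cong)
    fix s :: real
    have "(\<integral>\<^sup>+b. ennreal (exp (s / 2) / Q b s) \<partial>lborel) = (\<integral>\<^sup>+b. ennreal (exp (s / 2)) * ennreal (1 / Q b s) \<partial>lborel)"
      by (intro nn_integral_cong) (simp add: ennreal_mult'[symmetric])
    also have "\<dots> = ennreal (exp (s / 2)) * (\<integral>\<^sup>+b. ennreal (1 / Q b s) \<partial>lborel)"
      unfolding Q_def by (rule nn_integral_cmult) measurable
    also have "(\<integral>\<^sup>+b. ennreal (1 / Q b s) \<partial>lborel) = ennreal (pi / sqrt (exp s * exp s + 2 * u * exp t * exp s + exp (2 * t)))"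
      unfolding Q_def disc[symmetric] using disc_pos[of s] unfolding disc[symmetric]
      by (intro nn_integral_inverse_quadratic) (auto intro: add_pos_pos)
    finally show "(\<integral>\<^sup>+b. ennreal (exp (s / 2) / Q b s) \<partial>lborel) = ennreal (pi * (exp (s / 2) / sqrt (exp s * exp s + 2 * u * exp t * exp s + exp (2 * t))))"
      by (simp add: ennreal_mult'[symmetric] mult_ac)
  qed
  \<comment> \<open>Shifting \<open>s\<close> by \<open>t\<close> makes the two outer terms of the
    discriminant symmetric; it then factors as
    \<open>exp (2 * t + r) * (2 * (u + cosh r))\<close>.\<close>
  also have "\<dots> = (\<integral>\<^sup>+r. ennreal (pi * (exp ((t + 1 * r) / 2) / sqrt (exp (t + 1 * r) * exp (t + 1 * r) + 2 * u * exp t * exp (t + 1 * r) + exp (2 * t)))) \<partial>lborel)"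
    by (subst nn_integral_real_affine[where c = 1 and t = t]) simp_all
  also have "\<dots> = (\<integral>\<^sup>+r. ennreal (pi * exp (- t / 2) / sqrt 2) * ennreal (1 / sqrt (u + cosh r)) \<partial>lborel)"
  proof (rule nn_integral_cong)
    fix r :: real
    have "exp (t + 1 * r) * exp (t + 1 * r) + 2 * u * exp t * exp (t + 1 * r) + exp (2 * t) = (exp (t + r / 2))\<^sup>2 * (2 * (u + cosh r))"
    proof -
      have "(exp (t + r / 2))\<^sup>2 = exp (2 * t + r)" by (simp add: exp_double[symmetric])
      then have "(exp (t + r / 2))\<^sup>2 * (2 * (u + cosh r)) = exp (2 * t + r) * (2 * u) + exp (2 * t + r) * (2 * cosh r)"
        by (simp add: algebra_simps)
      also have "2 * cosh r = exp r + exp (- r)" by (simp add: cosh_field_def)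
      also have "exp (2 * t + r) * (2 * u) + exp (2 * t + r) * (exp r + exp (- r))
          = exp (t + r) * exp (t + r) + 2 * u * exp t * exp (t + r) + exp (2 * t)"
        by (simp add: distrib_left mult_exp_exp mult.assoc mult.left_commute[of u])
      finally show ?thesis by simp
    qed
    then have "sqrt (exp (t + 1 * r) * exp (t + 1 * r) + 2 * u * exp t * exp (t + 1 * r) + exp (2 * t)) = exp (t + r / 2) * (sqrt 2 * sqrt (u + cosh r))"
      by (simp only: real_sqrt_mult real_sqrt_abs abs_exp_cancel)
    moreover have "exp ((t + 1 * r) / 2) = exp (- t / 2) * exp (t + r / 2)"
      by (simp add: exp_add[symmetric] field_simps)
    ultimately have "pi * (exp ((t + 1 * r) / 2) / sqrt (exp (t + 1 * r) * exp (t + 1 * r) + 2 * u * exp t * exp (t + 1 * r) + exp (2 * t)))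
       = pi * exp (- t / 2) / sqrt 2 * (1 / sqrt (u + cosh r))"
      by simp
    then show "ennreal (pi * (exp ((t + 1 * r) / 2) / sqrt (exp (t + 1 * r) * exp (t + 1 * r) + 2 * u * exp t * exp (t + 1 * r) + exp (2 * t))))
       = ennreal (pi * exp (- t / 2) / sqrt 2) * ennreal (1 / sqrt (u + cosh r))"
      by (simp add: ennreal_mult'[symmetric])
  qed
  also have "\<dots> = ennreal (pi * exp (- t / 2) / sqrt 2) * ennreal (legFr u)"
    by (subst nn_integral_cmult, measurable, subst legFr_nn[OF u]) simp
  also have "\<dots> = ennreal pi * ennreal (exp (- t / 2) / sqrt 2 * legFr u)"
    using legFr_nonneg[OF u] by (simp add: ennreal_mult'[symmetric])
  finally show ?thesis
    by (subst (asm) ennreal_mult_cancel_left) (auto simp: u_def)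
qed

text \<open>Translations and dilations of the half-plane already force the power of
  \<open>\<bar>b - b'\<bar>\<close>. For the constant, the root is again written as an integral over
  \<open>s\<close> and \<open>x\<close> is integrated out; a shift of \<open>t\<close> then
  separates \<open>s\<close> from \<open>t\<close>, and each of the two remaining integrals is a
  multiple of \<open>legFr 0\<close>.\<close>

lemma inverse_sqrt_plane_integral:
  fixes b b' :: real
  assumes "b \<noteq> b'"
  shows "(\<integral>\<^sup>+t. (\<integral>\<^sup>+x. ennreal (exp (t / 2) / sqrt (((x - b)\<^sup>2 + exp (2 * t)) * ((x - b')\<^sup>2 + exp (2 * t)))) \<partial>lborel) \<partial>lborel)
    = ennreal ((legFr 0)\<^sup>2 / sqrt \<bar>b - b'\<bar>)"
proof -
  define d where "d = \<bar>b - b'\<bar>"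
  have d: "0 < d" using assms by (simp add: d_def)
  define Q where "Q x t s = (1 + exp s) * x\<^sup>2 - 2 * (b + exp s * b') * x + (b\<^sup>2 + exp s * b'\<^sup>2 + (1 + exp s) * exp (2 * t))" for x t s
  have Q: "(x - b)\<^sup>2 + exp (2 * t) + exp s * ((x - b')\<^sup>2 + exp (2 * t)) = Q x t s" for x t s
    by (simp add: Q_def power2_eq_square algebra_simps)
  have disc: "(1 + exp s) * (b\<^sup>2 + exp s * b'\<^sup>2 + (1 + exp s) * exp (2 * t)) - (b + exp s * b')\<^sup>2
     = exp s * d\<^sup>2 + (1 + exp s)\<^sup>2 * exp (2 * t)" for s t
    unfolding d_def by (simp add: power2_eq_square algebra_simps)
  have disc_pos: "0 < exp s * d\<^sup>2 + (1 + exp s)\<^sup>2 * exp (2 * t)" for s t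
    by (intro add_nonneg_pos) (auto intro!: mult_pos_pos zero_less_power add_pos_pos)
  define L where "L = ennreal (legFr 0)"
  have Lnn: "L = (\<integral>\<^sup>+t. ennreal (1 / sqrt (cosh t)) \<partial>lborel)" using legFr_nn(1)[of 0] by (simp add: L_def)
  have inner: "(\<integral>\<^sup>+x. ennreal (exp (t / 2) / sqrt (((x - b)\<^sup>2 + exp (2 * t)) * ((x - b')\<^sup>2 + exp (2 * t)))) \<partial>lborel)
     = (\<integral>\<^sup>+s. ennreal (exp (t / 2) * exp (s / 2) / sqrt (exp s * d\<^sup>2 + (1 + exp s)\<^sup>2 * exp (2 * t))) \<partial>lborel)" for t
  proof -
    have "ennreal pi * (\<integral>\<^sup>+x. ennreal (exp (t / 2) / sqrt (((x - b)\<^sup>2 + exp (2 * t)) * ((x - b')\<^sup>2 + exp (2 * t)))) \<partial>lborel)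
      = (\<integral>\<^sup>+x. ennreal (exp (t / 2)) * (\<integral>\<^sup>+s. ennreal (exp (s / 2) / Q x t s) \<partial>lborel) \<partial>lborel)"
    proof (subst nn_integral_cmult[symmetric], measurable, rule nn_integral_cong)
      fix x :: real
      have "0 < (x - b)\<^sup>2 + exp (2 * t)" "0 < (x - b')\<^sup>2 + exp (2 * t)"
        by (auto intro!: add_nonneg_pos)
      from nn_integral_inverse_sqrt[OF this]
      show "ennreal pi * ennreal (exp (t / 2) / sqrt (((x - b)\<^sup>2 + exp (2 * t)) * ((x - b')\<^sup>2 + exp (2 * t))))
          = ennreal (exp (t / 2)) * (\<integral>\<^sup>+s. ennreal (exp (s / 2) / Q x t s) \<partial>lborel)"
        unfolding Q by (simp add: ennreal_mult'[symmetric] mult_ac)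
    qed
    also have "\<dots> = ennreal (exp (t / 2)) * (\<integral>\<^sup>+x. (\<integral>\<^sup>+s. ennreal (exp (s / 2) / Q x t s) \<partial>lborel) \<partial>lborel)"
      unfolding Q_def by (rule nn_integral_cmult) measurable
    also have "(\<integral>\<^sup>+x. (\<integral>\<^sup>+s. ennreal (exp (s / 2) / Q x t s) \<partial>lborel) \<partial>lborel)
        = (\<integral>\<^sup>+s. (\<integral>\<^sup>+x. ennreal (exp (s / 2) / Q x t s) \<partial>lborel) \<partial>lborel)"
      unfolding Q_def by (rule lborel_pair.Fubini') measurable
    also have "\<dots> = (\<integral>\<^sup>+s. ennreal pi * ennreal (exp (s / 2) / sqrt (exp s * d\<^sup>2 + (1 + exp s)\<^sup>2 * exp (2 * t))) \<partial>lborel)"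
    proof (rule nn_integral_cong)
      fix s :: real
      have "(\<integral>\<^sup>+x. ennreal (exp (s / 2) / Q x t s) \<partial>lborel) = (\<integral>\<^sup>+x. ennreal (exp (s / 2)) * ennreal (1 / Q x t s) \<partial>lborel)"
        by (intro nn_integral_cong) (simp add: ennreal_mult'[symmetric])
      also have "\<dots> = ennreal (exp (s / 2)) * (\<integral>\<^sup>+x. ennreal (1 / Q x t s) \<partial>lborel)"
        unfolding Q_def by (rule nn_integral_cmult) measurable
      also have "(\<integral>\<^sup>+x. ennreal (1 / Q x t s) \<partial>lborel) = ennreal (pi / sqrt (exp s * d\<^sup>2 + (1 + exp s)\<^sup>2 * exp (2 * t)))"
        unfolding Q_def disc[symmetric] using disc_pos[of s t] unfolding disc[symmetric]
        by (intro nn_integral_inverse_quadratic) (auto intro: add_pos_pos)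
      finally show "(\<integral>\<^sup>+x. ennreal (exp (s / 2) / Q x t s) \<partial>lborel) = ennreal pi * ennreal (exp (s / 2) / sqrt (exp s * d\<^sup>2 + (1 + exp s)\<^sup>2 * exp (2 * t)))"
        by (simp add: ennreal_mult'[symmetric] mult_ac)
    qed
    also have "\<dots> = ennreal pi * (\<integral>\<^sup>+s. ennreal (exp (s / 2) / sqrt (exp s * d\<^sup>2 + (1 + exp s)\<^sup>2 * exp (2 * t))) \<partial>lborel)"
      by (rule nn_integral_cmult) measurable
    also have "ennreal (exp (t / 2)) * \<dots> = ennreal pi * (ennreal (exp (t / 2)) * (\<integral>\<^sup>+s. ennreal (exp (s / 2) / sqrt (exp s * d\<^sup>2 + (1 + exp s)\<^sup>2 * exp (2 * t))) \<partial>lborel))"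
      by (simp only: mult_ac)
    also have "ennreal (exp (t / 2)) * (\<integral>\<^sup>+s. ennreal (exp (s / 2) / sqrt (exp s * d\<^sup>2 + (1 + exp s)\<^sup>2 * exp (2 * t))) \<partial>lborel)
       = (\<integral>\<^sup>+s. ennreal (exp (t / 2) * exp (s / 2) / sqrt (exp s * d\<^sup>2 + (1 + exp s)\<^sup>2 * exp (2 * t))) \<partial>lborel)"
      by (subst nn_integral_cmult[symmetric], measurable, intro nn_integral_cong) (simp add: ennreal_mult'[symmetric])
    finally show ?thesis by (subst (asm) ennreal_mult_cancel_left) auto
  qed
  have "(\<integral>\<^sup>+t. (\<integral>\<^sup>+x. ennreal (exp (t / 2) / sqrt (((x - b)\<^sup>2 + exp (2 * t)) * ((x - b')\<^sup>2 + exp (2 * t)))) \<partial>lborel) \<partial>lborel)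
     = (\<integral>\<^sup>+s. (\<integral>\<^sup>+t. ennreal (exp (t / 2) * exp (s / 2) / sqrt (exp s * d\<^sup>2 + (1 + exp s)\<^sup>2 * exp (2 * t))) \<partial>lborel) \<partial>lborel)"
    unfolding inner by (rule lborel_pair.Fubini') measurable
  also have "\<dots> = (\<integral>\<^sup>+s. ennreal (1 / sqrt d * (1 / (2 * sqrt (cosh (s / 2))))) * L \<partial>lborel)"
  proof (rule nn_integral_cong)
    fix s :: real
    \<comment> \<open>The point where the two terms under the root balance:
      \<open>(1 + exp s)\<^sup>2 * exp (2 * a) = exp s * d\<^sup>2\<close>. Measured from there, the
      root is a function of \<open>s\<close> times a function of \<open>r\<close>.\<close>
    define a where "a = ln (exp (s / 2) * d / (1 + exp s))"
    have ps: "0 < 1 + exp s" by (intro add_pos_pos) auto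
    have ea: "exp a = exp (s / 2) * d / (1 + exp s)" using d ps by (simp add: a_def)
    have e2: "exp (2 * (a + 1 * r)) = (exp (s / 2) * d / (1 + exp s))\<^sup>2 * exp (2 * r)" for r
      unfolding ea[symmetric] by (simp add: power2_eq_square exp_add[symmetric] algebra_simps mult_exp_exp)
    have root: "sqrt (exp s * d\<^sup>2 + (1 + exp s)\<^sup>2 * exp (2 * (a + 1 * r))) = exp (s / 2) * d * (exp (r / 2) * sqrt (2 * cosh r))" for r
    proof -
      have "exp s * d\<^sup>2 + (1 + exp s)\<^sup>2 * exp (2 * (a + 1 * r)) = exp s * d\<^sup>2 + (exp (s / 2) * d)\<^sup>2 * exp (2 * r)"
        unfolding e2 using ps by (simp add: power_divide)
      also have "(exp (s / 2) * d)\<^sup>2 = exp s * d\<^sup>2"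
        by (simp add: power_mult_distrib exp_double[symmetric])
      also have "exp s * d\<^sup>2 + exp s * d\<^sup>2 * exp (2 * r) = (exp (s / 2) * d * exp (r / 2))\<^sup>2 * (2 * cosh r)"
      proof -
        have "2 * cosh r = exp r + exp (- r)" by (simp add: cosh_field_def)
        then have "exp r * (2 * cosh r) = 1 + exp (2 * r)"
          by (simp only: distrib_left mult_exp_exp) simp
        moreover have "(exp (s / 2) * d * exp (r / 2))\<^sup>2 = exp s * d\<^sup>2 * exp r"
          by (simp add: power_mult_distrib exp_double[symmetric])
        ultimately show ?thesis by (simp only: mult.assoc) (simp add: algebra_simps)
      qed
      finally show ?thesis using d by (simp add: real_sqrt_mult)
    qed
    have ea2: "exp ((a + 1 * r) / 2) = exp (s / 4) * sqrt d / sqrt (1 + exp s) * exp (r / 2)" for r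
    proof -
      have "exp (a / 2) = sqrt (exp a)" by (simp add: sqrt_exp)
      also have "\<dots> = sqrt (exp (s / 2)) * sqrt d / sqrt (1 + exp s)" unfolding ea by (simp add: real_sqrt_mult real_sqrt_divide)
      also have "sqrt (exp (s / 2)) = exp (s / 4)" by (simp add: sqrt_exp)
      finally show ?thesis by (simp add: add_divide_distrib exp_add)
    qed
    have s1: "sqrt (1 + exp s) = exp (s / 4) * (sqrt 2 * sqrt (cosh (s / 2)))"
    proof -
      have "1 + exp s = exp (s / 2) * (2 * cosh (s / 2))"
      proof -
        have "2 * cosh (s / 2) = exp (s / 2) + exp (- (s / 2))" by (simp add: cosh_field_def)
        then show ?thesis by (simp only: distrib_left mult_exp_exp) simp
      qed
      moreover have "sqrt (exp (s / 2)) = exp (s / 4)" by (simp add: sqrt_exp)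
      ultimately show ?thesis by (simp add: real_sqrt_mult)
    qed
    have "(\<integral>\<^sup>+t. ennreal (exp (t / 2) * exp (s / 2) / sqrt (exp s * d\<^sup>2 + (1 + exp s)\<^sup>2 * exp (2 * t))) \<partial>lborel)
       = (\<integral>\<^sup>+r. ennreal (exp ((a + 1 * r) / 2) * exp (s / 2) / sqrt (exp s * d\<^sup>2 + (1 + exp s)\<^sup>2 * exp (2 * (a + 1 * r)))) \<partial>lborel)"
      by (subst nn_integral_real_affine[where c = 1 and t = a]) simp_all
    also have "\<dots> = (\<integral>\<^sup>+r. ennreal (1 / sqrt d * (1 / (2 * sqrt (cosh (s / 2))))) * ennreal (1 / sqrt (cosh r)) \<partial>lborel)"
    proof (rule nn_integral_cong)
      fix r :: real
      have "d = sqrt d * sqrt d" using d by simp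
      then have "exp ((a + 1 * r) / 2) * exp (s / 2) / sqrt (exp s * d\<^sup>2 + (1 + exp s)\<^sup>2 * exp (2 * (a + 1 * r)))
         = 1 / sqrt d * (1 / (2 * sqrt (cosh (s / 2)))) * (1 / sqrt (cosh r))"
        unfolding root ea2 s1 using d by (simp add: real_sqrt_mult field_simps)
      then show "ennreal (exp ((a + 1 * r) / 2) * exp (s / 2) / sqrt (exp s * d\<^sup>2 + (1 + exp s)\<^sup>2 * exp (2 * (a + 1 * r))))
         = ennreal (1 / sqrt d * (1 / (2 * sqrt (cosh (s / 2))))) * ennreal (1 / sqrt (cosh r))"
        using d by (simp add: ennreal_mult'[symmetric])
    qed
    also have "\<dots> = ennreal (1 / sqrt d * (1 / (2 * sqrt (cosh (s / 2))))) * L"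
      unfolding Lnn by (rule nn_integral_cmult) measurable
    finally show "(\<integral>\<^sup>+t. ennreal (exp (t / 2) * exp (s / 2) / sqrt (exp s * d\<^sup>2 + (1 + exp s)\<^sup>2 * exp (2 * t))) \<partial>lborel)
       = ennreal (1 / sqrt d * (1 / (2 * sqrt (cosh (s / 2))))) * L" .
  qed
  also have "\<dots> = (\<integral>\<^sup>+s. ennreal (1 / sqrt d * (1 / (2 * sqrt (cosh (s / 2))))) \<partial>lborel) * L"
    by (rule nn_integral_multc) measurable
  also have "(\<integral>\<^sup>+s. ennreal (1 / sqrt d * (1 / (2 * sqrt (cosh (s / 2))))) \<partial>lborel)
      = ennreal 2 * (\<integral>\<^sup>+s. ennreal (1 / sqrt d * (1 / (2 * sqrt (cosh ((0 + 2 * s) / 2))))) \<partial>lborel)"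
    by (subst nn_integral_real_affine[where c = 2 and t = 0]) simp_all
  also have "(\<integral>\<^sup>+s. ennreal (1 / sqrt d * (1 / (2 * sqrt (cosh ((0 + 2 * s) / 2))))) \<partial>lborel)
      = (\<integral>\<^sup>+s. ennreal (1 / (2 * sqrt d)) * ennreal (1 / sqrt (cosh s)) \<partial>lborel)"
    using d by (intro nn_integral_cong) (simp add: ennreal_mult'[symmetric])
  also have "\<dots> = ennreal (1 / (2 * sqrt d)) * L"
    unfolding Lnn by (rule nn_integral_cmult) measurable
  also have "ennreal 2 * (ennreal (1 / (2 * sqrt d)) * L) * L = ennreal ((legFr 0)\<^sup>2 / sqrt d)"
    unfolding L_def using d legFr_nonneg[of 0]
    by (simp add: ennreal_mult'[symmetric] power2_eq_square del: ennreal_numeral)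
  finally show ?thesis by (simp add: d_def)
qed

text \<open>At \<open>y = 0\<close> the two terms of \<open>legF_imaginary\<close> agree up to
  conjugate phases adding up to \<open>2 * cos (pi / 4) = sqrt 2\<close>, so
  \<open>legFr 0 = sqrt 2 * legR (1/2) 0\<close>. By symmetry the integral here is twice
  \<open>legR (1/2) 0\<close>.\<close>

lemma nn_integral_inverse_sqrt_sinh:
  "(\<integral>\<^sup>+t. ennreal (1 / sqrt \<bar>sinh t\<bar>) \<partial>lborel) = ennreal (sqrt 2 * legFr 0)"
proof -
  have p: "max 0 (sinh t) powr (- (1 / 2)) = (if 0 < sinh t then 1 / sqrt \<bar>sinh t\<bar> else 0)" for t :: real
    by (auto simp: powr_minus_half max_def)
  have "legF (1/2) (\<i> * of_real 0) = of_real (legFr 0)"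
  proof -
    have "(\<i> * of_real 0 + complex_of_real (cosh t)) powr (- of_real (1/2)) = of_real (1 / sqrt (0 + cosh t))" for t
    proof -
      have "(\<i> * of_real 0 + complex_of_real (cosh t)) powr (- of_real (1/2)) = complex_of_real (cosh t) powr of_real (- (1/2))"
        by simp
      also have "\<dots> = of_real (cosh t powr (- (1/2)))" by (rule powr_of_real) simp
      finally show ?thesis by (simp add: powr_minus_half)
    qed
    then show ?thesis unfolding legF_def legFr_def by (simp only: integral_complex_of_real)
  qed
  moreover have "legF (1/2) (\<i> * of_real 0) = of_real (sqrt 2 * legR (1/2) 0)"
    by (subst legF_imaginary) (simp_all add: complex_eq_iff cos_45 sin_45)
  ultimately have L: "legFr 0 = sqrt 2 * legR (1/2) 0"
    by (simp only: of_real_eq_iff)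
  have R: "(\<integral>\<^sup>+t. ennreal (if 0 < sinh t then 1 / sqrt \<bar>sinh t\<bar> else 0) \<partial>lborel) = ennreal (legR (1/2) 0)"
    using legR_nn[of "1/2" 0] unfolding p[symmetric] by simp
  have "(\<integral>\<^sup>+t. ennreal (1 / sqrt \<bar>sinh t\<bar>) \<partial>lborel)
     = (\<integral>\<^sup>+t. ennreal (if 0 < sinh t then 1 / sqrt \<bar>sinh t\<bar> else 0) + ennreal (if 0 < sinh (0 + (-1) * t) then 1 / sqrt \<bar>sinh (0 + (-1) * t)\<bar> else 0) \<partial>lborel)"
    by (intro nn_integral_cong) (auto simp: not_less)
  also have "\<dots> = (\<integral>\<^sup>+t. ennreal (if 0 < sinh t then 1 / sqrt \<bar>sinh t\<bar> else 0) \<partial>lborel)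
     + (\<integral>\<^sup>+t. ennreal (if 0 < sinh (0 + (-1) * t) then 1 / sqrt \<bar>sinh (0 + (-1) * t)\<bar> else 0) \<partial>lborel)"
    by (rule nn_integral_add) measurable
  also have "(\<integral>\<^sup>+t. ennreal (if 0 < sinh (0 + (-1) * t) then 1 / sqrt \<bar>sinh (0 + (-1) * t)\<bar> else 0) \<partial>lborel)
     = (\<integral>\<^sup>+t. ennreal (if 0 < sinh t then 1 / sqrt \<bar>sinh t\<bar> else 0) \<partial>lborel)"
    by (subst (2) nn_integral_real_affine[where c = "-1" and t = 0]) simp_all
  finally show ?thesis
    unfolding R L using legR_nonneg[of "1/2" 0] by (simp add: ennreal_plus[symmetric] del: ennreal_plus)
qed

text \<open>The substitutions \<open>b = sinh t\<close>, \<open>b' = sinh t'\<close> absorb the two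
  weights. With \<open>t = t' + 2 * q\<close> the difference is
  \<open>2 * cosh (t' + q) * sinh q\<close>, so after exchanging the order the integral splits into
  one over \<open>cosh\<close> and one over \<open>sinh\<close>.\<close>

lemma nn_integral_inverse_sqrt_difference:
  "(\<integral>\<^sup>+b. (\<integral>\<^sup>+b'. ennreal (1 / sqrt (1 + b\<^sup>2) * (1 / sqrt (1 + b'\<^sup>2)) * (1 / sqrt \<bar>b - b'\<bar>)) \<partial>lborel) \<partial>lborel)
    = ennreal (2 * (legFr 0)\<^sup>2)"
proof -
  have img: "sinh ` UNIV = (UNIV :: real set)"
    by (metis sinh_arsinh_real surjI)
  have sub: "(\<integral>\<^sup>+b. ennreal (1 / sqrt (1 + b\<^sup>2) * f b) \<partial>lborel) = (\<integral>\<^sup>+t. ennreal (f (sinh t)) \<partial>lborel)"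
    if [measurable]: "f \<in> borel_measurable borel" and nn: "\<And>b. 0 \<le> f b" for f :: "real \<Rightarrow> real"
  proof -
    have "(\<integral>\<^sup>+b. ennreal (1 / sqrt (1 + b\<^sup>2) * f b) \<partial>lborel) = (\<integral>\<^sup>+b\<in>sinh ` UNIV. ennreal (1 / sqrt (1 + b\<^sup>2) * f b) \<partial>lborel)"
      unfolding img by simp
    also have "\<dots> = (\<integral>\<^sup>+t\<in>UNIV. ennreal (\<bar>cosh t\<bar> * (1 / sqrt (1 + (sinh t)\<^sup>2) * f (sinh t))) \<partial>lborel)"
    proof (rule nn_integral_change_of_variables)
      show "(sinh has_real_derivative cosh x) (at x)" for x :: real by (auto intro!: derivative_eq_intros)
      show "inj (sinh :: real \<Rightarrow> real)" by (metis arsinh_sinh_real injI)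
    qed (auto simp: img intro!: divide_nonneg_nonneg nn)
    also have "\<dots> = (\<integral>\<^sup>+t. ennreal (f (sinh t)) \<partial>lborel)"
    proof (rule nn_integral_cong)
      fix t :: real
      have "sqrt (1 + (sinh t)\<^sup>2) = cosh t" using cosh_square_eq[of t] by (metis add.commute cosh_real_nonneg real_sqrt_unique)
      then show "ennreal (\<bar>cosh t\<bar> * (1 / sqrt (1 + (sinh t)\<^sup>2) * f (sinh t))) * indicator UNIV t = ennreal (f (sinh t))"
        by simp
    qed
    finally show ?thesis .
  qed
  have "(\<integral>\<^sup>+b. (\<integral>\<^sup>+b'. ennreal (1 / sqrt (1 + b\<^sup>2) * (1 / sqrt (1 + b'\<^sup>2)) * (1 / sqrt \<bar>b - b'\<bar>)) \<partial>lborel) \<partial>lborel)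
     = (\<integral>\<^sup>+b. (\<integral>\<^sup>+t'. ennreal (1 / sqrt (1 + b\<^sup>2) * (1 / sqrt \<bar>b - sinh t'\<bar>)) \<partial>lborel) \<partial>lborel)"
  proof (rule nn_integral_cong)
    fix b :: real
    show "(\<integral>\<^sup>+b'. ennreal (1 / sqrt (1 + b\<^sup>2) * (1 / sqrt (1 + b'\<^sup>2)) * (1 / sqrt \<bar>b - b'\<bar>)) \<partial>lborel)
       = (\<integral>\<^sup>+t'. ennreal (1 / sqrt (1 + b\<^sup>2) * (1 / sqrt \<bar>b - sinh t'\<bar>)) \<partial>lborel)"
      using sub[of "\<lambda>b'. 1 / sqrt (1 + b\<^sup>2) * (1 / sqrt \<bar>b - b'\<bar>)"] by (simp add: mult_ac)
  qed
  also have "\<dots> = (\<integral>\<^sup>+t'. (\<integral>\<^sup>+b. ennreal (1 / sqrt (1 + b\<^sup>2) * (1 / sqrt \<bar>b - sinh t'\<bar>)) \<partial>lborel) \<partial>lborel)"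
    by (rule lborel_pair.Fubini') measurable
  also have "\<dots> = (\<integral>\<^sup>+t'. (\<integral>\<^sup>+t. ennreal (1 / sqrt \<bar>sinh t - sinh t'\<bar>) \<partial>lborel) \<partial>lborel)"
    by (intro nn_integral_cong sub) auto
  also have "\<dots> = (\<integral>\<^sup>+t'. (\<integral>\<^sup>+q. ennreal (sqrt 2 * (1 / sqrt (cosh (t' + q)) * (1 / sqrt \<bar>sinh q\<bar>))) \<partial>lborel) \<partial>lborel)"
  proof (rule nn_integral_cong)
    fix t' :: real
    have "(\<integral>\<^sup>+t. ennreal (1 / sqrt \<bar>sinh t - sinh t'\<bar>) \<partial>lborel) = ennreal 2 * (\<integral>\<^sup>+q. ennreal (1 / sqrt \<bar>sinh (t' + 2 * q) - sinh t'\<bar>) \<partial>lborel)"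
      by (subst nn_integral_real_affine[where c = 2 and t = t']) simp_all
    also have "\<dots> = (\<integral>\<^sup>+q. ennreal 2 * ennreal (1 / sqrt \<bar>sinh (t' + 2 * q) - sinh t'\<bar>) \<partial>lborel)"
      by (rule nn_integral_cmult[symmetric]) measurable
    also have "\<dots> = (\<integral>\<^sup>+q. ennreal (sqrt 2 * (1 / sqrt (cosh (t' + q)) * (1 / sqrt \<bar>sinh q\<bar>))) \<partial>lborel)"
    proof (rule nn_integral_cong)
      fix q :: real
      have "sinh (t' + 2 * q) = sinh ((t' + q) + q)" "sinh t' = sinh ((t' + q) - q)" by (simp_all add: algebra_simps)
      then have "sinh (t' + 2 * q) - sinh t' = 2 * cosh (t' + q) * sinh q"
        by (simp only: sinh_add[of "t' + q" q] sinh_diff[of "t' + q" q])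
      then have "sqrt \<bar>sinh (t' + 2 * q) - sinh t'\<bar> = sqrt 2 * (sqrt (cosh (t' + q)) * sqrt \<bar>sinh q\<bar>)"
        by (simp add: abs_mult real_sqrt_mult)
      moreover have "2 * (1 / (sqrt 2 * X)) = sqrt 2 * (1 / X)" for X :: real
        by (cases "X = 0") (simp_all add: field_simps)
      ultimately have "2 * (1 / sqrt \<bar>sinh (t' + 2 * q) - sinh t'\<bar>) = sqrt 2 * (1 / sqrt (cosh (t' + q)) * (1 / sqrt \<bar>sinh q\<bar>))"
        by (simp only:) simp
      then show "ennreal 2 * ennreal (1 / sqrt \<bar>sinh (t' + 2 * q) - sinh t'\<bar>) = ennreal (sqrt 2 * (1 / sqrt (cosh (t' + q)) * (1 / sqrt \<bar>sinh q\<bar>)))"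
        by (simp only: ennreal_mult'[symmetric] zero_le_numeral)
    qed
    finally show "(\<integral>\<^sup>+t. ennreal (1 / sqrt \<bar>sinh t - sinh t'\<bar>) \<partial>lborel) = (\<integral>\<^sup>+q. ennreal (sqrt 2 * (1 / sqrt (cosh (t' + q)) * (1 / sqrt \<bar>sinh q\<bar>))) \<partial>lborel)" .
  qed
  also have "\<dots> = (\<integral>\<^sup>+q. (\<integral>\<^sup>+t'. ennreal (sqrt 2 * (1 / sqrt (cosh (t' + q)) * (1 / sqrt \<bar>sinh q\<bar>))) \<partial>lborel) \<partial>lborel)"
    by (rule lborel_pair.Fubini') measurable
  also have "\<dots> = (\<integral>\<^sup>+q. ennreal (sqrt 2 * legFr 0) * ennreal (1 / sqrt \<bar>sinh q\<bar>) \<partial>lborel)"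
  proof (rule nn_integral_cong)
    fix q :: real
    have "(\<integral>\<^sup>+t'. ennreal (sqrt 2 * (1 / sqrt (cosh (t' + q)) * (1 / sqrt \<bar>sinh q\<bar>))) \<partial>lborel)
       = (\<integral>\<^sup>+t'. ennreal (sqrt 2 * (1 / sqrt \<bar>sinh q\<bar>)) * ennreal (1 / sqrt (cosh (q + 1 * t'))) \<partial>lborel)"
      by (intro nn_integral_cong) (simp add: ennreal_mult'[symmetric] mult_ac add.commute)
    also have "\<dots> = ennreal (sqrt 2 * (1 / sqrt \<bar>sinh q\<bar>)) * (\<integral>\<^sup>+t'. ennreal (1 / sqrt (cosh (q + 1 * t'))) \<partial>lborel)"
      by (rule nn_integral_cmult) measurable
    also have "(\<integral>\<^sup>+t'. ennreal (1 / sqrt (cosh (q + 1 * t'))) \<partial>lborel) = ennreal (legFr 0)"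
      using nn_integral_real_affine[of "\<lambda>t. ennreal (1 / sqrt (cosh t))" 1 q] legFr_nn(1)[of 0] by simp
    finally show "(\<integral>\<^sup>+t'. ennreal (sqrt 2 * (1 / sqrt (cosh (t' + q)) * (1 / sqrt \<bar>sinh q\<bar>))) \<partial>lborel) = ennreal (sqrt 2 * legFr 0) * ennreal (1 / sqrt \<bar>sinh q\<bar>)"
      using legFr_nonneg[of 0] by (simp add: ennreal_mult'[symmetric] mult_ac)
  qed
  also have "\<dots> = ennreal (sqrt 2 * legFr 0) * ennreal (sqrt 2 * legFr 0)"
    by (subst nn_integral_cmult, measurable, subst nn_integral_inverse_sqrt_sinh) simp
  also have "\<dots> = ennreal (2 * (legFr 0)\<^sup>2)"
    using legFr_nonneg[of 0] by (simp add: ennreal_mult'[symmetric] power2_eq_square)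
  finally show ?thesis .
qed

section \<open>Evaluation of the double integral\<close>

lemma borel_measurable_legFr [measurable]: "legFr \<in> borel_measurable borel"
  unfolding legFr_def[abs_def] by measurable

text \<open>Writing both factors \<open>legFr u\<close> as integrals over boundary points
  \<open>b\<close> and \<open>b'\<close> makes this an integral over the half-plane and two boundary
  variables. Everything is nonnegative, so the point of the half-plane can be integrated out first;
  that leaves the kernel \<open>1 / sqrt \<bar>b - b'\<bar>\<close>, and each of the two stages
  gives a multiple of \<open>(legFr 0)\<^sup>2\<close>.\<close>

lemma legFr_double_integral:
  "(\<integral>\<^sup>+t. (\<integral>\<^sup>+u\<in>{cosh t<..}. ennreal ((legFr u)\<^sup>2 / sqrt (u - cosh t)) \<partial>lborel) \<partial>lborel)
    = ennreal (2 * sqrt 2 * (legFr 0) ^ 4)"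
proof -
  define \<Phi> where "\<Phi> x t = legFr (cosh t + x\<^sup>2 * exp (- t) / 2)" for x t
  have [measurable (raw)]: "(\<lambda>w. \<Phi> (g w) (h w)) \<in> borel_measurable M"
    if [measurable]: "g \<in> borel_measurable M" "h \<in> borel_measurable M"
    for g h :: "'z \<Rightarrow> real" and M :: "'z measure"
    unfolding \<Phi>_def by measurable
  have \<Phi>0: "0 \<le> \<Phi> x t" for x t unfolding \<Phi>_def by (intro legFr_nonneg) auto
  define k where "k b x t = 1 / sqrt (((x - b)\<^sup>2 + exp (2 * t)) * (1 + b\<^sup>2))" for b x t :: real
  have k0: "0 \<le> k b x t" for b x t by (simp add: k_def)
  have conv: "(\<integral>\<^sup>+b. ennreal (k b x t) \<partial>lborel) = ennreal (exp (- t / 2) / sqrt 2 * \<Phi> x t)" for x t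
    unfolding k_def \<Phi>_def by (rule inverse_sqrt_convolution)
  have [measurable (raw)]: "(\<lambda>w. k (f w) (g w) (h w)) \<in> borel_measurable M"
    if [measurable]: "f \<in> borel_measurable M" "g \<in> borel_measurable M" "h \<in> borel_measurable M"
    for f g h :: "'z \<Rightarrow> real" and M :: "'z measure"
    unfolding k_def by measurable
  have step1: "(\<integral>\<^sup>+u\<in>{cosh t<..}. ennreal ((legFr u)\<^sup>2 / sqrt (u - cosh t)) \<partial>lborel)
     = (\<integral>\<^sup>+x\<in>{0<..}. ennreal (sqrt 2 * exp (- t / 2) * (\<Phi> x t)\<^sup>2) \<partial>lborel)" for t
  proof -
    define g where "g x = cosh t + x\<^sup>2 * exp (- t) / 2" for x
    have img: "g ` {0<..} = {cosh t<..}"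
    proof (intro set_eqI iffI)
      fix u assume u: "u \<in> {cosh t<..}"
      then have "g (sqrt (2 * (u - cosh t) * exp t)) = u" "sqrt (2 * (u - cosh t) * exp t) \<in> {0<..}"
        by (auto simp: g_def exp_minus field_simps)
      then show "u \<in> g ` {0<..}" by (metis imageI)
    qed (auto simp: g_def)
    have "(\<integral>\<^sup>+u\<in>{cosh t<..}. ennreal ((legFr u)\<^sup>2 / sqrt (u - cosh t)) \<partial>lborel) = (\<integral>\<^sup>+u\<in>g ` {0<..}. ennreal ((legFr u)\<^sup>2 / sqrt (u - cosh t)) \<partial>lborel)"
      unfolding img ..
    also have "\<dots> = (\<integral>\<^sup>+x\<in>{0<..}. ennreal (\<bar>x * exp (- t)\<bar> * ((legFr (g x))\<^sup>2 / sqrt (g x - cosh t))) \<partial>lborel)"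
    proof (rule nn_integral_change_of_variables)
      show "(g has_real_derivative x * exp (- t)) (at x)" for x
        unfolding g_def by (auto intro!: derivative_eq_intros)
      show "inj_on g {0<..}" by (auto simp: g_def inj_on_def)
      show "0 \<le> (legFr y)\<^sup>2 / sqrt (y - cosh t)" if "y \<in> g ` {0<..}" for y
        using that unfolding img by auto
      show "g \<in> borel_measurable borel" unfolding g_def by measurable
    qed (simp_all add: img)
    also have "\<dots> = (\<integral>\<^sup>+x\<in>{0<..}. ennreal (sqrt 2 * exp (- t / 2) * (\<Phi> x t)\<^sup>2) \<partial>lborel)"
    proof (rule nn_integral_cong)
      fix x :: real
      have "\<bar>x * exp (- t)\<bar> * ((legFr (g x))\<^sup>2 / sqrt (g x - cosh t)) = sqrt 2 * exp (- t / 2) * (\<Phi> x t)\<^sup>2" if x: "0 < x"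
      proof -
        have "sqrt (g x - cosh t) = sqrt ((x * exp (- t / 2))\<^sup>2 / 2)"
          by (simp add: g_def power_mult_distrib exp_double[symmetric])
        also have "\<dots> = x * exp (- t / 2) / sqrt 2" using x by (simp add: real_sqrt_divide)
        finally have r: "sqrt (g x - cosh t) = x * exp (- t / 2) / sqrt 2" .
        have e: "\<bar>x * exp (- t)\<bar> = x * (exp (- t / 2) * exp (- t / 2))" using x by (simp add: mult_exp_exp)
        have "legFr (g x) = \<Phi> x t" by (simp add: \<Phi>_def g_def)
        then show ?thesis unfolding r e using x by (simp add: field_simps)
      qed
      then show "ennreal (\<bar>x * exp (- t)\<bar> * ((legFr (g x))\<^sup>2 / sqrt (g x - cosh t))) * indicator {0<..} x = ennreal (sqrt 2 * exp (- t / 2) * (\<Phi> x t)\<^sup>2) * indicator {0<..} x"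
        by (cases "0 < x") auto
    qed
    finally show ?thesis .
  qed
  \<comment> \<open>\<open>x\<close> and \<open>- x\<close> give the same \<open>u\<close>, so twice
    the half-line integral is an integral over all \<open>x\<close>, as the plane integral
    requires.\<close>
  have step2: "ennreal 2 * (\<integral>\<^sup>+x\<in>{0<..}. ennreal (sqrt 2 * exp (- t / 2) * (\<Phi> x t)\<^sup>2) \<partial>lborel)
     = (\<integral>\<^sup>+x. ennreal (sqrt 2 * exp (- t / 2) * (\<Phi> x t)\<^sup>2) \<partial>lborel)" for t
  proof -
    let ?G = "\<lambda>x. ennreal (sqrt 2 * exp (- t / 2) * (\<Phi> x t)\<^sup>2)"
    have even: "?G (0 + (-1) * x) = ?G x" for x by (simp add: \<Phi>_def)
    have "(\<integral>\<^sup>+x. ?G x \<partial>lborel) = (\<integral>\<^sup>+x. ?G x * indicator {0<..} x + ?G (0 + (-1) * x) * indicator {0<..} (0 + (-1) * x) \<partial>lborel)"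
    proof (rule nn_integral_cong_AE)
      have "AE x in lborel. x \<noteq> (0::real)" using AE_lborel_singleton by blast
      then show "AE x in lborel. ?G x = ?G x * indicator {0<..} x + ?G (0 + (-1) * x) * indicator {0<..} (0 + (-1) * x)"
        unfolding even by eventually_elim (auto simp: indicator_def)
    qed
    also have "\<dots> = (\<integral>\<^sup>+x. ?G x * indicator {0<..} x \<partial>lborel) + (\<integral>\<^sup>+x. ?G (0 + (-1) * x) * indicator {0<..} (0 + (-1) * x) \<partial>lborel)"
      by (rule nn_integral_add) measurable
    also have "(\<integral>\<^sup>+x. ?G (0 + (-1) * x) * indicator {0<..} (0 + (-1) * x) \<partial>lborel) = (\<integral>\<^sup>+x. ?G x * indicator {0<..} x \<partial>lborel)"
      by (subst (2) nn_integral_real_affine[where c = "-1" and t = 0]) simp_all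
    finally show ?thesis by (simp add: mult_2[symmetric] ennreal_numeral[symmetric] del: ennreal_numeral)
  qed
  \<comment> \<open>Two uses of \<open>conv\<close> give
    \<open>exp (- t) / 2 * (\<Phi> x t)\<^sup>2\<close>; the factor \<open>exp (t / 2)\<close> and
    the constant \<open>2 * sqrt 2\<close> restore the left side.\<close>
  have sq: "ennreal (sqrt 2 * exp (- t / 2) * (\<Phi> x t)\<^sup>2) = ennreal (2 * sqrt 2) * (\<integral>\<^sup>+b. (\<integral>\<^sup>+b'. ennreal (exp (t / 2) * (k b x t * k b' x t)) \<partial>lborel) \<partial>lborel)" for x t
  proof -
    have "(\<integral>\<^sup>+b. (\<integral>\<^sup>+b'. ennreal (exp (t / 2) * (k b x t * k b' x t)) \<partial>lborel) \<partial>lborel)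
       = (\<integral>\<^sup>+b. ennreal (exp (t / 2) * k b x t) * ennreal (exp (- t / 2) / sqrt 2 * \<Phi> x t) \<partial>lborel)"
    proof (rule nn_integral_cong)
      fix b
      have "(\<integral>\<^sup>+b'. ennreal (exp (t / 2) * (k b x t * k b' x t)) \<partial>lborel) = (\<integral>\<^sup>+b'. ennreal (exp (t / 2) * k b x t) * ennreal (k b' x t) \<partial>lborel)"
        using k0 by (intro nn_integral_cong) (simp add: ennreal_mult'[symmetric] mult_ac)
      also have "\<dots> = ennreal (exp (t / 2) * k b x t) * (\<integral>\<^sup>+b'. ennreal (k b' x t) \<partial>lborel)"
        by (rule nn_integral_cmult) measurable
      finally show "(\<integral>\<^sup>+b'. ennreal (exp (t / 2) * (k b x t * k b' x t)) \<partial>lborel) = ennreal (exp (t / 2) * k b x t) * ennreal (exp (- t / 2) / sqrt 2 * \<Phi> x t)"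
        unfolding conv .
    qed
    also have "\<dots> = (\<integral>\<^sup>+b. ennreal (exp (t / 2) * (exp (- t / 2) / sqrt 2 * \<Phi> x t)) * ennreal (k b x t) \<partial>lborel)"
      using k0 \<Phi>0 by (intro nn_integral_cong) (simp add: ennreal_mult'[symmetric] mult_ac)
    also have "\<dots> = ennreal (exp (t / 2) * (exp (- t / 2) / sqrt 2 * \<Phi> x t)) * ennreal (exp (- t / 2) / sqrt 2 * \<Phi> x t)"
      by (subst nn_integral_cmult, measurable) (simp only: conv)
    also have "\<dots> = ennreal (exp (- t / 2) / 2 * (\<Phi> x t)\<^sup>2)"
      using \<Phi>0[of x t] by (simp add: ennreal_mult'[symmetric] mult_exp_exp power2_eq_square field_simps)
    finally show ?thesis using \<Phi>0[of x t] by (simp add: ennreal_mult'[symmetric])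
  qed
  have kk: "(\<integral>\<^sup>+t. (\<integral>\<^sup>+x. ennreal (exp (t / 2) * (k b x t * k b' x t)) \<partial>lborel) \<partial>lborel)
     = ennreal ((legFr 0)\<^sup>2) * ennreal (1 / sqrt (1 + b\<^sup>2) * (1 / sqrt (1 + b'\<^sup>2)) * (1 / sqrt \<bar>b - b'\<bar>))" if "b \<noteq> b'" for b b'
  proof -
    have e: "ennreal (exp (t / 2) * (k b x t * k b' x t)) = ennreal (1 / sqrt (1 + b\<^sup>2) * (1 / sqrt (1 + b'\<^sup>2))) *
        ennreal (exp (t / 2) / sqrt (((x - b)\<^sup>2 + exp (2 * t)) * ((x - b')\<^sup>2 + exp (2 * t))))" for x t
      by (simp add: ennreal_mult'[symmetric] k_def real_sqrt_mult mult_ac)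
    have "(\<integral>\<^sup>+t. (\<integral>\<^sup>+x. ennreal (exp (t / 2) * (k b x t * k b' x t)) \<partial>lborel) \<partial>lborel) = ennreal (1 / sqrt (1 + b\<^sup>2) * (1 / sqrt (1 + b'\<^sup>2))) * ennreal ((legFr 0)\<^sup>2 / sqrt \<bar>b - b'\<bar>)"
      unfolding e inverse_sqrt_plane_integral[OF that, symmetric]
      by (subst nn_integral_cmult, measurable, subst nn_integral_cmult, measurable)
    then show ?thesis by (simp add: ennreal_mult'[symmetric] mult_ac)
  qed
  define N where "N = (\<integral>\<^sup>+t. (\<integral>\<^sup>+u\<in>{cosh t<..}. ennreal ((legFr u)\<^sup>2 / sqrt (u - cosh t)) \<partial>lborel) \<partial>lborel)"
  have "ennreal 2 * N = (\<integral>\<^sup>+t. ennreal 2 * (\<integral>\<^sup>+x\<in>{0<..}. ennreal (sqrt 2 * exp (- t / 2) * (\<Phi> x t)\<^sup>2) \<partial>lborel) \<partial>lborel)"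
    unfolding N_def step1 by (rule nn_integral_cmult[symmetric]) measurable
  also have "\<dots> = (\<integral>\<^sup>+t. (\<integral>\<^sup>+x. ennreal (2 * sqrt 2) * (\<integral>\<^sup>+b. (\<integral>\<^sup>+b'. ennreal (exp (t / 2) * (k b x t * k b' x t)) \<partial>lborel) \<partial>lborel) \<partial>lborel) \<partial>lborel)"
    by (simp only: step2) (simp only: sq)
  also have "\<dots> = ennreal (2 * sqrt 2) * (\<integral>\<^sup>+t. (\<integral>\<^sup>+x. (\<integral>\<^sup>+b. (\<integral>\<^sup>+b'. ennreal (exp (t / 2) * (k b x t * k b' x t)) \<partial>lborel) \<partial>lborel) \<partial>lborel) \<partial>lborel)"
    by (subst nn_integral_cmult, measurable, subst nn_integral_cmult, measurable)
  \<comment> \<open>The two boundary variables move outwards past \<open>x\<close> and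
    \<open>t\<close> by adjacent exchanges.\<close>
  also have "(\<integral>\<^sup>+t. (\<integral>\<^sup>+x. (\<integral>\<^sup>+b. (\<integral>\<^sup>+b'. ennreal (exp (t / 2) * (k b x t * k b' x t)) \<partial>lborel) \<partial>lborel) \<partial>lborel) \<partial>lborel)
     = (\<integral>\<^sup>+b. (\<integral>\<^sup>+b'. (\<integral>\<^sup>+t. (\<integral>\<^sup>+x. ennreal (exp (t / 2) * (k b x t * k b' x t)) \<partial>lborel) \<partial>lborel) \<partial>lborel) \<partial>lborel)"
  proof -
    have "(\<integral>\<^sup>+t. (\<integral>\<^sup>+x. (\<integral>\<^sup>+b. (\<integral>\<^sup>+b'. ennreal (exp (t / 2) * (k b x t * k b' x t)) \<partial>lborel) \<partial>lborel) \<partial>lborel) \<partial>lborel)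
      = (\<integral>\<^sup>+t. (\<integral>\<^sup>+b. (\<integral>\<^sup>+x. (\<integral>\<^sup>+b'. ennreal (exp (t / 2) * (k b x t * k b' x t)) \<partial>lborel) \<partial>lborel) \<partial>lborel) \<partial>lborel)"
      by (intro nn_integral_cong lborel_pair.Fubini') measurable
    also have "\<dots> = (\<integral>\<^sup>+b. (\<integral>\<^sup>+t. (\<integral>\<^sup>+x. (\<integral>\<^sup>+b'. ennreal (exp (t / 2) * (k b x t * k b' x t)) \<partial>lborel) \<partial>lborel) \<partial>lborel) \<partial>lborel)"
      by (intro lborel_pair.Fubini') measurable
    also have "\<dots> = (\<integral>\<^sup>+b. (\<integral>\<^sup>+t. (\<integral>\<^sup>+b'. (\<integral>\<^sup>+x. ennreal (exp (t / 2) * (k b x t * k b' x t)) \<partial>lborel) \<partial>lborel) \<partial>lborel) \<partial>lborel)"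
      by (intro nn_integral_cong lborel_pair.Fubini') measurable
    also have "\<dots> = (\<integral>\<^sup>+b. (\<integral>\<^sup>+b'. (\<integral>\<^sup>+t. (\<integral>\<^sup>+x. ennreal (exp (t / 2) * (k b x t * k b' x t)) \<partial>lborel) \<partial>lborel) \<partial>lborel) \<partial>lborel)"
      by (intro nn_integral_cong lborel_pair.Fubini') measurable
    finally show ?thesis .
  qed
  also have "\<dots> = (\<integral>\<^sup>+b. (\<integral>\<^sup>+b'. ennreal ((legFr 0)\<^sup>2) * ennreal (1 / sqrt (1 + b\<^sup>2) * (1 / sqrt (1 + b'\<^sup>2)) * (1 / sqrt \<bar>b - b'\<bar>)) \<partial>lborel) \<partial>lborel)"
  proof (rule nn_integral_cong, rule nn_integral_cong_AE)
    fix b :: real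
    have "AE b' in lborel. b' \<noteq> b" using AE_lborel_singleton by blast
    then show "AE b' in lborel. (\<integral>\<^sup>+t. (\<integral>\<^sup>+x. ennreal (exp (t / 2) * (k b x t * k b' x t)) \<partial>lborel) \<partial>lborel)
      = ennreal ((legFr 0)\<^sup>2) * ennreal (1 / sqrt (1 + b\<^sup>2) * (1 / sqrt (1 + b'\<^sup>2)) * (1 / sqrt \<bar>b - b'\<bar>))"
      by eventually_elim (rule kk, simp)
  qed
  also have "\<dots> = (\<integral>\<^sup>+b. ennreal ((legFr 0)\<^sup>2) * (\<integral>\<^sup>+b'. ennreal (1 / sqrt (1 + b\<^sup>2) * (1 / sqrt (1 + b'\<^sup>2)) * (1 / sqrt \<bar>b - b'\<bar>)) \<partial>lborel) \<partial>lborel)"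
    by (intro nn_integral_cong nn_integral_cmult) measurable
  also have "\<dots> = ennreal ((legFr 0)\<^sup>2) * (\<integral>\<^sup>+b. (\<integral>\<^sup>+b'. ennreal (1 / sqrt (1 + b\<^sup>2) * (1 / sqrt (1 + b'\<^sup>2)) * (1 / sqrt \<bar>b - b'\<bar>)) \<partial>lborel) \<partial>lborel)"
    by (rule nn_integral_cmult) measurable
  also have "\<dots> = ennreal ((legFr 0)\<^sup>2) * ennreal (2 * (legFr 0)\<^sup>2)"
    unfolding nn_integral_inverse_sqrt_difference ..
  also have "ennreal (2 * sqrt 2) * \<dots> = ennreal 2 * ennreal (2 * sqrt 2 * (legFr 0) ^ 4)"
    by (simp add: ennreal_mult'[symmetric] power4_eq_xxxx power2_eq_square del: ennreal_numeral)
  finally show ?thesis unfolding N_def by (subst (asm) ennreal_mult_cancel_left) auto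
qed

section \<open>Folding onto the cuts\<close>

lemma legF_of_real:
  assumes "0 \<le> u"
  shows "legF (1/2) (of_real u) = of_real (legFr u)"
proof -
  have "(of_real u + complex_of_real (cosh t)) powr (- of_real (1/2)) = of_real (1 / sqrt (u + cosh t))" for t
  proof -
    have nn: "0 \<le> u + cosh t" using assms by (intro add_nonneg_nonneg) auto
    have "(of_real u + complex_of_real (cosh t)) powr (- of_real (1/2)) = complex_of_real (u + cosh t) powr of_real (- (1/2))"
      by simp
    also have "\<dots> = of_real ((u + cosh t) powr (- (1/2)))" using nn by (rule powr_of_real)
    finally show ?thesis using nn by (simp add: powr_minus_half)
  qed
  then show ?thesis unfolding legF_def legFr_def by (simp only: integral_complex_of_real)
qed

lemma integrable_inverse_sqrt_dist:
  fixes c :: real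
  assumes c: "0 < c"
  shows "integrable lborel (\<lambda>\<rho>. indicator {0<..<2*c} \<rho> * (1 / sqrt \<bar>c - \<rho>\<bar>))"
proof -
  have i0: "integrable lborel (\<lambda>x. indicator {0..c} x * x powr (- (1/2)))"
  proof -
    have "((\<lambda>x. x powr (- (1/2))) has_integral (c powr (- (1/2) + 1) / (- (1/2) + 1))) {0..c}"
      by (rule has_integral_powr_from_0) (use c in auto)
    then have "(\<lambda>x. x powr (- (1/2))) absolutely_integrable_on {0..c}"
      by (intro nonnegative_absolutely_integrable_1) (auto simp: integrable_on_def)
    then have "set_integrable lborel {0..c} (\<lambda>x::real. x powr (- (1/2)))"
      by (subst (asm) set_integrable_lebesgue_iff_lborel) (auto simp: set_borel_measurable_def)
    then show ?thesis by (simp add: set_integrable_def)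
  qed
  have i1: "integrable lborel (\<lambda>\<rho>. indicator {0..c} (c + (-1) * \<rho>) * (c + (-1) * \<rho>) powr (- (1/2)))"
    by (rule lborel_integrable_real_affine[OF i0]) simp
  have i2: "integrable lborel (\<lambda>\<rho>. indicator {0..c} (- c + 1 * \<rho>) * (- c + 1 * \<rho>) powr (- (1/2)))"
    by (rule lborel_integrable_real_affine[OF i0]) simp
  show ?thesis
  proof (rule Bochner_Integration.integrable_bound[OF Bochner_Integration.integrable_add[OF i1 i2]])
    show "AE \<rho> in lborel. norm (indicator {0<..<2*c} \<rho> * (1 / sqrt \<bar>c - \<rho>\<bar>))
       \<le> norm (indicator {0..c} (c + (-1) * \<rho>) * (c + (-1) * \<rho>) powr (- (1/2)) + indicator {0..c} (- c + 1 * \<rho>) * (- c + 1 * \<rho>) powr (- (1/2)))"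
      by (intro AE_I2) (auto simp: indicator_def powr_minus_half abs_if)
  qed measurable
qed

text \<open>The split \<open>\<theta> = 1/4\<close> gives decay 3/8 for one factor and 3/4 for the
  square; together with the 1/2 of an inverse square root this exceeds 1.\<close>

lemma legF_half_bound:
  "\<exists>K>0. \<forall>u. 0 \<le> Re u \<longrightarrow> norm (legF (1/2) u) ^ 2 \<le> K * max 1 (norm u) powr (- (3/4))"
proof -
  obtain K where K: "K > 0" "\<And>u. 0 \<le> Re u \<Longrightarrow> norm (legF (1/2) u) \<le> K * max 1 (norm u) powr (- (1 - 1/4) * (1/2))"
    using legF_bound[of "1/2" "1/4"] by auto
  have "norm (legF (1/2) u) ^ 2 \<le> K\<^sup>2 * max 1 (norm u) powr (- (3/4))" if "0 \<le> Re u" for u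
  proof -
    have "norm (legF (1/2) u) ^ 2 \<le> (K * max 1 (norm u) powr (- (1 - 1/4) * (1/2))) ^ 2"
      by (intro power_mono K(2) that) simp
    also have "\<dots> = K\<^sup>2 * (max 1 (norm u) powr (- (3/8)) * max 1 (norm u) powr (- (3/8)))"
      by (simp add: power2_eq_square)
    also have "max 1 (norm u) powr (- (3/8)) * max 1 (norm u) powr (- (3/8)) = max 1 (norm u) powr (- (3/4))"
      by (simp add: powr_add[symmetric])
    finally show ?thesis .
  qed
  then show ?thesis using K(1) by (intro exI[of _ "K\<^sup>2"]) auto
qed

text \<open>The integrand on the imaginary axis extends to the right half-plane except for the cut
  of \<open>(c - w)\<close> to the power -1/2 along \<open>[c, \<infinity>)\<close>. Below
  \<open>c\<close> the one-sided limits agree; beyond \<open>c\<close> they are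
  \<open>\<i> / sqrt (\<rho> - c)\<close> and its conjugate times
  \<open>(legFr \<rho>)\<^sup>2\<close>, so the contour integral collapses to twice the integral
  over the cut.\<close>

lemma legF_half_contour:
  assumes c: "1 \<le> c"
  shows "(\<integral>y. legF (1/2) (\<i> * of_real y) ^ 2 * (of_real c - \<i> * of_real y) powr (- of_real (1/2)) \<partial>lborel)
      = 2 * of_real (LBINT u:{c<..}. (legFr u)\<^sup>2 / sqrt (u - c))"
    and "set_integrable lborel {c<..} (\<lambda>u. (legFr u)\<^sup>2 / sqrt (u - c))"
proof -
  let ?F = "legF (1/2)"
  define f where "f w = ?F w ^ 2 * (of_real c - w) powr (- of_real (1/2))" for w
  \<comment> \<open>The limit of the root from the upper side. Past \<open>c\<close> the base tends
    to the negative axis, where the principal power jumps; a quarter turn moves it to the imaginary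
    axis, where the power is continuous.\<close>
  define E where "E \<rho> = cis (pi / 4) * (\<i> * of_real (c - \<rho>)) powr (- of_real (1/2))" for \<rho>
  define fp where "fp \<rho> = of_real ((legFr \<rho>)\<^sup>2) * E \<rho>" for \<rho>
  define fm where "fm \<rho> = of_real ((legFr \<rho>)\<^sup>2) * cnj (E \<rho>)" for \<rho>
  obtain K where K: "K > 0" "\<And>u. 0 \<le> Re u \<Longrightarrow> norm (?F u) ^ 2 \<le> K * max 1 (norm u) powr (- (3/4))"
    using legF_half_bound by blast
  \<comment> \<open>The first term covers the integrable singularity at \<open>c\<close>. For
    \<open>\<rho> \<ge> 2 * c\<close> one has
    \<open>\<bar>c - \<rho>\<bar> \<ge> \<rho> / 2\<close>, which yields the factor
    \<open>sqrt 2\<close> and the decay \<open>3/4 + 1/2 = 5/4\<close>.\<close>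
  define M where "M \<rho> = K * (indicator {0<..<2*c} \<rho> * (1 / sqrt \<bar>c - \<rho>\<bar>) + sqrt 2 * max 1 \<rho> powr (- (5/4)))" for \<rho>
  have E: "E \<rho> = (if \<rho> < c then of_real (1 / sqrt (c - \<rho>)) else \<i> * of_real (1 / sqrt (\<rho> - c)))" if "\<rho> \<noteq> c" for \<rho>
  proof -
    have "E \<rho> = cis (pi / 4) * (of_real (1 / sqrt \<bar>c - \<rho>\<bar>) * cis (- sgn (c - \<rho>) * pi * (1/2) / 2))"
      unfolding E_def using that by (subst powr_imaginary) (auto simp: powr_minus_half)
    also have "\<dots> = of_real (1 / sqrt \<bar>c - \<rho>\<bar>) * cis (pi / 4 + (- sgn (c - \<rho>) * pi * (1/2) / 2))"
      by (simp add: cis_mult mult.left_commute)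
    finally show ?thesis using that by (auto simp: abs_if)
  qed
  have Mint: "set_integrable lborel {0<..} M"
  proof -
    have "set_integrable lborel {0<..} (\<lambda>\<rho>. indicator {0<..<2*c} \<rho> * (1 / sqrt \<bar>c - \<rho>\<bar>))"
      unfolding set_integrable_def
      by (rule Bochner_Integration.integrable_bound[OF integrable_inverse_sqrt_dist[of c]])
         (use c in \<open>auto simp: indicator_def\<close>)
    then show ?thesis
      unfolding M_def using set_integrable_max_powr[of "5/4" "sqrt 2"]
      by (intro set_integrable_mult_right set_integral_add(1)) simp_all
  qed
  have Mbound: "K * max 1 \<rho> powr (- (3/4)) * (1 / sqrt \<bar>c - \<rho>\<bar>) \<le> M \<rho>" if \<rho>: "0 < \<rho>" "\<rho> \<noteq> c" for \<rho>
  proof (cases "\<rho> < 2 * c")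
    case True
    have "max 1 \<rho> powr (- (3/4)) \<le> 1" using powr_mono2'[of "- (3/4)" 1 "max 1 \<rho>"] by simp
    then have "max 1 \<rho> powr (- (3/4)) * (1 / sqrt \<bar>c - \<rho>\<bar>) \<le> 1 * (1 / sqrt \<bar>c - \<rho>\<bar>)"
      by (intro mult_right_mono) auto
    also have "\<dots> \<le> indicator {0<..<2*c} \<rho> * (1 / sqrt \<bar>c - \<rho>\<bar>) + sqrt 2 * max 1 \<rho> powr (- (5/4))"
      using True \<rho> by simp
    finally show ?thesis unfolding M_def mult.assoc using K(1) by (intro mult_left_mono) auto
  next
    case False
    then have r: "1 \<le> \<rho>" "\<rho> / 2 \<le> \<bar>c - \<rho>\<bar>" using c by auto
    have "0 < \<rho> / 2" "0 < \<bar>c - \<rho>\<bar>" using r by linarith+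
    then have "1 / sqrt \<bar>c - \<rho>\<bar> \<le> 1 / sqrt (\<rho> / 2)"
      using r by (intro divide_left_mono mult_pos_pos) auto
    also have "\<dots> = sqrt 2 * \<rho> powr (- (1/2))"
      using r by (simp add: powr_minus_half real_sqrt_divide)
    finally have "max 1 \<rho> powr (- (3/4)) * (1 / sqrt \<bar>c - \<rho>\<bar>) \<le> \<rho> powr (- (3/4)) * (sqrt 2 * \<rho> powr (- (1/2)))"
      using r by (intro mult_mono) auto
    also have "\<dots> = sqrt 2 * \<rho> powr (- (5/4))"
      by (simp add: powr_add[symmetric] mult.left_commute)
    also have "\<dots> \<le> indicator {0<..<2*c} \<rho> * (1 / sqrt \<bar>c - \<rho>\<bar>) + sqrt 2 * max 1 \<rho> powr (- (5/4))"
      using r by (simp add: max_def)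
    finally show ?thesis unfolding M_def mult.assoc using K(1) by (intro mult_left_mono) auto
  qed
  have holF: "?F holomorphic_on {u. -1 < Re u}" by (rule legF_holomorphic) simp
  have cw: "of_real c - w \<notin> \<real>\<^sub>\<le>\<^sub>0" if "Im w \<noteq> 0" for w
    using that by (auto simp: complex_nonpos_Reals_iff)
  have hol: "f holomorphic_on {w. 0 < Re w \<and> Im w \<noteq> 0}"
    unfolding f_def
    by (intro holomorphic_intros holomorphic_on_subset[OF holF]) (use cw in auto)
  have bound: "norm (f (of_real \<rho> * cis a)) \<le> M \<rho>" if \<rho>: "0 < \<rho>" "\<rho> \<noteq> c" and a: "a \<noteq> 0" "\<bar>a\<bar> < pi / 2" for \<rho> a
  proof -
    define w where "w = of_real \<rho> * cis a"
    have "0 < cos a" using a by (intro cos_gt_zero_pi) linarith+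
    then have Rew: "0 \<le> Re w" and nw: "norm w = \<rho>" using \<rho> by (auto simp: w_def norm_mult)
    have dist: "\<bar>c - \<rho>\<bar> \<le> norm (of_real c - w)"
      using norm_triangle_ineq3[of "of_real c" w] nw c by simp
    have "norm (f w) = norm (?F w) ^ 2 * (1 / sqrt (norm (of_real c - w)))"
      by (simp add: f_def norm_mult norm_power norm_powr_real_powr' powr_minus_half)
    also have "\<dots> \<le> (K * max 1 \<rho> powr (- (3/4))) * (1 / sqrt \<bar>c - \<rho>\<bar>)"
      using K(1) K(2)[OF Rew] dist \<rho> unfolding nw
      by (intro mult_mono divide_left_mono mult_pos_pos) auto
    also have "\<dots> \<le> M \<rho>" by (rule Mbound[OF \<rho>])
    finally show ?thesis by (simp add: w_def)
  qed
  \<comment> \<open>For \<open>0 < Im w\<close> the argument of \<open>c - w\<close> lies strictly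
    between \<open>- pi\<close> and 0, so adding \<open>pi / 2\<close> stays within the principal
    range.\<close>
  have rot: "(of_real c - w) powr (- of_real (1/2)) = cis (pi / 4) * (\<i> * (of_real c - w)) powr (- of_real (1/2))" if "0 < Im w" for w
  proof -
    have z: "of_real c - w \<noteq> 0" "Im (of_real c - w) < 0" using that by (auto simp: complex_eq_iff)
    have "Ln (\<i> * (of_real c - w)) = Ln (of_real c - w) + \<i> * of_real pi / 2"
      using Ln_times_ii[OF z(1)] z(2) by simp
    then show ?thesis using z by (simp add: powr_def cis_conv_exp exp_add[symmetric] algebra_simps)
  qed
  have limE: "((\<lambda>a. (of_real c - of_real \<rho> * cis a) powr (- of_real (1/2))) \<longlongrightarrow> E \<rho>) (at_right 0)" if \<rho>: "0 < \<rho>" "\<rho> \<noteq> c" for \<rho>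
  proof -
    have "((\<lambda>a. cis (pi / 4) * (\<i> * (of_real c - of_real \<rho> * cis a)) powr (- of_real (1/2))) \<longlongrightarrow>
        cis (pi / 4) * (\<i> * (of_real c - of_real \<rho> * cis 0)) powr (- of_real (1/2))) (at_right 0)"
      by (intro tendsto_mult tendsto_const tendsto_powr_complex tendsto_diff tendsto_cis[OF tendsto_ident_at])
         (use \<rho> in \<open>auto simp: complex_nonpos_Reals_iff\<close>)
    also have "cis (pi / 4) * (\<i> * (of_real c - of_real \<rho> * cis 0)) powr (- of_real (1/2)) = E \<rho>"
      by (simp add: E_def)
    finally show ?thesis
    proof (rule Lim_transform_eventually)
      have "\<forall>\<^sub>F a in at_right 0. 0 < a \<and> a < pi"
        by (auto simp: eventually_at_right[of 0 1] intro!: exI[of _ pi])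
      then show "\<forall>\<^sub>F a in at_right 0. cis (pi / 4) * (\<i> * (of_real c - of_real \<rho> * cis a)) powr (- of_real (1/2))
          = (of_real c - of_real \<rho> * cis a) powr (- of_real (1/2))"
      proof eventually_elim
        case (elim a)
        have "0 < Im (of_real \<rho> * cis a)" using elim \<rho> sin_gt_zero[of a] by simp
        from rot[OF this] show ?case by (simp only:)
      qed
    qed
  qed
  have limFp: "((\<lambda>a. f (of_real \<rho> * cis a)) \<longlongrightarrow> fp \<rho>) (at_right 0)" if \<rho>: "0 < \<rho>" "\<rho> \<noteq> c" for \<rho>
  proof -
    have "((\<lambda>a. f (of_real \<rho> * cis a)) \<longlongrightarrow> ?F (of_real \<rho>) ^ 2 * E \<rho>) (at_right 0)"
      unfolding f_def by (intro tendsto_mult tendsto_power limE \<rho> tendsto_cis_quarter(1)[OF holF])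
    then show ?thesis using \<rho> by (simp add: fp_def legF_of_real)
  qed
  have limFm: "((\<lambda>a. f (of_real \<rho> * cis (- a))) \<longlongrightarrow> fm \<rho>) (at_right 0)" if \<rho>: "0 < \<rho>" "\<rho> \<noteq> c" for \<rho>
  proof -
    have l: "((\<lambda>a. ?F (of_real \<rho> * cis (- a)) ^ 2 * cnj ((of_real c - of_real \<rho> * cis a) powr (- of_real (1/2)))) \<longlongrightarrow> ?F (of_real \<rho>) ^ 2 * cnj (E \<rho>)) (at_right 0)"
      by (intro tendsto_mult tendsto_power tendsto_cnj limE \<rho> tendsto_cis_quarter(2)[OF holF])
    have "((\<lambda>a. f (of_real \<rho> * cis (- a))) \<longlongrightarrow> ?F (of_real \<rho>) ^ 2 * cnj (E \<rho>)) (at_right 0)"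
      using l
    proof (rule Lim_transform_eventually)
      have "\<forall>\<^sub>F a in at_right 0. 0 < a \<and> a < pi"
        by (auto simp: eventually_at_right[of 0 1] intro!: exI[of _ pi])
      then show "\<forall>\<^sub>F a in at_right 0. ?F (of_real \<rho> * cis (- a)) ^ 2 * cnj ((of_real c - of_real \<rho> * cis a) powr (- of_real (1/2))) = f (of_real \<rho> * cis (- a))"
      proof eventually_elim
        case (elim a)
        have "Im (of_real \<rho> * cis a) \<noteq> 0" using elim \<rho> sin_gt_zero[of a] by simp
        from cw[OF this] have "cnj ((of_real c - of_real \<rho> * cis a) powr (- of_real (1/2))) = (of_real c - of_real \<rho> * cis (- a)) powr (- of_real (1/2))"
          by (subst cnj_powr) (use sin_gt_zero[of a] elim in \<open>auto simp: cis_cnj\<close>)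
        then show ?case by (simp add: f_def)
      qed
    qed
    then show ?thesis using \<rho> by (simp add: fm_def legF_of_real)
  qed
  have cwi: "of_real c - \<i> * of_real y \<notin> \<real>\<^sub>\<le>\<^sub>0" for y :: real
    using c by (auto simp: complex_nonpos_Reals_iff)
  have limg: "((\<lambda>a. f (of_real \<rho> * cis a)) \<longlongrightarrow> f (\<i> * of_real \<rho>)) (at_left (pi / 2))"
    "((\<lambda>a. f (of_real \<rho> * cis (- a))) \<longlongrightarrow> f (\<i> * of_real (- \<rho>))) (at_left (pi / 2))" if \<rho>: "0 < \<rho>" for \<rho>
  proof -
    have 1: "((\<lambda>a. of_real \<rho> * cis a) \<longlongrightarrow> \<i> * of_real \<rho>) (at_left (pi / 2))"
      and 2: "((\<lambda>a. of_real \<rho> * cis (- a)) \<longlongrightarrow> \<i> * of_real (- \<rho>)) (at_left (pi / 2))"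
      using tendsto_cis_quarter(3,4)[of "\<lambda>z. z" \<rho>] \<rho> by auto
    show "((\<lambda>a. f (of_real \<rho> * cis a)) \<longlongrightarrow> f (\<i> * of_real \<rho>)) (at_left (pi / 2))"
      unfolding f_def
      by (intro tendsto_mult tendsto_power tendsto_powr_complex tendsto_diff tendsto_const tendsto_cis_quarter(3)[OF holF] \<rho> 1 cwi)
    show "((\<lambda>a. f (of_real \<rho> * cis (- a))) \<longlongrightarrow> f (\<i> * of_real (- \<rho>))) (at_left (pi / 2))"
      unfolding f_def
      by (intro tendsto_mult tendsto_power tendsto_powr_complex tendsto_diff tendsto_const tendsto_cis_quarter(4)[OF holF] \<rho> 2 cwi)
  qed
  have mM: "M \<in> borel_measurable borel" unfolding M_def by measurable
  \<comment> \<open>The explicit formula is measurable by inspection; at \<open>c\<close>, which it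
    does not cover, the value of \<open>E\<close> is kept so that the two functions agree
    everywhere.\<close>
  define E' where "E' \<rho> = (if \<rho> < c then of_real (1 / sqrt (c - \<rho>)) else if c < \<rho> then \<i> * of_real (1 / sqrt (\<rho> - c)) else E c)" for \<rho>
  have "E = E'" using E by (auto simp: E'_def fun_eq_iff)
  moreover have "E' \<in> borel_measurable borel" unfolding E'_def by measurable
  ultimately have [measurable]: "E \<in> borel_measurable borel" by simp
  have mfp: "fp \<in> borel_measurable borel" unfolding fp_def by measurable
  have mfm: "fm \<in> borel_measurable borel" unfolding fm_def by measurable
  have mg: "(\<lambda>y. f (\<i> * of_real y)) \<in> borel_measurable borel"
  proof (rule borel_measurable_continuous_onI)
    have "continuous_on UNIV (\<lambda>y. ?F (\<i> * of_real y))"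
      by (rule continuous_on_compose2[OF holomorphic_on_imp_continuous_on[OF holF]]) (auto intro!: continuous_intros)
    moreover have "continuous_on UNIV (\<lambda>y. (of_real c - \<i> * of_real y) powr (- of_real (1/2)))"
      by (rule continuous_on_compose2[where g = "\<lambda>z. z powr (- of_real (1/2))" and t = "- \<real>\<^sub>\<le>\<^sub>0"])
         (use cwi in \<open>auto intro!: holomorphic_on_imp_continuous_on holomorphic_intros continuous_intros\<close>)
    ultimately show "continuous_on UNIV (\<lambda>y. f (\<i> * of_real y))"
      unfolding f_def by (intro continuous_on_mult continuous_on_power)
  qed
  note contour = half_plane_contour(2)[where c = c, OF hol Mint bound limFp limFm limg(1) limg(2)]
  have main: "\<i> * (\<integral>y. f (\<i> * of_real y) \<partial>lborel) = (LINT \<rho>:{0<..}|lborel. fp \<rho> - fm \<rho>)"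
    by (rule contour[OF _ _ _ _ _ _ _ _ _ _ mM mfp mfm mg])
  have si: "set_integrable lborel {c<..} (\<lambda>u. (legFr u)\<^sup>2 / sqrt (u - c))"
  proof (rule set_integrable_bound)
    show "set_integrable lborel {c<..} M" by (rule set_integrable_subset[OF Mint]) (use c in auto)
    show "AE u in lborel. u \<in> {c<..} \<longrightarrow> norm ((legFr u)\<^sup>2 / sqrt (u - c)) \<le> norm (M u)"
    proof (intro AE_I2 impI)
      fix u assume u: "u \<in> {c<..}"
      then have u0: "0 \<le> u" using c by simp
      have "norm ((legFr u)\<^sup>2 / sqrt (u - c)) = norm (?F (of_real u)) ^ 2 * (1 / sqrt \<bar>c - u\<bar>)"
        using u legF_of_real[OF u0] by (simp add: abs_minus_commute)
      also have "\<dots> \<le> K * max 1 u powr (- (3/4)) * (1 / sqrt \<bar>c - u\<bar>)"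
        using K(2)[of "of_real u"] u0 by (intro mult_right_mono) auto
      also have "\<dots> \<le> M u" by (rule Mbound) (use u c in auto)
      finally show "norm ((legFr u)\<^sup>2 / sqrt (u - c)) \<le> norm (M u)" by simp
    qed
  qed (simp add: set_borel_measurable_def)
  then show "set_integrable lborel {c<..} (\<lambda>u. (legFr u)\<^sup>2 / sqrt (u - c))" .
  have "(LINT \<rho>:{0<..}|lborel. fp \<rho> - fm \<rho>) = (LINT \<rho>|lborel. 2 * \<i> * of_real (indicator {c<..} \<rho> *\<^sub>R ((legFr \<rho>)\<^sup>2 / sqrt (\<rho> - c))))"
    unfolding set_lebesgue_integral_def
  proof (rule integral_cong_AE)
    have "AE \<rho> in lborel. \<rho> \<noteq> c" using AE_lborel_singleton by blast
    then show "AE \<rho> in lborel. indicator {0<..} \<rho> *\<^sub>R (fp \<rho> - fm \<rho>) = 2 * \<i> * of_real (indicator {c<..} \<rho> *\<^sub>R ((legFr \<rho>)\<^sup>2 / sqrt (\<rho> - c)))"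
    proof eventually_elim
      case (elim \<rho>)
      show ?case using c E[OF elim] elim by (auto simp: fp_def fm_def indicator_def)
    qed
  qed (use mfp mfm in measurable)
  also have "\<dots> = 2 * \<i> * of_real (LBINT u:{c<..}. (legFr u)\<^sup>2 / sqrt (u - c))"
    unfolding integral_mult_right_zero integral_complex_of_real set_lebesgue_integral_def ..
  finally have "\<i> * (\<integral>y. f (\<i> * of_real y) \<partial>lborel) = \<i> * (2 * of_real (LBINT u:{c<..}. (legFr u)\<^sup>2 / sqrt (u - c)))"
    unfolding main by (simp add: mult_ac)
  then show "(\<integral>y. legF (1/2) (\<i> * of_real y) ^ 2 * (of_real c - \<i> * of_real y) powr (- of_real (1/2)) \<partial>lborel)
      = 2 * of_real (LBINT u:{c<..}. (legFr u)\<^sup>2 / sqrt (u - c))"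
    unfolding f_def by simp
qed

text \<open>Writing the factor at \<open>- (\<i> * y)\<close> as its defining integral over
  \<open>t\<close> and exchanging the order leaves, for each \<open>t\<close>, a contour integral
  with \<open>c = cosh t\<close>. The integrand is complex, so the exchange rests on the product
  majorant \<open>b1 y * b2 t\<close>; after folding, nonnegativity makes the double integral
  available.\<close>

lemma legF_half_integral:
  "(\<integral>y. legF (1/2) (\<i> * of_real y) ^ 2 * legF (1/2) (- (\<i> * of_real y)) \<partial>lborel) = of_real (4 * sqrt 2 * legFr 0 ^ 4)"
proof -
  let ?F = "legF (1/2)"
  define p where "p t y = (of_real (cosh t) - \<i> * of_real y) powr (- of_real (1/2))" for t y :: real
  define G where "G t y = ?F (\<i> * of_real y) ^ 2 * p t y" for t y
  obtain K where K: "K > 0" "\<And>u. 0 \<le> Re u \<Longrightarrow> norm (?F u) ^ 2 \<le> K * max 1 (norm u) powr (- (3/4))"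
    using legF_half_bound by blast
  have contF: "continuous_on UNIV (\<lambda>y. ?F (\<i> * of_real y))"
    by (rule continuous_on_compose2[OF holomorphic_on_imp_continuous_on[OF legF_holomorphic[of "1/2"]]]) (auto intro!: continuous_intros)
  have [measurable]: "(\<lambda>y. ?F (\<i> * of_real y)) \<in> borel_measurable borel"
    by (rule borel_measurable_continuous_onI[OF contF])
  have pos: "of_real (cosh t) - \<i> * of_real y \<notin> \<real>\<^sub>\<le>\<^sub>0" for t y :: real
    using cosh_real_pos[of t] by (auto simp: complex_nonpos_Reals_iff simp del: cosh_real_pos)
  have [measurable]: "(\<lambda>w. p (fst w) (snd w)) \<in> borel_measurable (borel \<Otimes>\<^sub>M borel)"
    unfolding borel_prod p_def
  proof (rule borel_measurable_continuous_onI)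
    show "continuous_on UNIV (\<lambda>w. (of_real (cosh (fst w)) - \<i> * of_real (snd w)) powr (- of_real (1/2)))"
      by (rule continuous_on_compose2[where g = "\<lambda>z. z powr (- of_real (1/2))" and t = "- \<real>\<^sub>\<le>\<^sub>0"])
         (use pos in \<open>auto intro!: holomorphic_on_imp_continuous_on holomorphic_intros continuous_intros\<close>)
  qed
  have pm: "case_prod G \<in> borel_measurable (lborel \<Otimes>\<^sub>M lborel)"
    unfolding G_def case_prod_beta by measurable
  \<comment> \<open>The decay in \<open>y\<close> is \<open>3/4\<close> from the square and
    \<open>3/8\<close> from the root, and \<open>9/8 > 1\<close>; the remaining \<open>1/8\<close>
    of the root's exponent goes to \<open>cosh t\<close>.\<close>
  define b1 where "b1 y = K * max 1 \<bar>y\<bar> powr (- (9/8))" for y :: real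
  define b2 where "b2 t = cosh t powr (- (1/8))" for t :: real
  have pbound: "norm (p t y) \<le> max 1 \<bar>y\<bar> powr (- (3/8)) * cosh t powr (- (1/8))" for t y
  proof -
    have "p t y = (- (\<i> * of_real y) + of_real (cosh t)) powr (- of_real (1/2))"
      by (simp add: p_def)
    then show ?thesis
      using legF_integrand_bound[of "- (\<i> * of_real y)" "1/2" "1/4" t] by (simp add: norm_mult)
  qed
  have Gbound: "norm (G t y) \<le> b1 y * b2 t" for t y
  proof -
    have "norm (G t y) \<le> (K * max 1 \<bar>y\<bar> powr (- (3/4))) * (max 1 \<bar>y\<bar> powr (- (3/8)) * cosh t powr (- (1/8)))"
      unfolding G_def norm_mult norm_power using K(2)[of "\<i> * of_real y"] K(1) pbound[of t y]
      by (intro mult_mono) (auto simp: norm_mult)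
    also have "\<dots> = K * (max 1 \<bar>y\<bar> powr (- (3/4)) * max 1 \<bar>y\<bar> powr (- (3/8))) * cosh t powr (- (1/8))"
      by simp
    also have "max 1 \<bar>y\<bar> powr (- (3/4)) * max 1 \<bar>y\<bar> powr (- (3/8)) = max 1 \<bar>y\<bar> powr (- (9/8))"
      by (simp add: powr_add[symmetric])
    finally show ?thesis by (simp add: b1_def b2_def)
  qed
  have ib1: "integrable lborel b1"
  proof -
    have i: "integrable lborel (\<lambda>y. indicator {0<..} y *\<^sub>R (K * max 1 y powr (- (9/8))))"
      using set_integrable_max_powr[of "9/8" K] by (simp add: set_integrable_def)
    have "integrable lborel (\<lambda>y. indicator {0<..} y *\<^sub>R (K * max 1 y powr (- (9/8))) + indicator {0<..} (0 + (-1) * y) *\<^sub>R (K * max 1 (0 + (-1) * y) powr (- (9/8))))"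
      by (intro Bochner_Integration.integrable_add i lborel_integrable_real_affine[OF i]) simp
    then show ?thesis
    proof (rule Bochner_Integration.integrable_bound)
      have "AE y in lborel. y \<noteq> (0::real)" using AE_lborel_singleton by blast
      then show "AE y in lborel. norm (b1 y) \<le> norm (indicator {0<..} y *\<^sub>R (K * max 1 y powr (- (9/8))) + indicator {0<..} (0 + (-1) * y) *\<^sub>R (K * max 1 (0 + (-1) * y) powr (- (9/8))))"
        by eventually_elim (auto simp: b1_def indicator_def abs_if)
    qed (simp add: b1_def[abs_def])
  qed
  have ib2: "integrable lborel b2" unfolding b2_def by (rule integrable_cosh_powr) simp
  have b0: "0 \<le> b1 y" "0 \<le> b2 t" for y t using K(1) by (auto simp: b1_def b2_def)
  have mb [measurable]: "b1 \<in> borel_measurable borel" "b2 \<in> borel_measurable borel"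
    unfolding b1_def b2_def by measurable
  have Gint: "integrable (lborel \<Otimes>\<^sub>M lborel) (case_prod G)"
  proof (rule integrableI_bounded[OF pm])
    have "(\<integral>\<^sup>+w. ennreal (norm (case_prod G w)) \<partial>(lborel \<Otimes>\<^sub>M lborel)) = (\<integral>\<^sup>+t. (\<integral>\<^sup>+y. ennreal (norm (G t y)) \<partial>lborel) \<partial>lborel)"
      using lborel.nn_integral_fst[of "\<lambda>w. ennreal (norm (case_prod G w))" lborel] pm by simp
    also have "\<dots> \<le> (\<integral>\<^sup>+t. (\<integral>\<^sup>+y. ennreal (b2 t) * ennreal (b1 y) \<partial>lborel) \<partial>lborel)"
    proof (intro nn_integral_mono)
      fix t y
      have "ennreal (norm (G t y)) \<le> ennreal (b2 t * b1 y)" using Gbound[of t y] by (intro ennreal_leI) (simp add: mult.commute)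
      then show "ennreal (norm (G t y)) \<le> ennreal (b2 t) * ennreal (b1 y)" using b0 by (simp add: ennreal_mult')
    qed
    also have "\<dots> = (\<integral>\<^sup>+t. ennreal (b2 t) \<partial>lborel) * (\<integral>\<^sup>+y. ennreal (b1 y) \<partial>lborel)"
      by (subst nn_integral_cmult, measurable, subst nn_integral_multc, measurable)
    also have "\<dots> < \<infinity>"
      using ib1 ib2 b0 by (simp add: nn_integral_eq_integral ennreal_mult_less_top)
    finally show "(\<integral>\<^sup>+w. ennreal (norm (case_prod G w)) \<partial>(lborel \<Otimes>\<^sub>M lborel)) < \<infinity>" .
  qed
  define H where "H c = (LBINT u:{c<..}. (legFr u)\<^sup>2 / sqrt (u - c))" for c
  have inner_y: "(\<integral>y. G t y \<partial>lborel) = of_real (2 * H (cosh t))" for t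
    using legF_half_contour(1)[OF cosh_real_ge_1[of t]] by (simp add: G_def p_def H_def)
  have inner_t: "(\<integral>t. G t y \<partial>lborel) = ?F (\<i> * of_real y) ^ 2 * ?F (- (\<i> * of_real y))" for y
    unfolding G_def integral_mult_right_zero by (simp add: p_def legF_def)
  have "(\<integral>y. ?F (\<i> * of_real y) ^ 2 * ?F (- (\<i> * of_real y)) \<partial>lborel) = (\<integral>t. (\<integral>y. G t y \<partial>lborel) \<partial>lborel)"
    unfolding inner_t[symmetric] by (rule lborel_pair.Fubini_integral[OF Gint])
  also have "\<dots> = of_real (LBINT t. 2 * H (cosh t))"
    unfolding inner_y by (rule integral_complex_of_real)
  also have "(LBINT t. 2 * H (cosh t)) = 2 * (LBINT t. H (cosh t))"
    by simp
  also have "(LBINT t. H (cosh t)) = 2 * sqrt 2 * legFr 0 ^ 4"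
  proof -
    have H0: "0 \<le> H c" for c
      unfolding H_def set_lebesgue_integral_def by (intro integral_nonneg_AE AE_I2) (auto simp: indicator_def)
    have "integrable lborel (\<lambda>t. \<integral>y. G t y \<partial>lborel)"
      using lborel_pair.integrable_fst'[OF Gint] by simp
    then have iH: "integrable lborel (\<lambda>t. 2 * H (cosh t))"
      unfolding inner_y complex_of_real_integrable_eq .
    then have iH: "integrable lborel (\<lambda>t. H (cosh t))" by simp
    have "ennreal (LBINT t. H (cosh t)) = (\<integral>\<^sup>+t. ennreal (H (cosh t)) \<partial>lborel)"
      using nn_integral_eq_integral[OF iH] H0 by simp
    also have "\<dots> = (\<integral>\<^sup>+t. (\<integral>\<^sup>+u\<in>{cosh t<..}. ennreal ((legFr u)\<^sup>2 / sqrt (u - cosh t)) \<partial>lborel) \<partial>lborel)"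
    proof (rule nn_integral_cong)
      fix t :: real
      show "ennreal (H (cosh t)) = (\<integral>\<^sup>+u\<in>{cosh t<..}. ennreal ((legFr u)\<^sup>2 / sqrt (u - cosh t)) \<partial>lborel)"
        using legF_half_contour(2)[OF cosh_real_ge_1[of t]]
        by (subst nn_integral_eq_set_integral) (auto simp: H_def)
    qed
    also have "\<dots> = ennreal (2 * sqrt 2 * legFr 0 ^ 4)" by (rule legFr_double_integral)
    finally show ?thesis
      using H0 legFr_nonneg[of 0] by (subst (asm) ennreal_inj) (auto intro!: integral_nonneg_AE)
  qed
  finally show ?thesis by simp
qed

section \<open>Complete elliptic integrals\<close>

text \<open>The expansion of the nonvanishing integral is the second linear relation. With
  \<open>c = cis (pi / 4)\<close> both coefficient sums equal \<open>c + cnj c = sqrt 2\<close>, so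
  it determines \<open>legJ3 + legJ21\<close>; the ratio 3 from the first relation turns this into
  \<open>4 * legJ21\<close>.\<close>

lemma legJ_half:
  "legJ21 (1/2) = Gamma (1/4) ^ 8 / (4 * pi ^ 5)" "legJ3 (1/2) = 3 * legJ21 (1/2)"
proof -
  have h: "0 < (1/2::real)" "(1/2::real) < 1" by auto
  show J3: "legJ3 (1/2) = 3 * legJ21 (1/2)"
    using legendre_identity_unit_interval[OF h] by simp
  define c where "c = cis (pi / 4)"
  have cc: "c * cnj c = 1" by (simp add: c_def cis_cnj cis_mult)
  have c2: "c ^ 2 = \<i>" by (simp add: c_def power2_eq_square cis_mult)
  have cs: "c + cnj c = of_real (sqrt 2)"
    by (simp add: c_def complex_eq_iff cos_45)
  have R: "legR (1/2) y = pi * ((1 + y\<^sup>2) powr (- (1/4)) * legA (1/2) y)" for y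
    using legR_legA[OF h, of y] Gamma_one_half_real by simp
  have F: "legF (1/2) (\<i> * of_real y) = of_real (pi * (1 + y\<^sup>2) powr (- (1/4))) * (cnj c * of_real (legA (1/2) (- y)) + c * of_real (legA (1/2) y))" for y
    unfolding legF_imaginary[OF h] R by (simp add: c_def cis_cnj algebra_simps)
  have expand: "legF (1/2) (\<i> * of_real y) ^ 2 * legF (1/2) (- (\<i> * of_real y)) = of_real (pi ^ 3) *
      (of_real ((1 + y\<^sup>2) powr (- (1/2 + 1) / 2)) *
      (c * of_real (legA (1/2) y) ^ 3 + (c ^ 3 + 2 * cnj c) * (of_real (legA (1/2) y) ^ 2 * of_real (legA (1/2) (- y)))
       + (2 * c + cnj c ^ 3) * (of_real (legA (1/2) (- y)) ^ 2 * of_real (legA (1/2) y)) + cnj c * of_real (legA (1/2) (- y)) ^ 3))" for y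
  proof -
    define V where "V = (1 + y\<^sup>2) powr (- (1/4))"
    have V: "V ^ 3 = (1 + y\<^sup>2) powr (- (1/2 + 1) / 2)"
    proof -
      have "V ^ 3 = V powr 3" by (simp add: V_def)
      then show ?thesis by (simp add: V_def powr_powr)
    qed
    have F': "legF (1/2) (- (\<i> * of_real y)) = of_real (pi * V) * (cnj c * of_real (legA (1/2) y) + c * of_real (legA (1/2) (- y)))"
      using F[of "- y"] by (simp add: V_def)
    have poly: "(cnj c * q + c * p)\<^sup>2 * (cnj c * p + c * q) = c * p ^ 3 + (c ^ 3 + 2 * cnj c) * (p\<^sup>2 * q) + (2 * c + cnj c ^ 3) * (q\<^sup>2 * p) + cnj c * q ^ 3" for p q
    proof -
      have "(cnj c * q + c * p)\<^sup>2 * (cnj c * p + c * q) = (c * cnj c) * (c * p ^ 3) + (c ^ 3 + 2 * ((c * cnj c) * cnj c)) * (p\<^sup>2 * q)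
         + (2 * ((c * cnj c) * c) + cnj c ^ 3) * (q\<^sup>2 * p) + (c * cnj c) * (cnj c * q ^ 3)"
        by (simp add: power2_eq_square power3_eq_cube algebra_simps)
      then show ?thesis unfolding cc by simp
    qed
    have "legF (1/2) (\<i> * of_real y) ^ 2 * legF (1/2) (- (\<i> * of_real y)) = of_real (pi ^ 3) * (of_real (V ^ 3) *
       ((cnj c * of_real (legA (1/2) (- y)) + c * of_real (legA (1/2) y))\<^sup>2 * (cnj c * of_real (legA (1/2) y) + c * of_real (legA (1/2) (- y)))))"
      unfolding F F' V_def[symmetric] by (simp add: power2_eq_square power3_eq_cube mult_ac)
    then show ?thesis unfolding poly V .
  qed
  have "complex_of_real (4 * sqrt 2 * legFr 0 ^ 4) = of_real (pi ^ 3) * ((c + cnj c) * of_real (legJ3 (1/2)) + ((c ^ 3 + 2 * cnj c) + (2 * c + cnj c ^ 3)) * of_real (legJ21 (1/2)))"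
    unfolding legF_half_integral[symmetric] expand integral_mult_right_zero legJ_line_integral[OF h(1)] ..
  also have "(c ^ 3 + 2 * cnj c) + (2 * c + cnj c ^ 3) = c + cnj c"
  proof -
    have "c ^ 3 + cnj c ^ 3 = (c + cnj c) ^ 3 - 3 * (c * cnj c) * (c + cnj c)"
      by (simp add: power3_eq_cube algebra_simps)
    also have "(c + cnj c) ^ 3 = 2 * (c + cnj c)"
      unfolding cs by (simp add: power3_eq_cube flip: of_real_mult)
    finally show ?thesis unfolding cc by (simp add: algebra_simps)
  qed
  also have "of_real (pi ^ 3) * ((c + cnj c) * of_real (legJ3 (1/2)) + (c + cnj c) * of_real (legJ21 (1/2)))
     = complex_of_real (pi ^ 3 * (sqrt 2 * (4 * legJ21 (1/2))))"
    unfolding cs J3 by (simp add: algebra_simps)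
  finally have "4 * sqrt 2 * legFr 0 ^ 4 = pi ^ 3 * (sqrt 2 * (4 * legJ21 (1/2)))"
    by (simp only: of_real_eq_iff)
  then have "legJ21 (1/2) = legFr 0 ^ 4 / pi ^ 3" by (simp add: field_simps)
  also have "legFr 0 ^ 4 = Gamma (1/4) ^ 8 / (4 * pi\<^sup>2)"
  proof -
    have "sqrt (2 * pi) ^ 4 = (sqrt (2 * pi) ^ 2) ^ 2" unfolding power_mult[symmetric] by simp
    also have "sqrt (2 * pi) ^ 2 = 2 * pi" by (rule real_sqrt_pow2) simp
    also have "(2 * pi)\<^sup>2 = 4 * pi\<^sup>2" by (simp add: power_mult_distrib)
    finally show ?thesis unfolding legFr_0 power_divide by simp
  qed
  finally show "legJ21 (1/2) = Gamma (1/4) ^ 8 / (4 * pi ^ 5)"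
    by (simp add: power_add[symmetric] mult.assoc)
qed

section \<open>Translation into complete elliptic integrals\<close>

lemma legendre_P_minus_half:
  assumes "x \<in> {-1<..<1}"
  shows "legendre_P (- 1 / 2) x = of_real (legendre_real (1/2) x)"
  using legendre_real_sums(2)[of x "1/2"] assms by simp

text \<open>Euler's integral at \<open>s = 1/2\<close> becomes the elliptic integral under
  \<open>t = (sin \<theta>)\<^sup>2\<close>: the Jacobian cancels both endpoint singularities, and
  \<open>Gamma (1/2)\<close> squared gives \<open>pi\<close>.\<close>

lemma legendre_real_elliptic_K:
  assumes x: "-1 < x" "x \<le> 1"
  shows "legendre_real (1/2) x = 2 / pi * elliptic_K (sqrt ((1 - x) / 2))"
proof -
  define z where "z = (1 - x) / 2"
  have z: "0 \<le> z" "z < 1" using x by (auto simp: z_def)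
  define f where "f \<theta> = (1 - z * (sin \<theta>)\<^sup>2) powr (- 1 / 2)" for \<theta> :: real
  have [measurable]: "f \<in> borel_measurable borel" unfolding f_def by measurable
  let ?S = "{0<..<pi/2}"
  have sc: "0 < sin \<theta>" "0 < cos \<theta>" "sin \<theta> < 1" if "\<theta> \<in> ?S" for \<theta>
  proof -
    show s: "0 < sin \<theta>" and c: "0 < cos \<theta>" using that by (auto intro!: sin_gt_zero cos_gt_zero_pi)
    show "sin \<theta> < 1" using sin_cos_squared_add[of \<theta>] c s
      by (smt (verit) one_power2 power_mono zero_less_power)
  qed
  have img: "(\<lambda>\<theta>. (sin \<theta>)\<^sup>2) ` ?S = {0<..<1}"
  proof (intro set_eqI iffI)
    fix t :: real assume t: "t \<in> {0<..<1}"
    then have "0 < sqrt t" "sqrt t < 1" by auto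
    moreover from this have "sin (arcsin (sqrt t)) = sqrt t" by (intro sin_arcsin) linarith+
    ultimately have "arcsin (sqrt t) \<in> ?S" "(sin (arcsin (sqrt t)))\<^sup>2 = t"
      using t arcsin_less_mono[of 0 "sqrt t"] arcsin_less_mono[of "sqrt t" 1] by auto
    then show "t \<in> (\<lambda>\<theta>. (sin \<theta>)\<^sup>2) ` ?S" by (metis (mono_tags, lifting) imageI)
  next
    fix t assume "t \<in> (\<lambda>\<theta>. (sin \<theta>)\<^sup>2) ` ?S"
    then obtain \<theta> where "\<theta> \<in> ?S" and t: "t = (sin \<theta>)\<^sup>2" by blast
    from sc[OF this(1)] show "t \<in> {0<..<1}" unfolding t by (simp add: power_less_one_iff)
  qed
  have "ennreal (pi * legendre_real (1/2) x) = (\<integral>\<^sup>+t\<in>{0<..<1}. ennreal (t powr (- (1/2)) * (1 - t) powr (1/2 - 1) * (1 - z * t) powr (- (1/2))) \<partial>lborel)"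
    using legendre_real_Euler[of "1/2" x] x Gamma_one_half_real by (simp add: z_def)
  also have "\<dots> = (\<integral>\<^sup>+\<theta>\<in>?S. ennreal (\<bar>2 * sin \<theta> * cos \<theta>\<bar> * (((sin \<theta>)\<^sup>2) powr (- (1/2)) * (1 - (sin \<theta>)\<^sup>2) powr (1/2 - 1) * (1 - z * (sin \<theta>)\<^sup>2) powr (- (1/2)))) \<partial>lborel)"
    unfolding img[symmetric]
  proof (rule nn_integral_change_of_variables)
    show "inj_on (\<lambda>\<theta>. (sin \<theta>)\<^sup>2) ?S"
    proof (rule inj_onI)
      fix a b assume ab: "a \<in> ?S" "b \<in> ?S" "(sin a)\<^sup>2 = (sin b)\<^sup>2"
      then have "sin a = sin b" using sc[of a] sc[of b] by (simp add: power2_eq_iff)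
      then have "arcsin (sin a) = arcsin (sin b)" by simp
      then show "a = b" using ab by (simp add: arcsin_sin)
    qed
    show "((\<lambda>\<theta>. (sin \<theta>)\<^sup>2) has_real_derivative 2 * sin \<theta> * cos \<theta>) (at \<theta>)" for \<theta> :: real
      by (auto intro!: derivative_eq_intros)
  qed (auto simp: img)
  also have "\<dots> = (\<integral>\<^sup>+\<theta>. ennreal 2 * (ennreal (f \<theta>) * indicator ?S \<theta>) \<partial>lborel)"
  proof (rule nn_integral_cong)
    fix \<theta>
    have "\<bar>2 * sin \<theta> * cos \<theta>\<bar> * (((sin \<theta>)\<^sup>2) powr (- (1/2)) * (1 - (sin \<theta>)\<^sup>2) powr (1/2 - 1) * (1 - z * (sin \<theta>)\<^sup>2) powr (- (1/2))) = 2 * f \<theta>" if "\<theta> \<in> ?S"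
    proof -
      note s = sc[OF that]
      have e: "(1/2 - 1 :: real) = - (1/2)" by simp
      have "((sin \<theta>)\<^sup>2) powr (- (1/2)) = 1 / sin \<theta>" "(1 - (sin \<theta>)\<^sup>2) powr (1/2 - 1) = 1 / cos \<theta>"
        using s unfolding e cos_squared_eq[symmetric] by (simp_all only: powr_minus_half zero_le_power2) auto
      then show ?thesis using s by (simp add: f_def)
    qed
    then show "ennreal (\<bar>2 * sin \<theta> * cos \<theta>\<bar> * (((sin \<theta>)\<^sup>2) powr (- (1/2)) * (1 - (sin \<theta>)\<^sup>2) powr (1/2 - 1) * (1 - z * (sin \<theta>)\<^sup>2) powr (- (1/2)))) * indicator ?S \<theta>
       = ennreal 2 * (ennreal (f \<theta>) * indicator ?S \<theta>)"
      by (cases "\<theta> \<in> ?S") (simp_all add: ennreal_mult'[symmetric] f_def del: ennreal_numeral)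
  qed
  also have "\<dots> = ennreal 2 * (\<integral>\<^sup>+\<theta>\<in>?S. ennreal (f \<theta>) \<partial>lborel)"
    by (rule nn_integral_cmult) measurable
  finally have eq: "ennreal (pi * legendre_real (1/2) x) = ennreal 2 * (\<integral>\<^sup>+\<theta>\<in>?S. ennreal (f \<theta>) \<partial>lborel)" .
  have f0: "0 \<le> f \<theta>" for \<theta> by (simp add: f_def)
  have p: "0 \<le> legendre_real (1/2) x" using legendre_real_ge_1[of "1/2" x] x by simp
  have si: "set_integrable lborel ?S f"
  proof (rule ccontr)
    assume "\<not> set_integrable lborel ?S f"
    then have "(\<integral>\<^sup>+\<theta>\<in>?S. ennreal (f \<theta>) \<partial>lborel) = \<infinity>"
      using f0 by (subst nn_integral_eq_set_integral) auto
    then show False using eq by (simp add: ennreal_mult_top)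
  qed
  have "(\<integral>\<^sup>+\<theta>\<in>?S. ennreal (f \<theta>) \<partial>lborel) = ennreal (LBINT \<theta>:?S. f \<theta>)"
    using f0 si by (subst nn_integral_eq_set_integral) auto
  moreover have i0: "0 \<le> (LBINT \<theta>:?S. f \<theta>)"
    unfolding set_lebesgue_integral_def using f0 by (intro integral_nonneg_AE AE_I2) (auto simp: indicator_def)
  ultimately have "ennreal (pi * legendre_real (1/2) x) = ennreal (2 * (LBINT \<theta>:?S. f \<theta>))"
    using eq by (simp add: ennreal_mult'[symmetric] del: ennreal_numeral)
  then have "pi * legendre_real (1/2) x = 2 * (LBINT \<theta>:?S. f \<theta>)"
    using p i0 by (subst (asm) ennreal_inj) auto
  also have "(LBINT \<theta>:?S. f \<theta>) = (LBINT \<theta>:{0..pi/2}. f \<theta>)"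
    unfolding set_lebesgue_integral_def
  proof (rule integral_cong_AE)
    have "AE \<theta> in lborel. \<theta> \<noteq> (0::real)" "AE \<theta> in lborel. \<theta> \<noteq> pi / 2" using AE_lborel_singleton by blast+
    then show "AE \<theta> in lborel. indicator ?S \<theta> *\<^sub>R f \<theta> = indicator {0..pi/2} \<theta> *\<^sub>R f \<theta>"
      by eventually_elim (auto simp: indicator_def)
  qed measurable
  also have "\<dots> = elliptic_K (sqrt z)"
    using z by (simp add: elliptic_K_def f_def[abs_def])
  finally show ?thesis by (simp add: z_def field_simps)
qed

lemma borel_measurable_elliptic_K [measurable]: "elliptic_K \<in> borel_measurable borel"
  unfolding elliptic_K_def[abs_def] set_lebesgue_integral_def by measurable

text \<open>Under \<open>x = 2 * t - 1\<close> the constant collects the Jacobian 2, the factor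
  \<open>(2 / pi) ^ 3\<close> that every \<open>i + j = 3\<close> produces, and
  \<open>4 powr (- (3/4)) = sqrt 2 / 4\<close> from \<open>1 - x\<^sup>2 = 4 * t * (1 - t)\<close>.
  General exponents treat the three products at once.\<close>

lemma elliptic_K_integral_parameter:
  fixes i j :: nat
  assumes ij: "i + j = 3"
  shows "(LBINT x:{-1<..<1}. legendre_real (1/2) x ^ i * legendre_real (1/2) (- x) ^ j * (1 - x\<^sup>2) powr (1/2/2 - 1))
    = 4 * sqrt 2 / pi ^ 3 * (LBINT t:{0<..<1}. elliptic_K (sqrt (1 - t)) ^ i * elliptic_K (sqrt t) ^ j / (t powr (3/4) * (1 - t) powr (3/4)))"
proof -
  define g where "g t = 2 * t - 1" for t :: real
  have img: "g ` {0<..<1} = {-1<..<1}"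
  proof (intro set_eqI iffI)
    fix x :: real assume "x \<in> {-1<..<1}"
    then have "g ((x + 1) / 2) = x" "(x + 1) / 2 \<in> {0<..<1}" by (auto simp: g_def field_simps)
    then show "x \<in> g ` {0<..<1}" by (metis imageI)
  qed (auto simp: g_def)
  let ?f = "\<lambda>x. legendre_real (1/2) x ^ i * legendre_real (1/2) (- x) ^ j * (1 - x\<^sup>2) powr (1/2/2 - 1)"
  have "(LBINT x:{-1<..<1}. ?f x) = (LBINT x:g ` {0<..<1}. ?f x)" unfolding img ..
  also have "\<dots> = (LBINT t:{0<..<1}. \<bar>2\<bar> *\<^sub>R ?f (g t))"
  proof (rule set_integrable_change_of_variables(2))
    show "(g has_real_derivative 2) (at t)" for t unfolding g_def by (auto intro!: derivative_eq_intros)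
    show "inj_on g {0<..<1}" by (auto simp: g_def inj_on_def)
    show "g \<in> borel_measurable borel" unfolding g_def by measurable
  qed (simp_all add: img)
  also have "\<dots> = (LBINT t:{0<..<1}. 4 * sqrt 2 / pi ^ 3 * (elliptic_K (sqrt (1 - t)) ^ i * elliptic_K (sqrt t) ^ j / (t powr (3/4) * (1 - t) powr (3/4))))"
  proof (rule set_lebesgue_integral_cong)
    show "\<forall>t. t \<in> {0<..<1} \<longrightarrow> \<bar>2\<bar> *\<^sub>R ?f (g t) = 4 * sqrt 2 / pi ^ 3 * (elliptic_K (sqrt (1 - t)) ^ i * elliptic_K (sqrt t) ^ j / (t powr (3/4) * (1 - t) powr (3/4)))"
    proof (intro allI impI)
      fix t :: real assume t: "t \<in> {0<..<1}"
      have e: "(1 - g t) / 2 = 1 - t" "(1 - - g t) / 2 = t" by (simp_all add: g_def field_simps)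
      have p: "legendre_real (1/2) (g t) = 2 / pi * elliptic_K (sqrt (1 - t))"
        "legendre_real (1/2) (- g t) = 2 / pi * elliptic_K (sqrt t)"
        using legendre_real_elliptic_K[of "g t"] legendre_real_elliptic_K[of "- g t"] t
        unfolding e by (simp_all add: g_def)
      have w: "(1 - (g t)\<^sup>2) powr (1/2/2 - 1) = sqrt 2 / 4 * (1 / (t powr (3/4) * (1 - t) powr (3/4)))"
      proof -
        have "1 - (g t)\<^sup>2 = 4 * (t * (1 - t))" by (simp add: g_def power2_eq_square algebra_simps)
        then have "(1 - (g t)\<^sup>2) powr (1/2/2 - 1) = 4 powr (- (3/4)) * (t powr (- (3/4)) * (1 - t) powr (- (3/4)))"
          using t by (simp add: powr_mult)
        also have "4 powr (- (3/4)) = sqrt 2 / (4::real)"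
        proof -
          have "4 powr (- (3/4)) = ((2::real) powr 2) powr (- (3/4))" by simp
          also have "\<dots> = 2 powr (1/2 - 2)" unfolding powr_powr by simp
          also have "\<dots> = sqrt 2 / 4" unfolding powr_diff by (simp add: powr_half_sqrt)
          finally show ?thesis .
        qed
        finally show ?thesis using t by (simp add: powr_minus_divide)
      qed
      have "(2 / pi) ^ i * (2 / pi) ^ j = (2 / pi) ^ 3" unfolding power_add[symmetric] ij ..
      then have pp: "(2 / pi) ^ i * (2 / pi) ^ j = 8 / pi ^ 3" by (simp add: power_divide)
      have "\<bar>2\<bar> *\<^sub>R ?f (g t) = 2 * ((2 / pi) ^ i * (2 / pi) ^ j) * (elliptic_K (sqrt (1 - t)) ^ i * elliptic_K (sqrt t) ^ j) * (sqrt 2 / 4 * (1 / (t powr (3/4) * (1 - t) powr (3/4))))"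
        unfolding p w power_mult_distrib by simp
      also have "\<dots> = 4 * sqrt 2 / pi ^ 3 * (elliptic_K (sqrt (1 - t)) ^ i * elliptic_K (sqrt t) ^ j / (t powr (3/4) * (1 - t) powr (3/4)))"
        unfolding pp by simp
      finally show "\<bar>2\<bar> *\<^sub>R ?f (g t) = 4 * sqrt 2 / pi ^ 3 * (elliptic_K (sqrt (1 - t)) ^ i * elliptic_K (sqrt t) ^ j / (t powr (3/4) * (1 - t) powr (3/4)))" .
    qed
  qed simp
  finally show ?thesis unfolding set_integral_mult_right .
qed

text \<open>With \<open>t = k\<^sup>2\<close> the power 3/4 of \<open>t\<close> is
  \<open>k * sqrt k\<close>, and the Jacobian \<open>2 * k\<close> cancels all of it but
  \<open>sqrt k\<close>.\<close>

lemma elliptic_K_integral_modulus: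
  "(LBINT t:{0<..<1}. elliptic_K (sqrt (1 - t)) ^ i * elliptic_K (sqrt t) ^ j / (t powr (3/4) * (1 - t) powr (3/4)))
    = 2 * (LBINT k:{0<..<1}. elliptic_K (sqrt (1 - k\<^sup>2)) ^ i * elliptic_K k ^ j / (sqrt k * (1 - k\<^sup>2) powr (3/4)))"
proof -
  define g where "g k = k\<^sup>2" for k :: real
  have img: "g ` {0<..<1} = {0<..<1}"
  proof (intro set_eqI iffI)
    fix x :: real assume "x \<in> {0<..<1}"
    then have "g (sqrt x) = x" "sqrt x \<in> {0<..<1}" by (auto simp: g_def)
    then show "x \<in> g ` {0<..<1}" by (metis imageI)
  qed (auto simp: g_def power_less_one_iff)
  let ?f = "\<lambda>t. elliptic_K (sqrt (1 - t)) ^ i * elliptic_K (sqrt t) ^ j / (t powr (3/4) * (1 - t) powr (3/4))"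
  have "(LBINT t:{0<..<1}. ?f t) = (LBINT t:g ` {0<..<1}. ?f t)" unfolding img ..
  also have "\<dots> = (LBINT k:{0<..<1}. \<bar>2 * k\<bar> *\<^sub>R ?f (g k))"
  proof (rule set_integrable_change_of_variables(2))
    show "(g has_real_derivative 2 * t) (at t)" for t unfolding g_def by (auto intro!: derivative_eq_intros)
    show "inj_on g {0<..<1}" by (auto simp: g_def inj_on_def power2_eq_iff)
    show "g \<in> borel_measurable borel" unfolding g_def by measurable
  qed (simp_all add: img)
  also have "\<dots> = (LBINT k:{0<..<1}. 2 * (elliptic_K (sqrt (1 - k\<^sup>2)) ^ i * elliptic_K k ^ j / (sqrt k * (1 - k\<^sup>2) powr (3/4))))"
  proof (rule set_lebesgue_integral_cong)
    show "\<forall>k. k \<in> {0<..<1} \<longrightarrow> \<bar>2 * k\<bar> *\<^sub>R ?f (g k) = 2 * (elliptic_K (sqrt (1 - k\<^sup>2)) ^ i * elliptic_K k ^ j / (sqrt k * (1 - k\<^sup>2) powr (3/4)))"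
    proof (intro allI impI)
      fix k :: real assume k: "k \<in> {0<..<1}"
      have "(k\<^sup>2) powr (3/4) = k powr (3/2)"
        using k powr_powr[of k 2 "3/4"] by simp
      also have "\<dots> = k * sqrt k"
        using k powr_add[of k 1 "1/2"] by (simp add: powr_half_sqrt)
      finally have e: "(k\<^sup>2) powr (3/4) = k * sqrt k" .
      show "\<bar>2 * k\<bar> *\<^sub>R ?f (g k) = 2 * (elliptic_K (sqrt (1 - k\<^sup>2)) ^ i * elliptic_K k ^ j / (sqrt k * (1 - k\<^sup>2) powr (3/4)))"
        unfolding g_def e using k by simp
    qed
  qed simp
  finally show ?thesis unfolding set_integral_mult_right .
qed

lemma legJ12_half:
  "(LBINT x:{-1<..<1}. legendre_real (1/2) x * legendre_real (1/2) (- x) ^ 2 * (1 - x\<^sup>2) powr (1/2/2 - 1)) = legJ21 (1/2)"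
proof -
  have ind: "indicat_real {-1<..<1} (0 + (-1) * x) = indicator {-1<..<1} x" for x :: real
    by (auto simp: indicator_def)
  show ?thesis
    unfolding legJ21_def set_lebesgue_integral_def
    by (subst lborel_integral_real_affine[of "-1" _ 0]) (simp_all only: ind, simp_all add: mult_ac)
qed

theorem proposition2p1:
  shows
  "(let C = Gamma (1/4 :: real) ^ 8 / (32 * sqrt 2 * pi\<^sup>2)
    in C = 1/3 * (LBINT k:{0<..<1}. elliptic_K (sqrt (1 - k\<^sup>2)) ^ 3 / (sqrt k * (1 - k\<^sup>2) powr (3/4)))
     \<and> C = (LBINT k:{0<..<1}. elliptic_K (sqrt (1 - k\<^sup>2)) ^ 2 * elliptic_K k / (sqrt k * (1 - k\<^sup>2) powr (3/4)))
     \<and> C = (LBINT k:{0<..<1}. elliptic_K (sqrt (1 - k\<^sup>2)) * elliptic_K k ^ 2 / (sqrt k * (1 - k\<^sup>2) powr (3/4)))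
     \<and> C = (LBINT t:{0<..<1}. elliptic_K (sqrt (1 - t)) ^ 3 / (6 * t powr (3/4) * (1 - t) powr (3/4)))
     \<and> C = (LBINT t:{0<..<1}. elliptic_K (sqrt (1 - t)) ^ 2 * elliptic_K (sqrt t) / (2 * t powr (3/4) * (1 - t) powr (3/4)))
     \<and> C = (LBINT t:{0<..<1}. elliptic_K (sqrt (1 - t)) * elliptic_K (sqrt t) ^ 2 / (2 * t powr (3/4) * (1 - t) powr (3/4)))
     \<and> complex_of_real C = complex_of_real (sqrt 2 * pi ^ 3 / 48) *
         (LBINT x:{-1<..<1}. legendre_P (-1/2) x ^ 3 / complex_of_real ((1 - x\<^sup>2) powr (3/4)))
     \<and> complex_of_real C = complex_of_real (sqrt 2 * pi ^ 3 / 16) *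
         (LBINT x:{-1<..<1}. legendre_P (-1/2) x ^ 2 * legendre_P (-1/2) (- x) / complex_of_real ((1 - x\<^sup>2) powr (3/4)))
     \<and> complex_of_real C = complex_of_real (sqrt 2 * pi ^ 3 / 16) *
         (LBINT x:{-1<..<1}. legendre_P (-1/2) x * legendre_P (-1/2) (- x) ^ 2 / complex_of_real ((1 - x\<^sup>2) powr (3/4))))
   \<and> (\<forall>\<nu>::complex. Re \<nu> > -1 \<longrightarrow>
        set_integrable lborel {-1<..<1} (\<lambda>x. legendre_P \<nu> x ^ 3 / complex_of_real (1 - x\<^sup>2) powr ((1 - \<nu>) / 2))
      \<and> set_integrable lborel {-1<..<1} (\<lambda>x. legendre_P \<nu> x ^ 2 * legendre_P \<nu> (- x) / complex_of_real (1 - x\<^sup>2) powr ((1 - \<nu>) / 2))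
      \<and> (LBINT x:{-1<..<1}. legendre_P \<nu> x ^ 3 / complex_of_real (1 - x\<^sup>2) powr ((1 - \<nu>) / 2))
        = (3 - 2 * cos (\<nu> * of_real pi)) *
          (LBINT x:{-1<..<1}. legendre_P \<nu> x ^ 2 * legendre_P \<nu> (- x) / complex_of_real (1 - x\<^sup>2) powr ((1 - \<nu>) / 2)))"
proof (rule conjI, goal_cases)
  case 1
  define C where "C = Gamma (1/4 :: real) ^ 8 / (32 * sqrt 2 * pi\<^sup>2)"
  \<comment> \<open>One family for each row of the theorem, indexed by the exponents of the two
    factors: \<open>T\<close> in the parameter, \<open>Q\<close> in the modulus, \<open>L\<close>
    for Legendre functions. Each is a constant multiple of the others when \<open>i + j = 3\<close>,
    so three values of \<open>L\<close> settle all nine integrals.\<close>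
  define T where "T i j = (LBINT t:{0<..<1}. elliptic_K (sqrt (1 - t)) ^ i * elliptic_K (sqrt t) ^ j / (t powr (3/4) * (1 - t) powr (3/4)))" for i j
  define Q where "Q i j = (LBINT k:{0<..<1}. elliptic_K (sqrt (1 - k\<^sup>2)) ^ i * elliptic_K k ^ j / (sqrt k * (1 - k\<^sup>2) powr (3/4)))" for i j
  define L where "L i j = (LBINT x:{-1<..<1}. legendre_real (1/2) x ^ i * legendre_real (1/2) (- x) ^ j * (1 - x\<^sup>2) powr (1/2/2 - 1))" for i j
  \<comment> \<open>By \<open>legJ_half\<close> the Gamma constant is exactly the mixed Legendre
    integral with the prefactor of the theorem; the other evaluations are read off from it.\<close>
  have C: "C = sqrt 2 * pi ^ 3 / 16 * legJ21 (1/2)"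
  proof -
    have "1 / (32 * sqrt 2) = sqrt 2 / (64::real)" by (simp add: field_simps)
    moreover have "C = 1 / (32 * sqrt 2) * (Gamma (1/4) ^ 8 / pi\<^sup>2)" by (simp add: C_def)
    ultimately have "C = sqrt 2 / 64 * (Gamma (1/4) ^ 8 / pi\<^sup>2)" by (simp only:)
    also have "Gamma (1/4 :: real) ^ 8 / pi\<^sup>2 = pi ^ 3 * Gamma (1/4) ^ 8 / pi ^ 5"
      by (simp add: power_numeral_reduce)
    finally show ?thesis unfolding legJ_half(1) by simp
  qed
  have TQ: "T i j = 2 * Q i j" for i j unfolding T_def Q_def by (rule elliptic_K_integral_modulus)
  have LT: "T i j = pi ^ 3 / (4 * sqrt 2) * L i j" if "i + j = 3" for i j
    using elliptic_K_integral_parameter[OF that] unfolding T_def[symmetric] L_def[symmetric] by simp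
  have L: "L 3 0 = 3 * legJ21 (1/2)" "L 2 1 = legJ21 (1/2)" "L 1 2 = legJ21 (1/2)"
    using legJ_half(2) legJ12_half by (simp_all add: L_def legJ3_def legJ21_def)
  have T: "T 3 0 = 6 * C" "T 2 1 = 2 * C" "T 1 2 = 2 * C"
  proof -
    have "pi ^ 3 / (4 * sqrt 2) = sqrt 2 * pi ^ 3 / 8" by (simp add: field_simps)
    with LT have LT': "T i j = sqrt 2 * pi ^ 3 / 8 * L i j" if "i + j = 3" for i j using that by simp
    show "T 3 0 = 6 * C" "T 2 1 = 2 * C" "T 1 2 = 2 * C"
      using LT'[of 3 0] LT'[of 2 1] LT'[of 1 2] unfolding L C by simp_all
  qed
  then have Q: "Q 3 0 = 3 * C" "Q 2 1 = C" "Q 1 2 = C" using TQ by simp_all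
  have T': "(LBINT t:{0<..<1}. elliptic_K (sqrt (1 - t)) ^ i * elliptic_K (sqrt t) ^ j / (c * t powr (3/4) * (1 - t) powr (3/4))) = T i j / c" for c :: real and i j
    unfolding T_def set_integral_divide_zero[symmetric] by (simp add: mult_ac)
  have P: "(LBINT x:{-1<..<1}. legendre_P (-1/2) x ^ i * legendre_P (-1/2) (- x) ^ j / complex_of_real ((1 - x\<^sup>2) powr (3/4))) = of_real (L i j)" for i j
    unfolding L_def set_integral_of_real[symmetric]
  proof (rule set_lebesgue_integral_cong)
    show "\<forall>x. x \<in> {-1<..<1} \<longrightarrow> legendre_P (-1/2) x ^ i * legendre_P (-1/2) (- x) ^ j / complex_of_real ((1 - x\<^sup>2) powr (3/4))
      = of_real (legendre_real (1/2) x ^ i * legendre_real (1/2) (- x) ^ j * (1 - x\<^sup>2) powr (1/2/2 - 1))"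
    proof (intro allI impI)
      fix x :: real assume x: "x \<in> {-1<..<1}"
      have "(1 - x\<^sup>2) powr (1/2/2 - 1) = 1 / (1 - x\<^sup>2) powr (3/4)"
        using powr_minus_divide[of "1 - x\<^sup>2" "3/4"] by simp
      moreover have "legendre_P (-1/2) x = of_real (legendre_real (1/2) x)"
        "legendre_P (-1/2) (- x) = of_real (legendre_real (1/2) (- x))"
        by (rule legendre_P_minus_half; use x in simp)+
      ultimately show "legendre_P (-1/2) x ^ i * legendre_P (-1/2) (- x) ^ j / complex_of_real ((1 - x\<^sup>2) powr (3/4))
        = of_real (legendre_real (1/2) x ^ i * legendre_real (1/2) (- x) ^ j * (1 - x\<^sup>2) powr (1/2/2 - 1))"
        by simp
    qed
  qed simp
  show ?case
    unfolding Let_def C_def[symmetric]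
  proof (intro conjI)
    show "C = 1/3 * (LBINT k:{0<..<1}. elliptic_K (sqrt (1 - k\<^sup>2)) ^ 3 / (sqrt k * (1 - k\<^sup>2) powr (3/4)))"
      using Q(1) by (simp add: Q_def)
    show "C = (LBINT k:{0<..<1}. elliptic_K (sqrt (1 - k\<^sup>2)) ^ 2 * elliptic_K k / (sqrt k * (1 - k\<^sup>2) powr (3/4)))"
      using Q(2) by (simp add: Q_def)
    show "C = (LBINT k:{0<..<1}. elliptic_K (sqrt (1 - k\<^sup>2)) * elliptic_K k ^ 2 / (sqrt k * (1 - k\<^sup>2) powr (3/4)))"
      using Q(3) by (simp add: Q_def)
    show "C = (LBINT t:{0<..<1}. elliptic_K (sqrt (1 - t)) ^ 3 / (6 * t powr (3/4) * (1 - t) powr (3/4)))"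
      using T'[of 3 0 6] T(1) by simp
    show "C = (LBINT t:{0<..<1}. elliptic_K (sqrt (1 - t)) ^ 2 * elliptic_K (sqrt t) / (2 * t powr (3/4) * (1 - t) powr (3/4)))"
      using T'[of 2 1 2] T(2) by simp
    show "C = (LBINT t:{0<..<1}. elliptic_K (sqrt (1 - t)) * elliptic_K (sqrt t) ^ 2 / (2 * t powr (3/4) * (1 - t) powr (3/4)))"
      using T'[of 1 2 2] T(3) by simp
    show "complex_of_real C = complex_of_real (sqrt 2 * pi ^ 3 / 48) *
         (LBINT x:{-1<..<1}. legendre_P (-1/2) x ^ 3 / complex_of_real ((1 - x\<^sup>2) powr (3/4)))"
      using P[of 3 0] L(1) by (simp add: C)
    show "complex_of_real C = complex_of_real (sqrt 2 * pi ^ 3 / 16) *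
         (LBINT x:{-1<..<1}. legendre_P (-1/2) x ^ 2 * legendre_P (-1/2) (- x) / complex_of_real ((1 - x\<^sup>2) powr (3/4)))"
      using P[of 2 1] L(2) by (simp add: C)
    show "complex_of_real C = complex_of_real (sqrt 2 * pi ^ 3 / 16) *
         (LBINT x:{-1<..<1}. legendre_P (-1/2) x * legendre_P (-1/2) (- x) ^ 2 / complex_of_real ((1 - x\<^sup>2) powr (3/4)))"
      using P[of 1 2] L(3) by (simp add: C)
  qed
next
  case 2
  show ?case
    using legendre_triple_integrable legendre_identity unfolding legI3_def legI21_def by blast
qed

end
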